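(* Let $K$ be a number field, $E$ an elliptic curve over $K$ given by a Weierstrass equation, and $p\geq 5$ a prime. Let $P_1=(x_1,y_1)$, $P_2=(x_2,y_2)$ be a $\mathbb{Z}/p\mathbb{Z}$-basis of $E[p]$ such that every $\sigma\in\mathrm{Gal}(K(E[p])/K)$ satisfies $\sigma(P_1)=aP_1$ and $\sigma(P_2)=bP_1+cP_2$ for some $a,c\in(\mathbb{Z}/p\mathbb{Z})^\times$, $b\in\mathbb{Z}/p\mathbb{Z}$ (i.e., the Galois group is contained in the Borel subgroup of upper triangular matrices with respect to this basis). Let $\zeta_p$ be a primitive $p$-th root of unity and $K_p:=K(E[p])$. Then: (1) if $p\not\equiv 1\pmod 3$, then $K_p=K(\zeta_p,y_2)$; (2) if $p\equiv 1\pmod 3$, then $[K_p:K(\zeta_p,y_2)]$ is $1$ or $3$.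
   Context: $E[p]$ is the $p$-torsion subgroup of $E(\overline{K})$; $K(E[p])$ is the field obtained from $K$ by adjoining the coordinates of all points of $E[p]$. *)

theory Defs
  imports "HOL-Algebra.Algebraic_Closure_Type" "HOL-Algebra.Generated_Fields" "HOL-Number_Theory.Cong"
begin

section \<open>Fields\<close>

text \<open>All fields live in one ambient field type of characteristic 0, viewed as a
  HOL-Algebra ring; in the theorem this type is an algebraic closure of the base field.\<close>

abbreviation ambient :: "'a :: field_char_0 ring" where
  "ambient \<equiv> ring_of_type_algebra"

definition number_field :: "'a :: field_char_0 set \<Rightarrow> bool" where
  "number_field K \<longleftrightarrow> subfield K ambient \<and> ring.finite_dimension ambient \<rat> K"

definition adjoin :: "'a :: field_char_0 set \<Rightarrow> 'a set \<Rightarrow> 'a set" where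
  "adjoin K S = generate_field ambient (K \<union> S)"

definition has_degree :: "'a :: field_char_0 set \<Rightarrow> 'a set \<Rightarrow> nat \<Rightarrow> bool" where
  "has_degree L F n \<longleftrightarrow> ring.dimension ambient n F L"

text \<open>Automorphisms are made extensional so that each one is represented exactly once.\<close>

definition Gal :: "'a :: field_char_0 set \<Rightarrow> 'a set \<Rightarrow> ('a \<Rightarrow> 'a) set" where
  "Gal L K = {\<sigma> \<in> extensional L.
     \<sigma> \<in> ring_iso (ambient\<lparr>carrier := L\<rparr>) (ambient\<lparr>carrier := L\<rparr>) \<and> (\<forall>x\<in>K. \<sigma> x = x)}"

definition primitive_root_of_unity :: "nat \<Rightarrow> 'a :: field \<Rightarrow> bool" where
  "primitive_root_of_unity n \<zeta> \<longleftrightarrow> n > 0 \<and> \<zeta> ^ n = 1 \<and> (\<forall>k. 0 < k \<and> k < n \<longrightarrow> \<zeta> ^ k \<noteq> 1)"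


section \<open>Elliptic curves in general Weierstrass form\<close>

text \<open>The curve \<open>y\<^sup>2 + a1 x y + a3 y = x\<^sup>3 + a2 x\<^sup>2 + a4 x + a6\<close>.\<close>

datatype 'a weierstrass = Weierstrass (a1: 'a) (a2: 'a) (a3: 'a) (a4: 'a) (a6: 'a)

definition discriminant :: "'a :: field weierstrass \<Rightarrow> 'a" where
  "discriminant E =
     (let b2 = a1 E ^ 2 + 4 * a2 E;
          b4 = 2 * a4 E + a1 E * a3 E;
          b6 = a3 E ^ 2 + 4 * a6 E;
          b8 = a1 E ^ 2 * a6 E + 4 * a2 E * a6 E - a1 E * a3 E * a4 E + a2 E * a3 E ^ 2 - a4 E ^ 2
      in - (b2 ^ 2 * b8) - 8 * b4 ^ 3 - 27 * b6 ^ 2 + 9 * b2 * b4 * b6)"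

definition elliptic_curve_over :: "'a :: field set \<Rightarrow> 'a weierstrass \<Rightarrow> bool" where
  "elliptic_curve_over K E \<longleftrightarrow> set_weierstrass E \<subseteq> K \<and> discriminant E \<noteq> 0"

datatype 'a point = Infinity | Affine 'a 'a

text \<open>The points over the whole ambient field.\<close>

definition points :: "'a :: field weierstrass \<Rightarrow> 'a point set" where
  "points E = insert Infinity
     {Affine x y | x y.
        y ^ 2 + a1 E * x * y + a3 E * y = x ^ 3 + a2 E * x ^ 2 + a4 E * x + a6 E}"

text \<open>The chord-tangent law: the line through the two points (the tangent line if they
  coincide) is \<open>y = l x + v\<close>, and the third intersection point with the curve is negated
  by \<open>(x, y) \<mapsto> (x, - y - a1 x - a3)\<close>.\<close>

fun point_add :: "'a :: field weierstrass \<Rightarrow> 'a point \<Rightarrow> 'a point \<Rightarrow> 'a point" where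
  "point_add E Infinity Q = Q"
| "point_add E P Infinity = P"
| "point_add E (Affine x1 y1) (Affine x2 y2) =
     (if x1 = x2 \<and> y1 + y2 + a1 E * x2 + a3 E = 0 then Infinity
      else
        let l = (if x1 = x2
                 then (3 * x1 ^ 2 + 2 * a2 E * x1 + a4 E - a1 E * y1) / (2 * y1 + a1 E * x1 + a3 E)
                 else (y2 - y1) / (x2 - x1));
            v = y1 - l * x1;
            x3 = l ^ 2 + a1 E * l - a2 E - x1 - x2
        in Affine x3 (- (l + a1 E) * x3 - v - a3 E))"

definition point_mult :: "'a :: field weierstrass \<Rightarrow> nat \<Rightarrow> 'a point \<Rightarrow> 'a point" where
  "point_mult E n P = (point_add E P ^^ n) Infinity"

definition torsion :: "'a :: field weierstrass \<Rightarrow> nat \<Rightarrow> 'a point set" where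
  "torsion E n = {P \<in> points E. point_mult E n P = Infinity}"

text \<open>Scalars in \<open>\<int>/p\<int>\<close> are represented by natural numbers.\<close>

definition torsion_basis :: "'a :: field weierstrass \<Rightarrow> nat \<Rightarrow> 'a point \<Rightarrow> 'a point \<Rightarrow> bool" where
  "torsion_basis E p P1 P2 \<longleftrightarrow> P1 \<in> torsion E p \<and> P2 \<in> torsion E p
     \<and> (\<forall>Q\<in>torsion E p. \<exists>m n. Q = point_add E (point_mult E m P1) (point_mult E n P2))
     \<and> (\<forall>m n. point_add E (point_mult E m P1) (point_mult E n P2) = Infinity
           \<longrightarrow> p dvd m \<and> p dvd n)"

text \<open>\<open>K(E[n])\<close>; the set of coordinates of \<open>Infinity\<close> is empty.\<close>

definition torsion_field :: "'a :: field_char_0 set \<Rightarrow> 'a weierstrass \<Rightarrow> nat \<Rightarrow> 'a set" where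
  "torsion_field K E n = adjoin K (\<Union>Q\<in>torsion E n. set_point Q)"

end

theory Submission
  imports Defs "HOL-Number_Theory.Residues"
begin

text \<open>
  Write \<open>\<sigma> P\<^sub>1 = a P\<^sub>1\<close> and \<open>\<sigma> P\<^sub>2 = b P\<^sub>1 + c P\<^sub>2\<close>.  If \<open>\<sigma>\<close> fixes \<open>y\<^sub>2\<close>, the orbit of \<open>P\<^sub>2\<close> lies on the line
  \<open>y = y\<^sub>2\<close>, so it has at most three elements, and three distinct points of this line sum to zero,
  which forces \<open>1 + c + c\<^sup>2 = 0\<close> modulo \<open>p\<close>.  Orbits of length two, and \<open>\<sigma> \<noteq> 1\<close> with \<open>\<sigma> P\<^sub>2 = P\<^sub>2\<close>,
  are excluded by the Galois equivariance of the Weil pairing.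

  Only a fragment of the Weil pairing is needed.  Let \<open>C\<close> be the subgroup generated by \<open>P\<^sub>1\<close>.  The
  functions with at most simple poles, all in \<open>C\<close>, are the combinations of \<open>1\<close> and the slopes
  \<open>X \<mapsto> slope X T\<close> with \<open>T \<in> C\<close>; up to scalars exactly one of them vanishes on \<open>P\<^sub>2 + C\<close>.
  Translation by \<open>P\<^sub>1\<close> multiplies it by a constant \<open>t\<close> with \<open>t\<^sup>p = 1\<close>.  If \<open>t\<close> were \<open>1\<close>, all \<open>p\<close>
  residues would agree, and as they sum to zero they would vanish.  Transporting the function by
  \<open>\<sigma>\<close> gives \<open>\<sigma> t = t\<^sup>a\<close> when \<open>c = 1\<close> and \<open>\<sigma> t = t\<^sup>-\<^sup>a\<close> when \<open>c = -1\<close>.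
\<close>

section \<open>The group law on a short Weierstrass curve\<close>

text \<open>An orbit of length two gives c^2 = 1 and b (a + c) = 0 modulo p. Once \<sigma> fixes the
  root of unity, the pairing yields a = c = 1 or a = c = -1, hence 2 b = 0 and \<sigma> sends P2 to
  P2 or to -P2; both have abscissa x2, so x2 would be fixed. Only c = 1 and c = -1 therefore matter,
  and these are the cases in which \<sigma>, or \<sigma> followed by negation, preserves the coset
  P2 + C; this is why one function can stand in for the whole pairing. That function exists because
  the points of P2 + C and those of C have the same sum, and it is unique because a combination
  without a pole at infinity would have p zeros but at most p - 1 poles. Divisors are avoided by
  working with pairs of polynomials A + B y and degrees of norms. Translation requires a rule for
  the slope between Y + P1 and T; it comes out of the same interpolation argument that proves
  associativity. Galois theory enters through one fact: an element outside a field F containing K is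
  moved by some automorphism that fixes F.\<close>

locale short_curve =
  fixes a b :: "'a :: field_char_0"
  assumes nonsingular: "4 * a ^ 3 + 27 * b ^ 2 \<noteq> 0"
begin

definition curve :: "'a weierstrass" where
  "curve = Weierstrass 0 0 0 a b"

abbreviation add (infixl "\<oplus>\<oplus>" 65) where
  "P \<oplus>\<oplus> Q \<equiv> point_add curve P Q"

fun neg :: "'a point \<Rightarrow> 'a point" where
  "neg Infinity = Infinity"
| "neg (Affine x y) = Affine x (- y)"

fun slope :: "'a point \<Rightarrow> 'a point \<Rightarrow> 'a" where
  "slope (Affine x1 y1) (Affine x2 y2) =
     (if x1 = x2 then (3 * x1 ^ 2 + a) / (2 * y1) else (y2 - y1) / (x2 - x1))"
| "slope _ _ = 0"

text \<open>Vieta's relations say that the three points are the intersection of the curve with the line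
  \<open>y = l x + v\<close> counted with multiplicity; chords and tangents are thus treated alike.\<close>

definition coll :: "'a \<Rightarrow> 'a \<Rightarrow> 'a \<Rightarrow> 'a \<Rightarrow> 'a \<Rightarrow> 'a \<Rightarrow> 'a \<Rightarrow> 'a \<Rightarrow> bool" where
  "coll l v x1 y1 x2 y2 x3 y3 \<longleftrightarrow>
     y1 = l * x1 + v \<and> y2 = l * x2 + v \<and> y3 = l * x3 + v \<and>
     x1 + x2 + x3 = l ^ 2 \<and> x1 * x2 + x1 * x3 + x2 * x3 = a - 2 * l * v \<and>
     x1 * x2 * x3 = v ^ 2 - b"

abbreviation pts where "pts \<equiv> points curve"

lemma Affine_in_pts: "Affine x y \<in> pts \<longleftrightarrow> y ^ 2 = x ^ 3 + a * x + b"
  by (auto simp: points_def curve_def)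

lemma Infinity_in_pts [simp]: "Infinity \<in> pts"
  by (simp add: points_def)

lemma add_Infinity_right [simp]: "P \<oplus>\<oplus> Infinity = P"
  by (cases P) auto

lemma neg_neg [simp]: "neg (neg P) = P"
  by (cases P) auto

lemma neg_eq_iff: "neg P = Q \<longleftrightarrow> P = neg Q"
  by (cases P; cases Q) auto

lemma neg_eq_Infinity [simp]: "neg P = Infinity \<longleftrightarrow> P = Infinity"
  by (cases P) auto

lemma neg_in_pts [simp]: "neg P \<in> pts \<longleftrightarrow> P \<in> pts"
  by (cases P) (auto simp: Affine_in_pts)

lemma add_eq_Infinity: "P \<oplus>\<oplus> Q = Infinity \<longleftrightarrow> Q = neg P"
  by (cases P; cases Q) (auto simp: Let_def curve_def add_eq_0_iff2 add_eq_0_iff)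

lemma add_Affine:
  assumes "\<not> (x1 = x2 \<and> y2 = - y1)"
  shows "Affine x1 y1 \<oplus>\<oplus> Affine x2 y2 =
     (let l = slope (Affine x1 y1) (Affine x2 y2); x3 = l ^ 2 - x1 - x2
      in Affine x3 (l * (x1 - x3) - y1))"
  using assms by (auto simp: curve_def Let_def algebra_simps add_eq_0_iff)

lemma coll_perm:
  assumes "coll l v x1 y1 x2 y2 x3 y3"
  shows "coll l v x2 y2 x1 y1 x3 y3" and "coll l v x1 y1 x3 y3 x2 y2"
  using assms by (simp_all add: coll_def algebra_simps)

lemma coll_neg:
  "coll l v x1 y1 x2 y2 x3 y3 \<Longrightarrow> coll (- l) (- v) x1 (- y1) x2 (- y2) x3 (- y3)"
  by (simp add: coll_def)

lemma coll_in_pts: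
  assumes "coll l v x1 y1 x2 y2 x3 y3"
  shows "Affine x1 y1 \<in> pts" "Affine x2 y2 \<in> pts" "Affine x3 y3 \<in> pts"
proof -
  have *: "y1 ^ 2 = x1 ^ 3 + a * x1 + b" if "coll l v x1 y1 x2 y2 x3 y3" for x1 y1 x2 y2 x3 y3
    using that unfolding coll_def by Groebner_Basis.algebra
  show "Affine x1 y1 \<in> pts" "Affine x2 y2 \<in> pts" "Affine x3 y3 \<in> pts"
    using *[OF assms] *[OF coll_perm(1)[OF assms]]
      *[OF coll_perm(1)[OF coll_perm(2)[OF assms]]]
    by (simp_all add: Affine_in_pts)
qed

text \<open>The left side is the derivative at x1 of x^3 + a x + b - (l x + v)^2, which factors as
  (x - x1)(x - x2)(x - x3) by Vieta.\<close>

lemma coll_tangent: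
  assumes "coll l v x1 y1 x2 y2 x3 y3"
  shows "3 * x1 ^ 2 + a - 2 * l * y1 = (x1 - x2) * (x1 - x3)"
  using assms unfolding coll_def by Groebner_Basis.algebra

lemma nonsingular_point:
  assumes "Affine x 0 \<in> pts"
  shows "3 * x ^ 2 + a \<noteq> 0"
proof
  assume h: "3 * x ^ 2 + a = 0"
  have "x ^ 3 + a * x + b = 0" using assms by (simp add: Affine_in_pts)
  with h have "4 * a ^ 3 + 27 * b ^ 2 = 0" by Groebner_Basis.algebra
  with nonsingular show False by simp
qed

text \<open>\<open>coll\<close> determines the line, so the case distinction in \<open>slope\<close>
  is resolved once here. In the tangent case y1 = 0 would make x1 a double root of x^3 + a x + b,
  against nonsingularity.\<close>

lemma coll_slope:
  assumes "coll l v x1 y1 x2 y2 x3 y3"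
  shows "\<not> (x1 = x2 \<and> y2 = - y1)" "slope (Affine x1 y1) (Affine x2 y2) = l"
proof -
  have y: "y1 = l * x1 + v" "y2 = l * x2 + v" using assms by (auto simp: coll_def)
  have nz: "y1 \<noteq> 0" if "x1 = x2"
    using coll_tangent[OF assms] nonsingular_point[of x1] coll_in_pts(1)[OF assms] that by auto
  show "\<not> (x1 = x2 \<and> y2 = - y1)"
  proof
    assume "x1 = x2 \<and> y2 = - y1"
    with y have "2 * y1 = 0" by Groebner_Basis.algebra
    with nz \<open>x1 = x2 \<and> _\<close> show False by simp
  qed
  show "slope (Affine x1 y1) (Affine x2 y2) = l"
  proof (cases "x1 = x2")
    case True
    with coll_tangent[OF assms] have "3 * x1 ^ 2 + a = l * (2 * y1)" by (simp add: algebra_simps)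
    with True nz show ?thesis by (simp add: field_simps)
  next
    case False
    have "y2 - y1 = l * (x2 - x1)" using y by (simp add: algebra_simps)
    with False show ?thesis by (simp add: field_simps)
  qed
qed

lemma coll_add:
  assumes "coll l v x1 y1 x2 y2 x3 y3"
  shows "Affine x1 y1 \<oplus>\<oplus> Affine x2 y2 = Affine x3 (- y3)"
proof -
  have "x3 = l ^ 2 - x1 - x2" "- y3 = l * (x1 - x3) - y1"
    using assms by (auto simp: coll_def algebra_simps)
  then show ?thesis
    by (simp only: add_Affine[OF coll_slope(1)[OF assms]] coll_slope(2)[OF assms] Let_def)
qed

lemma add_coll:
  assumes "Affine x1 y1 \<in> pts" "Affine x2 y2 \<in> pts" "\<not> (x1 = x2 \<and> y2 = - y1)"
  obtains l v x3 y3 where "coll l v x1 y1 x2 y2 x3 y3"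
proof -
  define l where "l = slope (Affine x1 y1) (Affine x2 y2)"
  define v where "v = y1 - l * x1"
  define x3 where "x3 = l ^ 2 - x1 - x2"
  define y3 where "y3 = l * x3 + v"
  have e: "y1 ^ 2 = x1 ^ 3 + a * x1 + b" "y2 ^ 2 = x2 ^ 3 + a * x2 + b"
    using assms by (simp_all add: Affine_in_pts)
  have "coll l v x1 y1 x2 y2 x3 y3"
  proof (cases "x1 = x2")
    case True
    then have "y1 = y2 \<or> y1 = - y2" using e by (metis power2_eq_iff)
    with True assms(3) have y: "y1 = y2" "y1 \<noteq> 0" by auto
    then have l: "l * (2 * y1) = 3 * x1 ^ 2 + a" using True by (simp add: l_def)
    have "x1 * x2 + x1 * x3 + x2 * x3 = a - 2 * l * v" "x1 * x2 * x3 = v ^ 2 - b"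
      using e l True y(1) x3_def v_def by Groebner_Basis.algebra+
    then show ?thesis using True y by (simp add: coll_def y3_def v_def x3_def)
  next
    case False
    then have l: "l * (x2 - x1) = y2 - y1" by (simp add: l_def)
    \<comment> \<open>The chord slope is known only through l (x2 - x1) = y2 - y1, so the relations
      are first proved multiplied by x2 - x1.\<close>
    have "(x2 - x1) * (x1 * x2 + x1 * x3 + x2 * x3 - (a - 2 * l * v)) = 0"
      using e l x3_def v_def by Groebner_Basis.algebra
    moreover have "(x2 - x1) * (x1 * x2 * x3 - (v ^ 2 - b)) = 0"
      using e l x3_def v_def by Groebner_Basis.algebra
    ultimately have "x1 * x2 + x1 * x3 + x2 * x3 = a - 2 * l * v" "x1 * x2 * x3 = v ^ 2 - b"
      using False by auto
    moreover have "y2 = l * x2 + v" using l v_def by Groebner_Basis.algebra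
    ultimately show ?thesis by (simp add: coll_def y3_def v_def x3_def)
  qed
  then show ?thesis by (rule that)
qed

lemma add_in_pts [simp]:
  assumes "P \<in> pts" "Q \<in> pts"
  shows "P \<oplus>\<oplus> Q \<in> pts"
proof (cases "P = Infinity \<or> Q = Infinity \<or> Q = neg P")
  case True
  then show ?thesis using assms by (auto simp: add_eq_Infinity[THEN iffD2])
next
  case False
  then obtain x1 y1 x2 y2 where [simp]: "P = Affine x1 y1" "Q = Affine x2 y2"
    by (cases P; cases Q) auto
  obtain l v x3 y3 where c: "coll l v x1 y1 x2 y2 x3 y3"
    using add_coll assms False by (metis \<open>P = Affine x1 y1\<close> \<open>Q = Affine x2 y2\<close> neg.simps(2))
  have "Affine x3 (- y3) \<in> pts" using coll_in_pts(3)[OF c] by (simp add: Affine_in_pts)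
  then show ?thesis using coll_add[OF c] by simp
qed

lemma add_commute:
  assumes "P \<in> pts" "Q \<in> pts"
  shows "P \<oplus>\<oplus> Q = Q \<oplus>\<oplus> P"
proof (cases "P = Infinity \<or> Q = Infinity \<or> Q = neg P")
  case True
  then show ?thesis by (auto simp: add_eq_Infinity[THEN iffD2])
next
  case False
  then obtain x1 y1 x2 y2 where [simp]: "P = Affine x1 y1" "Q = Affine x2 y2"
    by (cases P; cases Q) auto
  obtain l v x3 y3 where c: "coll l v x1 y1 x2 y2 x3 y3"
    using add_coll assms False by (metis \<open>P = Affine x1 y1\<close> \<open>Q = Affine x2 y2\<close> neg.simps(2))
  show ?thesis using coll_add[OF c] coll_add[OF coll_perm(1)[OF c]] by simp
qed

lemma slope_commute:
  assumes "P \<in> pts" "Q \<in> pts" "Q \<noteq> neg P"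
  shows "slope P Q = slope Q P"
proof (cases "P = Infinity \<or> Q = Infinity")
  case True
  then show ?thesis by (cases P; cases Q) auto
next
  case False
  then obtain x1 y1 x2 y2 where [simp]: "P = Affine x1 y1" "Q = Affine x2 y2"
    by (cases P; cases Q) auto
  obtain l v x3 y3 where c: "coll l v x1 y1 x2 y2 x3 y3"
    using add_coll assms False by (metis \<open>P = Affine x1 y1\<close> \<open>Q = Affine x2 y2\<close> neg.simps(2))
  show ?thesis using coll_slope[OF c] coll_slope[OF coll_perm(1)[OF c]] by simp
qed

lemma neg_add:
  assumes "P \<in> pts" "Q \<in> pts"
  shows "neg (P \<oplus>\<oplus> Q) = neg P \<oplus>\<oplus> neg Q"
proof (cases "P = Infinity \<or> Q = Infinity \<or> Q = neg P")
  case True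
  then show ?thesis by (auto simp: add_eq_Infinity[THEN iffD2])
next
  case False
  then obtain x1 y1 x2 y2 where [simp]: "P = Affine x1 y1" "Q = Affine x2 y2"
    by (cases P; cases Q) auto
  obtain l v x3 y3 where c: "coll l v x1 y1 x2 y2 x3 y3"
    using add_coll assms False by (metis \<open>P = Affine x1 y1\<close> \<open>Q = Affine x2 y2\<close> neg.simps(2))
  show ?thesis using coll_add[OF c] coll_add[OF coll_neg[OF c]] by simp
qed

lemma neg_add_cancel:
  assumes "P \<in> pts" "Q \<in> pts"
  shows "neg P \<oplus>\<oplus> (P \<oplus>\<oplus> Q) = Q"
proof (cases "P = Infinity \<or> Q = Infinity \<or> Q = neg P")
  case True
  then show ?thesis by (auto simp: add_eq_Infinity[THEN iffD2] add_eq_Infinity)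
next
  case False
  then obtain x1 y1 x2 y2 where [simp]: "P = Affine x1 y1" "Q = Affine x2 y2"
    by (cases P; cases Q) auto
  obtain l v x3 y3 where c: "coll l v x1 y1 x2 y2 x3 y3"
    using add_coll assms False by (metis \<open>P = Affine x1 y1\<close> \<open>Q = Affine x2 y2\<close> neg.simps(2))
  show ?thesis using coll_add[OF c] coll_add[OF coll_neg[OF coll_perm(2)[OF c]]] by simp
qed

lemma slope_neg:
  assumes "P \<in> pts" "Q \<in> pts" "Q \<noteq> neg P"
  shows "slope (neg P) (neg Q) = - slope P Q"
proof (cases "P = Infinity \<or> Q = Infinity")
  case True
  then show ?thesis by (cases P; cases Q) auto
next
  case False
  then obtain x1 y1 x2 y2 where [simp]: "P = Affine x1 y1" "Q = Affine x2 y2"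
    by (cases P; cases Q) auto
  obtain l v x3 y3 where c: "coll l v x1 y1 x2 y2 x3 y3"
    using add_coll assms False by (metis \<open>P = Affine x1 y1\<close> \<open>Q = Affine x2 y2\<close> neg.simps(2))
  show ?thesis using coll_slope(2)[OF c] coll_slope(2)[OF coll_neg[OF c]] by simp
qed

text \<open>P, Q and -(P + Q) are collinear; the mirrored line carries P + Q, -Q and -P and has the
  opposite slope.\<close>

lemma slope_add_neg:
  assumes "P \<in> pts" "Q \<in> pts" "P \<noteq> Infinity" "Q \<noteq> Infinity" "Q \<noteq> neg P"
  shows "slope (P \<oplus>\<oplus> Q) (neg Q) = - slope P Q"
proof -
  obtain x1 y1 x2 y2 where [simp]: "P = Affine x1 y1" "Q = Affine x2 y2"
    using assms by (cases P; cases Q) auto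
  obtain l v x3 y3 where c: "coll l v x1 y1 x2 y2 x3 y3"
    using add_coll assms by (metis \<open>P = Affine x1 y1\<close> \<open>Q = Affine x2 y2\<close> neg.simps(2))
  have c': "coll (- l) (- v) x3 (- y3) x2 (- y2) x1 (- y1)"
    using c by (intro coll_neg) (simp add: coll_def algebra_simps)
  show ?thesis using coll_add[OF c] coll_slope(2)[OF c] coll_slope(2)[OF c'] by simp
qed

text \<open>The product of the line through \<open>A\<close>, \<open>M\<close> and the line through \<open>A + M\<close>, \<open>B\<close> is, up to the
  vertical line through \<open>A + M\<close>, the function \<open>x\<^sup>2 + \<alpha> x + \<beta> - w y\<close>, where \<open>w\<close> is the sum of the
  two slopes.  Interpolation shows that it only depends on \<open>A\<close>, \<open>M\<close> and \<open>B\<close>.\<close>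

lemma two_lines:
  assumes c: "coll l v xA yA xM yM xS (- yS)" and d: "coll m u xS yS xB yB xQ yQ"
  defines "w \<equiv> l + m" and "\<alpha> \<equiv> xS + l * m" and "\<beta> \<equiv> xS ^ 2 + a - l * m * xS + yS * (l - m)"
  shows "xA ^ 2 + \<alpha> * xA + \<beta> = w * yA" "xM ^ 2 + \<alpha> * xM + \<beta> = w * yM"
    "xB ^ 2 + \<alpha> * xB + \<beta> = w * yB" "xQ ^ 2 + \<alpha> * xQ + \<beta> = w * yQ"
    "xA + xM + xB + xQ = w ^ 2 - 2 * \<alpha>"
proof -
  have S: "yS ^ 2 = xS ^ 3 + a * xS + b"
    using coll_in_pts(1)[OF d] by (simp add: Affine_in_pts)
  have 1: "xA ^ 2 + \<alpha> * xA + \<beta> = w * yA" if c: "coll l v xA yA xM yM xS (- yS)" for xA yA xM yM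
  proof (cases "xA = xS")
    case True
    have "yA = - yS" using c True by (simp add: coll_def)
    then show ?thesis using coll_tangent[OF c] True unfolding \<alpha>_def \<beta>_def w_def
      by (simp add: algebra_simps power2_eq_square)
  next
    case False
    have A: "yA ^ 2 = xA ^ 3 + a * xA + b"
      using coll_in_pts(1)[OF c] by (simp add: Affine_in_pts)
    have "yA = l * (xA - xS) - yS" using c unfolding coll_def by Groebner_Basis.algebra
    then have "(xA - xS) * (xA ^ 2 + \<alpha> * xA + \<beta> - w * yA) = 0"
      using A S \<alpha>_def \<beta>_def w_def by Groebner_Basis.algebra
    with False show ?thesis by simp
  qed
  have 2: "xB ^ 2 + \<alpha> * xB + \<beta> = w * yB" if d: "coll m u xS yS xB yB xQ yQ" for xB yB xQ yQ
  proof (cases "xB = xS")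
    case True
    have "yB = yS" using d True by (simp add: coll_def)
    then show ?thesis using coll_tangent[OF d] True unfolding \<alpha>_def \<beta>_def w_def
      by (simp add: algebra_simps power2_eq_square)
  next
    case False
    have B: "yB ^ 2 = xB ^ 3 + a * xB + b"
      using coll_in_pts(2)[OF d] by (simp add: Affine_in_pts)
    have "yB = m * (xB - xS) + yS" using d unfolding coll_def by Groebner_Basis.algebra
    then have "(xB - xS) * (xB ^ 2 + \<alpha> * xB + \<beta> - w * yB) = 0"
      using B S \<alpha>_def \<beta>_def w_def by Groebner_Basis.algebra
    with False show ?thesis by simp
  qed
  show "xA ^ 2 + \<alpha> * xA + \<beta> = w * yA" "xM ^ 2 + \<alpha> * xM + \<beta> = w * yM"
    using 1[OF c] 1[OF coll_perm(1)[OF c]] .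
  show "xB ^ 2 + \<alpha> * xB + \<beta> = w * yB" "xQ ^ 2 + \<alpha> * xQ + \<beta> = w * yQ"
    using 2[OF d] 2[OF coll_perm(2)[OF d]] .
  show "xA + xM + xB + xQ = w ^ 2 - 2 * \<alpha>"
    using c d \<alpha>_def \<beta>_def w_def unfolding coll_def by Groebner_Basis.algebra
qed

lemma add_assoc_distinct:
  assumes "A \<in> pts" "M \<in> pts" "B \<in> pts" "A \<noteq> Infinity" "M \<noteq> Infinity" "B \<noteq> Infinity"
    and ne: "A \<noteq> neg M" "M \<noteq> neg B" "A \<oplus>\<oplus> M \<noteq> neg B" "M \<oplus>\<oplus> B \<noteq> neg A"
    and dist: "M \<noteq> B" "A \<noteq> B" "A \<noteq> neg B"
  shows "(A \<oplus>\<oplus> M) \<oplus>\<oplus> B = A \<oplus>\<oplus> (M \<oplus>\<oplus> B)"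
    "slope A M + slope (A \<oplus>\<oplus> M) B = slope M B + slope A (M \<oplus>\<oplus> B)"
proof -
  obtain xA yA xM yM xB yB where [simp]: "A = Affine xA yA" "M = Affine xM yM" "B = Affine xB yB"
    using assms by (cases A; cases M; cases B) auto
  have on: "yA ^ 2 = xA ^ 3 + a * xA + b" "yM ^ 2 = xM ^ 3 + a * xM + b" "yB ^ 2 = xB ^ 3 + a * xB + b"
    using assms by (simp_all add: Affine_in_pts)
  have eqx: "y = y' \<or> y = - y'" if "y ^ 2 = x ^ 3 + a * x + b" "y' ^ 2 = x ^ 3 + a * x + b" for x y y'
    using that by (metis power2_eq_iff)
  have xs: "xM \<noteq> xB" "xA \<noteq> xB" using eqx on ne dist by auto
  obtain l v xS yS' where c': "coll l v xA yA xM yM xS yS'"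
    using add_coll assms by (metis \<open>A = _\<close> \<open>M = _\<close> neg.simps(2) neg_eq_iff)
  define yS where "yS = - yS'"
  have c: "coll l v xA yA xM yM xS (- yS)" using c' by (simp add: yS_def)
  have S: "A \<oplus>\<oplus> M = Affine xS yS" "slope A M = l" using coll_add[OF c] coll_slope(2)[OF c] by auto
  obtain m u xQ yQ where d: "coll m u xS yS xB yB xQ yQ"
  proof -
    have "Affine xS yS \<in> pts" using add_in_pts[of A M] assms S by simp
    then show ?thesis using add_coll assms S that by (metis \<open>B = _\<close> neg.simps(2) neg_eq_iff)
  qed
  have Q: "(A \<oplus>\<oplus> M) \<oplus>\<oplus> B = Affine xQ (- yQ)" "slope (A \<oplus>\<oplus> M) B = m"
    using coll_add[OF d] coll_slope(2)[OF d] S by auto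
  obtain l' v' xT yT' where c2': "coll l' v' xM yM xB yB xT yT'"
    using add_coll assms by (metis \<open>B = _\<close> \<open>M = _\<close> neg.simps(2) neg_eq_iff)
  define yT where "yT = - yT'"
  have c2: "coll l' v' xM yM xB yB xT (- yT)" using c2' by (simp add: yT_def)
  have T: "M \<oplus>\<oplus> B = Affine xT yT" "slope M B = l'" using coll_add[OF c2] coll_slope(2)[OF c2] by auto
  obtain m' u' xR yR where d2: "coll m' u' xT yT xA yA xR yR"
  proof -
    have "Affine xT yT \<in> pts" using add_in_pts[of M B] assms T by simp
    then show ?thesis using add_coll assms T that by (metis \<open>A = _\<close> neg.simps(2) neg_eq_iff)
  qed
  have R: "A \<oplus>\<oplus> (M \<oplus>\<oplus> B) = Affine xR (- yR)" "slope A (M \<oplus>\<oplus> B) = m'"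
    using coll_add[OF coll_perm(1)[OF d2]] coll_slope(2)[OF coll_perm(1)[OF d2]] T by auto
  define w \<alpha> \<beta> where "w = l + m" and "\<alpha> = xS + l * m" and "\<beta> = xS ^ 2 + a - l * m * xS + yS * (l - m)"
  note H = two_lines[OF c d, folded w_def \<alpha>_def \<beta>_def]
  define w' \<alpha>' \<beta>' where "w' = l' + m'" and "\<alpha>' = xT + l' * m'"
    and "\<beta>' = xT ^ 2 + a - l' * m' * xT + yT * (l' - m')"
  note H' = two_lines[OF c2 d2, folded w'_def \<alpha>'_def \<beta>'_def]
  have lAM: "l * (xM - xA) = yM - yA" using c unfolding coll_def by Groebner_Basis.algebra
  \<comment> \<open>If A = M, a double zero replaces two zeros: the derivative of x^2 + \<alpha> x +
    \<beta> - w y along the tangent of slope l vanishes.\<close>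
  have der: "2 * xA + \<alpha> = w * l \<and> 2 * xA + \<alpha>' = w' * l" if "xA = xM"
  proof
    have yAM: "yA = yM" using that eqx on ne by auto
    have yA0: "yA \<noteq> 0" using coll_slope(1)[OF c] that yAM by auto
    show "2 * xA + \<alpha> = w * l"
      using c that unfolding coll_def \<alpha>_def w_def by Groebner_Basis.algebra
    have tl: "2 * l * yA = 3 * xA ^ 2 + a" using coll_tangent[OF c] that by simp
    have T2: "xA \<noteq> xT"
    proof
      assume "xA = xT"
      have pT: "Affine xT yT \<in> pts" using add_in_pts[of M B] assms T by simp
      have "Affine xT yT = A \<or> Affine xT yT = neg A"
        using pT \<open>xA = xT\<close> eqx on by (auto simp: Affine_in_pts)
      then have "M \<oplus>\<oplus> B = M" using ne(4) T that yAM by auto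
      then have "neg M \<oplus>\<oplus> M = B" using neg_add_cancel[of M B] assms by auto
      then have "B = Infinity" using add_eq_Infinity[of "neg M" M] by simp
      then show False using assms by simp
    qed
    have e1: "l' * (xA - xT) = yA + yT" "m' * (xA - xT) = yA - yT"
      using c2 d2 that yAM unfolding coll_def by Groebner_Basis.algebra+
    have onT: "yT ^ 2 = xT ^ 3 + a * xT + b"
      using coll_in_pts(1)[OF d2] by (simp add: Affine_in_pts)
    have "(xA - xT) * ((xA - xT) * (2 * xA + \<alpha>' - w' * l)) = 0"
      using e1 onT on(1) tl w'_def \<alpha>'_def by Groebner_Basis.algebra
    then show "2 * xA + \<alpha>' = w' * l" using T2 by simp
  qed
  \<comment> \<open>Otherwise the difference of the two functions is, up to a scalar, a line through
    A, M and B, which means A + M = -B.\<close>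
  have ww: "w = w'"
  proof (rule ccontr)
    assume w: "w \<noteq> w'"
    define k where "k = (\<alpha> - \<alpha>') / (w - w')"
    have k: "\<alpha> - \<alpha>' = k * (w - w')" using w by (simp add: k_def)
    have "(w - w') * (yA - yB - k * (xA - xB)) = 0" using H(1,3) H'(3,2) k by Groebner_Basis.algebra
    then have AB: "yA - yB = k * (xA - xB)" using w by simp
    have "k = l"
    proof (cases "xA = xM")
      case True
      have "2 * xA + \<alpha> = w * l" "2 * xA + \<alpha>' = w' * l" using der True by auto
      with k have "(w - w') * (k - l) = 0" by Groebner_Basis.algebra
      with w show ?thesis by simp
    next
      case False
      have "(w - w') * (yA - yM - k * (xA - xM)) = 0" using H(1,2) H'(3,1) k by Groebner_Basis.algebra
      then have "yA - yM = k * (xA - xM)" using w by simp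
      with lAM have "(xM - xA) * (k - l) = 0" by Groebner_Basis.algebra
      with False show ?thesis by simp
    qed
    have "coll l v xA yA xM yM xB yB"
    proof -
      have "(xB - xA) * ((xB - xM) * (xB - xS)) = 0"
      proof -
        have "yB = l * xB + v" using AB \<open>k = l\<close> c unfolding coll_def by Groebner_Basis.algebra
        then show ?thesis using on(3) c unfolding coll_def by Groebner_Basis.algebra
      qed
      then have "xB = xS" using xs by auto
      moreover have "yB = - yS" using AB \<open>k = l\<close> c \<open>xB = xS\<close> unfolding coll_def by Groebner_Basis.algebra
      ultimately show ?thesis using c by simp
    qed
    then have "A \<oplus>\<oplus> M = neg B" using coll_add by fastforce
    with ne show False by simp
  qed
  have aa: "\<alpha> = \<alpha>'"
  proof -
    have "(\<alpha> - \<alpha>') * (xA - xB) = 0" using H(1,3) H'(3,2) ww by Groebner_Basis.algebra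
    with xs show ?thesis by simp
  qed
  have bb: "\<beta> = \<beta>'" using H(1) H'(3) ww aa by Groebner_Basis.algebra
  \<comment> \<open>With w = 0 a monic quadratic in x would have the roots xA, xM and xB counted
    with multiplicity, one too many.\<close>
  have w0: "w \<noteq> 0"
  proof
    assume "w = 0"
    then have q: "xA ^ 2 + \<alpha> * xA + \<beta> = 0" "xM ^ 2 + \<alpha> * xM + \<beta> = 0" "xB ^ 2 + \<alpha> * xB + \<beta> = 0"
      using H by auto
    have "(xA - xB) * (xA + xB + \<alpha>) = 0" using q by Groebner_Basis.algebra
    then have s1: "xA + xB + \<alpha> = 0" using xs by simp
    have "(xM - xB) * (xM + xB + \<alpha>) = 0" using q by Groebner_Basis.algebra
    then have s2: "xM + xB + \<alpha> = 0" using xs by simp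
    have "xA = xM" using s1 s2 by Groebner_Basis.algebra
    with der \<open>w = 0\<close> have "2 * xA + \<alpha> = 0" by simp
    with s1 have "xA = xB" by Groebner_Basis.algebra
    with xs show False by simp
  qed
  have xQR: "xQ = xR" using H(5) H'(5) ww aa by Groebner_Basis.algebra
  have "w * yQ = w * yR" using H(4) H'(4) xQR ww aa bb by Groebner_Basis.algebra
  then have "yQ = yR" using w0 by simp
  then show "(A \<oplus>\<oplus> M) \<oplus>\<oplus> B = A \<oplus>\<oplus> (M \<oplus>\<oplus> B)" using xQR Q R by simp
  show "slope A M + slope (A \<oplus>\<oplus> M) B = slope M B + slope A (M \<oplus>\<oplus> B)"
    using ww S Q T R by (simp add: w_def w'_def)
qed

text \<open>Both sides are the coefficient w of the interpolating function. The identity expresses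
  the slope at the translate of A by M through slopes at A, which is what moves a sum of slopes
  under translation.\<close>

lemma slope_cocycle:
  assumes "A \<in> pts" "M \<in> pts" "B \<in> pts" "A \<noteq> Infinity" "M \<noteq> Infinity" "B \<noteq> Infinity"
    and ne: "A \<noteq> neg M" "M \<noteq> neg B" "A \<oplus>\<oplus> M \<noteq> neg B" "M \<oplus>\<oplus> B \<noteq> neg A" "A \<noteq> neg B" "A \<noteq> B"
  shows "slope A M + slope (A \<oplus>\<oplus> M) B = slope M B + slope A (M \<oplus>\<oplus> B)"
proof (cases "M = B")
  case True
  \<comment> \<open>\<open>add_assoc_distinct\<close> admits A = M but not M = B, so the triple is
    reversed to M, M, A.\<close>
  have "slope M M + slope (M \<oplus>\<oplus> M) A = slope M A + slope M (M \<oplus>\<oplus> A)"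
    using assms True by (intro add_assoc_distinct(2)) (auto simp: neg_eq_iff add_commute)
  moreover have "slope (M \<oplus>\<oplus> M) A = slope A (M \<oplus>\<oplus> M)"
    using assms True by (intro slope_commute) (auto simp: neg_eq_iff)
  moreover have "slope M A = slope A M"
    using assms True by (intro slope_commute) (auto simp: neg_eq_iff)
  moreover have "slope M (M \<oplus>\<oplus> A) = slope (A \<oplus>\<oplus> M) M"
    using assms True add_commute[of A M]
    by (subst slope_commute) (auto simp: neg_eq_iff)
  ultimately show ?thesis using True by simp
next
  case False
  then show ?thesis using assms by (intro add_assoc_distinct(2)) auto
qed

end

section \<open>Associativity through generic points, and the group of points\<close>

locale short_curve_closed = short_curve +
  assumes alg_closed: "\<And>q :: 'a poly. Polynomial.degree q > 0 \<Longrightarrow> \<exists>x. poly q x = 0"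
begin

lemma sqrt_exists: "\<exists>y :: 'a. y ^ 2 = z"
  using alg_closed[of "[:- z, 0, 1:]"] by (auto simp: power2_eq_square algebra_simps)

lemma generic_point:
  assumes "finite S"
  obtains Z where "Z \<in> pts" "Z \<notin> S"
proof -
  have "finite (set_point P)" for P :: "'a point" by (cases P) auto
  then obtain x :: 'a where x: "x \<notin> (\<Union>P\<in>S. set_point P)"
    using ex_new_if_finite[of "\<Union>P\<in>S. set_point P"] assms infinite_UNIV_char_0
    by (metis finite_UN)
  obtain y where "y ^ 2 = x ^ 3 + a * x + b" using sqrt_exists by blast
  then have "Affine x y \<in> pts" "Affine x y \<notin> S" using x by (auto simp: Affine_in_pts)
  then show ?thesis by (rule that)
qed

lemma add_assoc_generic:
  assumes "A \<in> pts" "M \<in> pts" "Z \<in> pts" "Z \<notin> {Infinity, A, neg A, M, neg M, neg (A \<oplus>\<oplus> M)}"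
  shows "(A \<oplus>\<oplus> M) \<oplus>\<oplus> Z = A \<oplus>\<oplus> (M \<oplus>\<oplus> Z)"
proof (cases "A = Infinity \<or> M = Infinity \<or> A = neg M")
  case True
  then show ?thesis
    using assms neg_add_cancel by (auto simp: add_eq_Infinity[THEN iffD2])
next
  case False
  have "Z = neg (A \<oplus>\<oplus> M)" if "M \<oplus>\<oplus> Z = neg A"
    using neg_add_cancel[of M Z] that assms by (simp add: neg_add add_commute)
  then show ?thesis using assms False
    by (intro add_assoc_distinct(1)) (auto simp: neg_eq_iff)
qed

lemma add_right_cancel:
  assumes "A \<in> pts" "B \<in> pts" "Z \<in> pts" "A \<oplus>\<oplus> Z = B \<oplus>\<oplus> Z"
  shows "A = B"
  using assms neg_add_cancel[of Z A] neg_add_cancel[of Z B] by (simp add: add_commute)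

text \<open>Adding a point is injective and only finitely many Z lead to a degenerate configuration,
  so both sides may be compared after adding a generic Z. Algebraic closedness supplies infinitely
  many points.\<close>

lemma add_assoc:
  assumes "P \<in> pts" "Q \<in> pts" "R \<in> pts"
  shows "(P \<oplus>\<oplus> Q) \<oplus>\<oplus> R = P \<oplus>\<oplus> (Q \<oplus>\<oplus> R)"
proof -
  define B where "B = (\<lambda>A M. {Infinity, A, neg A, M, neg M, neg (A \<oplus>\<oplus> M)})"
  have fin: "finite (B A M)" for A M by (simp add: B_def)
  \<comment> \<open>The triple P, Q, R + Z must be generic too, so the bad set of P and Q is
    excluded after translation by -R.\<close>
  obtain Z where Z: "Z \<in> pts"
    "Z \<notin> B (P \<oplus>\<oplus> Q) R \<union> (\<lambda>Y. neg R \<oplus>\<oplus> Y) ` B P Q \<union> B Q R \<union> B P (Q \<oplus>\<oplus> R)"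
    using generic_point fin by (metis finite_Un finite_imageI)
  have RZ: "R \<oplus>\<oplus> Z \<notin> B P Q"
  proof
    assume "R \<oplus>\<oplus> Z \<in> B P Q"
    then have "Z \<in> (\<lambda>Y. neg R \<oplus>\<oplus> Y) ` B P Q"
      using neg_add_cancel[of R Z] assms Z(1) by (metis imageI)
    with Z(2) show False by blast
  qed
  have "((P \<oplus>\<oplus> Q) \<oplus>\<oplus> R) \<oplus>\<oplus> Z = (P \<oplus>\<oplus> Q) \<oplus>\<oplus> (R \<oplus>\<oplus> Z)"
    using add_assoc_generic[of "P \<oplus>\<oplus> Q" R Z] Z assms by (simp add: B_def)
  also have "\<dots> = P \<oplus>\<oplus> (Q \<oplus>\<oplus> (R \<oplus>\<oplus> Z))"
    using add_assoc_generic[of P Q "R \<oplus>\<oplus> Z"] Z(1) RZ assms by (simp add: B_def)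
  also have "Q \<oplus>\<oplus> (R \<oplus>\<oplus> Z) = (Q \<oplus>\<oplus> R) \<oplus>\<oplus> Z"
    using add_assoc_generic[of Q R Z] Z assms by (simp add: B_def)
  also have "P \<oplus>\<oplus> ((Q \<oplus>\<oplus> R) \<oplus>\<oplus> Z) = (P \<oplus>\<oplus> (Q \<oplus>\<oplus> R)) \<oplus>\<oplus> Z"
    using add_assoc_generic[of P "Q \<oplus>\<oplus> R" Z] Z assms by (simp add: B_def)
  finally show ?thesis using add_right_cancel assms Z(1) by (meson add_in_pts)
qed

definition G :: "'a point monoid" where
  "G = \<lparr>carrier = pts, monoid.mult = point_add curve, one = Infinity\<rparr>"

lemma G_simps [simp]: "carrier G = pts" "monoid.mult G = point_add curve" "one G = Infinity"
  by (simp_all add: G_def)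

sublocale G: comm_group G
proof (rule comm_groupI)
  fix x assume "x \<in> carrier G"
  then show "\<exists>y\<in>carrier G. y \<otimes>\<^bsub>G\<^esub> x = \<one>\<^bsub>G\<^esub>"
    by (intro bexI[of _ "neg x"]) (simp_all add: add_eq_Infinity)
qed (simp_all add: add_assoc, simp add: add_commute)

lemma inv_G: "P \<in> pts \<Longrightarrow> inv\<^bsub>G\<^esub> P = neg P"
  by (intro G.inv_equality) (simp_all add: add_eq_Infinity)

lemma point_mult_eq_pow:
  assumes "P \<in> pts"
  shows "point_mult curve n P = P [^]\<^bsub>G\<^esub> n"
proof (induction n)
  case (Suc n)
  then show ?case
    using G.nat_pow_Suc2[of P n] assms by (simp add: point_mult_def)
qed (simp add: point_mult_def)

end

section \<open>Field endomorphisms\<close>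

locale field_endo =
  fixes \<sigma> :: "'a :: field_char_0 \<Rightarrow> 'a"
  assumes hom_add: "\<sigma> (x + y) = \<sigma> x + \<sigma> y"
    and hom_mult: "\<sigma> (x * y) = \<sigma> x * \<sigma> y"
    and hom_1 [simp]: "\<sigma> 1 = 1"
begin

lemma hom_0 [simp]: "\<sigma> 0 = 0"
  using hom_add[of 0 0] by simp

lemma hom_minus: "\<sigma> (- x) = - \<sigma> x"
  using hom_add[of x "- x"] by (simp add: eq_neg_iff_add_eq_0 add.commute)

lemma hom_diff: "\<sigma> (x - y) = \<sigma> x - \<sigma> y"
  using hom_add[of x "- y"] by (simp add: hom_minus)

lemma hom_eq_0_iff [simp]: "\<sigma> x = 0 \<longleftrightarrow> x = 0"
  using hom_mult[of x "inverse x"] by (cases "x = 0") auto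

lemma hom_eq_iff [simp]: "\<sigma> x = \<sigma> y \<longleftrightarrow> x = y"
  using hom_eq_0_iff[of "x - y"] by (simp add: hom_diff)

lemma hom_inverse: "\<sigma> (inverse x) = inverse (\<sigma> x)"
proof (cases "x = 0")
  case False
  then have "\<sigma> x * \<sigma> (inverse x) = 1" using hom_mult[of x "inverse x"] by simp
  then show ?thesis by (metis inverse_unique)
qed simp

lemma hom_divide: "\<sigma> (x / y) = \<sigma> x / \<sigma> y"
  by (simp add: divide_inverse hom_mult hom_inverse)

lemma hom_power: "\<sigma> (x ^ n) = \<sigma> x ^ n"
  by (induction n) (simp_all add: hom_mult)

lemma hom_of_nat [simp]: "\<sigma> (of_nat n) = of_nat n"
  by (induction n) (simp_all add: hom_add)

lemma hom_numeral [simp]: "\<sigma> (numeral n) = numeral n"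
  using hom_of_nat[of "numeral n"] by simp

lemma hom_sum: "\<sigma> (\<Sum>i\<in>I. f i) = (\<Sum>i\<in>I. \<sigma> (f i))"
  by (induction I rule: infinite_finite_induct) (simp_all add: hom_add)

lemmas hom_simps = hom_add hom_mult hom_minus hom_diff hom_inverse hom_divide hom_power

end

lemma map_point_point_add:
  assumes "field_endo \<sigma>" "\<And>x. x \<in> set_weierstrass E \<Longrightarrow> \<sigma> x = x"
  shows "map_point \<sigma> (point_add E U V) = point_add E (map_point \<sigma> U) (map_point \<sigma> V)"
proof -
  interpret field_endo \<sigma> by fact
  have c: "\<sigma> (a1 E) = a1 E" "\<sigma> (a2 E) = a2 E" "\<sigma> (a3 E) = a3 E" "\<sigma> (a4 E) = a4 E"
    using assms(2) by (cases E; auto)+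
  show ?thesis
  proof (cases "U = Infinity \<or> V = Infinity")
    case False
    then obtain x1 y1 x2 y2 where [simp]: "U = Affine x1 y1" "V = Affine x2 y2"
      by (cases U; cases V) auto
    have eq0: "\<sigma> y1 + \<sigma> y2 + a1 E * \<sigma> x2 + a3 E = 0 \<longleftrightarrow> y1 + y2 + a1 E * x2 + a3 E = 0"
      using hom_eq_0_iff[of "y1 + y2 + a1 E * x2 + a3 E"] by (simp add: hom_simps c)
    show ?thesis by (simp add: Let_def hom_simps c eq0)
  qed (cases U; cases V; auto)
qed

section \<open>Functions with simple poles along a subgroup of prime order\<close>

fun xc :: "'a point \<Rightarrow> 'a" where
  "xc (Affine x y) = x" | "xc Infinity = undefined"

fun yc :: "'a point \<Rightarrow> 'a" where
  "yc (Affine x y) = y" | "yc Infinity = undefined"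

locale torsion_pair = short_curve_closed +
  fixes p :: nat and P Q :: "'a point"
  assumes prime_p: "prime p" and p_ge_5: "p \<ge> 5"
    and P_in: "P \<in> pts" and Q_in: "Q \<in> pts"
    and P_pow: "P [^]\<^bsub>G\<^esub> p = Infinity" and Q_pow: "Q [^]\<^bsub>G\<^esub> p = Infinity"
    and indep: "\<And>m n :: nat. P [^]\<^bsub>G\<^esub> m \<oplus>\<oplus> Q [^]\<^bsub>G\<^esub> n = Infinity \<Longrightarrow> p dvd m \<and> p dvd n"
begin

text \<open>The first index counts Q and the second counts P, so that \<open>range (pt m)\<close> is
  a coset of the subgroup generated by P. Integer indices make negation a change of sign.\<close>

definition pt :: "int \<Rightarrow> int \<Rightarrow> 'a point" where
  "pt m k = Q [^]\<^bsub>G\<^esub> m \<oplus>\<oplus> P [^]\<^bsub>G\<^esub> k"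

lemma pt_in [simp]: "pt m k \<in> pts"
  using G.int_pow_closed[of Q m] G.int_pow_closed[of P k] P_in Q_in by (simp add: pt_def)

lemma pt_add: "pt m k \<oplus>\<oplus> pt m' k' = pt (m + m') (k + k')"
proof -
  have Qc: "Q [^]\<^bsub>G\<^esub> i \<in> pts" and Pc: "P [^]\<^bsub>G\<^esub> i \<in> pts" for i :: int
    using G.int_pow_closed[of Q i] G.int_pow_closed[of P i] P_in Q_in by simp_all
  have "pt (m + m') (k + k')
      = (Q [^]\<^bsub>G\<^esub> m \<oplus>\<oplus> Q [^]\<^bsub>G\<^esub> m') \<oplus>\<oplus> (P [^]\<^bsub>G\<^esub> k \<oplus>\<oplus> P [^]\<^bsub>G\<^esub> k')"
    using P_in Q_in G.int_pow_mult[of P k k'] G.int_pow_mult[of Q m m'] by (simp add: pt_def)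
  also have "\<dots> = (Q [^]\<^bsub>G\<^esub> m \<oplus>\<oplus> P [^]\<^bsub>G\<^esub> k) \<oplus>\<oplus> (Q [^]\<^bsub>G\<^esub> m' \<oplus>\<oplus> P [^]\<^bsub>G\<^esub> k')"
    using Qc Pc add_commute[of "Q [^]\<^bsub>G\<^esub> m'" "P [^]\<^bsub>G\<^esub> k"]
    by (simp add: add_assoc) (simp add: add_assoc[symmetric])
  finally show ?thesis by (simp add: pt_def)
qed

lemma pt_0_0: "pt 0 0 = Infinity"
  by (simp add: pt_def int_pow_def2)

lemma neg_pt: "neg (pt m k) = pt (- m) (- k)"
proof -
  have "pt m k \<oplus>\<oplus> pt (- m) (- k) = Infinity" by (simp add: pt_add pt_0_0)
  then show ?thesis by (simp add: add_eq_Infinity)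
qed

lemma pow_mod: "P [^]\<^bsub>G\<^esub> k = P [^]\<^bsub>G\<^esub> nat (k mod p)" "Q [^]\<^bsub>G\<^esub> k = Q [^]\<^bsub>G\<^esub> nat (k mod p)" for k :: int
proof -
  have *: "U [^]\<^bsub>G\<^esub> k = U [^]\<^bsub>G\<^esub> nat (k mod p)" if "U \<in> pts" "U [^]\<^bsub>G\<^esub> p = Infinity" for U
  proof -
    have "U [^]\<^bsub>G\<^esub> k = U [^]\<^bsub>G\<^esub> (int p * (k div p) + int (nat (k mod p)))"
      using p_ge_5 by simp
    also have "\<dots> = (U [^]\<^bsub>G\<^esub> int p) [^]\<^bsub>G\<^esub> (k div p) \<otimes>\<^bsub>G\<^esub> U [^]\<^bsub>G\<^esub> int (nat (k mod p))"
      using that by (subst G.int_pow_mult) (simp_all add: G.int_pow_pow)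
    also have "\<dots> = U [^]\<^bsub>G\<^esub> nat (k mod p)"
      using that G.int_pow_one[of "k div p"] by (simp add: int_pow_int)
    finally show ?thesis .
  qed
  show "P [^]\<^bsub>G\<^esub> k = P [^]\<^bsub>G\<^esub> nat (k mod p)" "Q [^]\<^bsub>G\<^esub> k = Q [^]\<^bsub>G\<^esub> nat (k mod p)"
    using *[OF P_in P_pow] *[OF Q_in Q_pow] .
qed

lemma pt_eq_Infinity: "pt m k = Infinity \<longleftrightarrow> int p dvd m \<and> int p dvd k"
proof
  assume "pt m k = Infinity"
  then have "P [^]\<^bsub>G\<^esub> nat (k mod p) \<oplus>\<oplus> Q [^]\<^bsub>G\<^esub> nat (m mod p) = Infinity"
    using G.nat_pow_closed P_in Q_in pow_mod(1)[of k] pow_mod(2)[of m]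
    by (subst add_commute) (simp_all add: pt_def)
  then have *: "p dvd nat (k mod p)" "p dvd nat (m mod p)" using indep by auto
  have "int p dvd j" if "p dvd nat (j mod int p)" for j :: int
  proof -
    have "int p dvd int (nat (j mod int p))" using that by (simp only: int_dvd_int_iff)
    then have "int p dvd j mod int p" using p_ge_5 by simp
    then show ?thesis by (simp add: dvd_mod_iff)
  qed
  with * show "int p dvd m \<and> int p dvd k" by blast
next
  assume "int p dvd m \<and> int p dvd k"
  then have "m mod p = 0" "k mod p = 0" by auto
  then have "Q [^]\<^bsub>G\<^esub> m = Infinity" "P [^]\<^bsub>G\<^esub> k = Infinity"
    using pow_mod(1)[of k] pow_mod(2)[of m] by simp_all
  then show "pt m k = Infinity" by (simp add: pt_def)
qed

lemma pt_eq_iff: "pt m k = pt m' k' \<longleftrightarrow> int p dvd m - m' \<and> int p dvd k - k'"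
proof -
  have "pt m k = pt m' k' \<longleftrightarrow> neg (pt m' k') \<oplus>\<oplus> pt m k = Infinity"
    by (subst add_eq_Infinity) simp
  then show ?thesis by (simp add: neg_pt pt_add pt_eq_Infinity algebra_simps)
qed

lemma P_eq: "P = pt 0 1" and Q_eq: "Q = pt 1 0"
  using P_in Q_in G.int_pow_1[of P] G.int_pow_1[of Q] by (simp_all add: pt_def int_pow_def2)

end

context short_curve
begin

lemma xc_eq_iff:
  assumes "U \<in> pts" "V \<in> pts" "U \<noteq> Infinity" "V \<noteq> Infinity"
  shows "xc U = xc V \<longleftrightarrow> U = V \<or> U = neg V"
  using assms by (cases U; cases V) (auto simp: Affine_in_pts, metis power2_eq_iff)

lemma yc_eq_0_iff: "U \<noteq> Infinity \<Longrightarrow> yc U = 0 \<longleftrightarrow> neg U = U"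
  by (cases U) (auto simp: neg_equal_zero)

lemma xc_neg [simp]: "U \<noteq> Infinity \<Longrightarrow> xc (neg U) = xc U"
  and yc_neg [simp]: "U \<noteq> Infinity \<Longrightarrow> yc (neg U) = - yc U"
  by (cases U; simp)+

end

context torsion_pair
begin

lemma two_nz: "int p dvd 2 * m \<longleftrightarrow> int p dvd m"
proof -
  have "\<not> p dvd 2" using p_ge_5 by (auto dest: dvd_imp_le)
  then have "\<not> int p dvd 2" by (metis int_dvd_int_iff of_nat_numeral)
  then show ?thesis using prime_p by (simp add: prime_dvd_mult_iff)
qed

lemma neg_pt_neq: "pt m k \<noteq> Infinity \<Longrightarrow> neg (pt m k) \<noteq> pt m k"
proof
  assume "pt m k \<noteq> Infinity" "neg (pt m k) = pt m k"
  then have "int p dvd - (2 * m)" "int p dvd - (2 * k)" by (simp_all add: neg_pt pt_eq_iff)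
  then have "int p dvd 2 * m" "int p dvd 2 * k" by (simp_all only: dvd_minus_iff)
  then show False using \<open>pt m k \<noteq> Infinity\<close> by (simp add: two_nz pt_eq_Infinity)
qed

end

lemma poly_eq_0_if_many_roots:
  fixes q :: "'a :: idom poly"
  assumes "finite S" "\<And>x. x \<in> S \<Longrightarrow> poly q x = 0" "Polynomial.degree q < card S"
  shows "q = 0"
proof (rule ccontr)
  assume "q \<noteq> 0"
  then have "card {x. poly q x = 0} \<le> Polynomial.degree q" "finite {x. poly q x = 0}"
    using card_poly_roots_bound poly_roots_finite by auto
  moreover have "card S \<le> card {x. poly q x = 0}"
    using assms calculation by (intro card_mono) auto
  ultimately show False using assms(3) by simp
qed

lemma prod_linear:
  fixes S :: "'a :: field set"
  shows "Polynomial.degree (\<Prod>t\<in>S. [:- t, 1:]) = card S"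
    and "Polynomial.coeff (\<Prod>t\<in>S. [:- t, 1:]) (card S) = 1"
proof -
  show *: "Polynomial.degree (\<Prod>t\<in>S. [:- t, 1:]) = card S"
    by (subst degree_prod_eq_sum_degree) auto
  have "Polynomial.lead_coeff (\<Prod>t\<in>S. [:- t, 1:]) = 1"
    by (simp add: lead_coeff_prod)
  with * show "Polynomial.coeff (\<Prod>t\<in>S. [:- t, 1:]) (card S) = 1" by simp
qed

lemma degree_less_if_coeff_eq_0:
  "Polynomial.degree q \<le> n \<Longrightarrow> Polynomial.coeff q n = 0 \<Longrightarrow> n > 0 \<Longrightarrow> Polynomial.degree q < n"
  by (metis leading_coeff_0_iff order_le_less degree_0)

context short_curve
begin

definition cubic :: "'a poly" where
  "cubic = [:b, a, 0, 1:]"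

lemma poly_cubic: "U \<in> pts \<Longrightarrow> U \<noteq> Infinity \<Longrightarrow> poly cubic (xc U) = yc U ^ 2"
  by (cases U) (auto simp: Affine_in_pts cubic_def power3_eq_cube algebra_simps)

lemma degree_cubic: "Polynomial.degree cubic = 3" "cubic \<noteq> 0"
  by (simp_all add: cubic_def)

text \<open>The expression is the norm of A + B y. Its two terms have degrees of different parity,
  so they cannot cancel.\<close>

lemma norm_eq_0:
  assumes "A * A - B * B * cubic = 0"
  shows "A = 0" "B = 0"
proof -
  have "B = 0"
  proof (rule ccontr)
    assume B: "B \<noteq> 0"
    have eq: "A * A = B * B * cubic" using assms by simp
    with B degree_cubic have "A \<noteq> 0" by auto
    then have "2 * Polynomial.degree A = 2 * Polynomial.degree B + 3"
      using arg_cong[OF eq, of Polynomial.degree] B degree_cubic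
      by (simp add: degree_mult_eq)
    then show False by presburger
  qed
  then show "A = 0" "B = 0" using assms by auto
qed

end

section \<open>Partial fractions with poles in the subgroup, and uniqueness of the vanishing
  function\<close>

context torsion_pair
begin

definition C :: "'a point set" where "C = range (pt 0)"

definition Cs :: "'a point set" where "Cs = C - {Infinity}"

lemma pt_mod: "pt m k = pt m (k mod int p)"
  by (simp add: pt_eq_iff)

lemma range_pt: "range (pt m) = pt m ` {0..<int p}"
proof -
  have "pt m k \<in> pt m ` {0..<int p}" for k
    using pt_mod[of m k] p_ge_5 by (intro image_eqI[of _ _ "k mod int p"]) auto
  then show ?thesis by auto
qed

lemma inj_on_pt: "inj_on (pt m) {0..<int p}"
proof (rule inj_onI)
  fix k l assume "k \<in> {0..<int p}" "l \<in> {0..<int p}" "pt m k = pt m l"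
  then have "k mod int p = l mod int p" by (simp only: pt_eq_iff mod_eq_dvd_iff)
  then show "k = l" using \<open>k \<in> _\<close> \<open>l \<in> _\<close> by auto
qed

lemma finite_C [simp]: "finite C" and card_C: "card C = p"
  and finite_Cs [simp]: "finite Cs" and card_Cs: "card Cs = p - 1"
proof -
  show *: "finite C" "card C = p"
    using card_image[OF inj_on_pt] by (simp_all add: C_def range_pt)
  have "Infinity \<in> C" using pt_0_0 unfolding C_def by (metis rangeI)
  with * show "finite Cs" "card Cs = p - 1" by (simp_all add: Cs_def)
qed

lemma Infinity_in_C: "Infinity \<in> C"
  using pt_0_0 unfolding C_def by (metis rangeI)

lemma Infinity_notin_Cs [simp]: "Infinity \<notin> Cs"
  by (simp add: Cs_def)

lemma C_eq: "C = insert Infinity Cs"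
  using Infinity_in_C by (auto simp: Cs_def)

lemma Cs_facts: "T \<in> Cs \<Longrightarrow> T \<in> pts" "T \<in> Cs \<Longrightarrow> T \<noteq> Infinity"
  "T \<in> Cs \<Longrightarrow> neg T \<in> Cs" "T \<in> Cs \<Longrightarrow> neg T \<noteq> T" "T \<in> Cs \<Longrightarrow> yc T \<noteq> 0"
proof -
  show "T \<in> Cs \<Longrightarrow> T \<in> pts" "T \<in> Cs \<Longrightarrow> T \<noteq> Infinity" "T \<in> Cs \<Longrightarrow> neg T \<in> Cs"
    by (auto simp: Cs_def C_def neg_pt neg_eq_iff)
  show *: "T \<in> Cs \<Longrightarrow> neg T \<noteq> T" by (auto simp: Cs_def C_def neg_pt_neq)
  show "T \<in> Cs \<Longrightarrow> yc T \<noteq> 0" using * yc_eq_0_iff by (auto simp: Cs_def)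
qed

lemma fiber_xc:
  assumes "T \<in> Cs"
  shows "{S \<in> Cs. xc S = xc T} = {T, neg T}"
  using assms Cs_facts by (auto simp: xc_eq_iff)

definition Xs :: "'a set" where "Xs = xc ` Cs"

lemma finite_Xs [simp]: "finite Xs" by (simp add: Xs_def)

text \<open>T and -T share their abscissa, and they differ because p is odd.\<close>

lemma card_Xs: "p = 2 * card Xs + 1"
proof -
  have "card Cs = (\<Sum>t\<in>Xs. card {T \<in> Cs. xc T = t})"
    using sum.group[of Cs Xs xc "\<lambda>_. 1 :: nat"] by (simp add: Xs_def)
  also have "\<dots> = (\<Sum>t\<in>Xs. 2)"
  proof (rule sum.cong)
    fix t assume "t \<in> Xs"
    then obtain T where T: "T \<in> Cs" "t = xc T" by (auto simp: Xs_def)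
    then have "neg T \<noteq> T" using Cs_facts(4) by blast
    with fiber_xc[OF T(1)] T(2) show "card {T \<in> Cs. xc T = t} = 2" by (auto simp: card_2_iff)
  qed simp
  finally have "card Cs = 2 * card Xs" by simp
  then show ?thesis using card_Cs p_ge_5 by simp
qed

definition Dp :: "'a poly" where "Dp = (\<Prod>t\<in>Xs. [:- t, 1:])"

definition Dq :: "'a \<Rightarrow> 'a poly" where "Dq t = (\<Prod>s\<in>Xs - {t}. [:- s, 1:])"

text \<open>The numerator of the sum of g T / (X - xc T) over the common denominator
  \<open>Dp\<close>; \<open>Dq t\<close> is \<open>Dp\<close> with the factor X - t removed.\<close>

definition lin :: "('a point \<Rightarrow> 'a) \<Rightarrow> 'a poly" where
  "lin g = (\<Sum>T\<in>Cs. smult (g T) (Dq (xc T)))"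

lemma Dp_Dq: "t \<in> Xs \<Longrightarrow> Dp = [:- t, 1:] * Dq t"
  by (simp add: Dp_def Dq_def prod.remove[of Xs t])

lemma poly_Dq: "poly (Dq t) s = (\<Prod>u\<in>Xs - {t}. s - u)"
  by (simp add: Dq_def poly_prod)

lemma poly_Dp: "poly Dp s = (\<Prod>u\<in>Xs. s - u)"
  by (simp add: Dp_def poly_prod)

lemma poly_Dq_nz: "poly (Dq t) t \<noteq> 0"
  by (simp add: poly_Dq)

lemma poly_lin:
  assumes "T \<in> Cs"
  shows "poly (lin g) (xc T) = (g T + g (neg T)) * poly (Dq (xc T)) (xc T)"
proof -
  have "poly (lin g) (xc T) = (\<Sum>S\<in>Cs. g S * poly (Dq (xc S)) (xc T))"
    by (simp add: lin_def poly_sum)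
  also have "\<dots> = (\<Sum>S\<in>{S \<in> Cs. xc S = xc T}. g S * poly (Dq (xc S)) (xc T))"
  proof (rule sum.mono_neutral_right)
    show "\<forall>S\<in>Cs - {S \<in> Cs. xc S = xc T}. g S * poly (Dq (xc S)) (xc T) = 0"
      using assms by (auto simp: poly_Dq Xs_def intro!: prod_zero)
  qed auto
  also have "\<dots> = (g T + g (neg T)) * poly (Dq (xc T)) (xc T)"
  proof -
    have "T \<noteq> neg T" "xc (neg T) = xc T" using Cs_facts[of T] assms by auto
    then show ?thesis unfolding fiber_xc[OF assms] by (simp add: algebra_simps)
  qed
  finally show ?thesis .
qed

lemma degree_Dq: "t \<in> Xs \<Longrightarrow> Polynomial.degree (Dq t) = card Xs - 1"
  and coeff_Dq: "t \<in> Xs \<Longrightarrow> Polynomial.coeff (Dq t) (card Xs - 1) = 1"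
  using prod_linear[of "Xs - {t}"] by (simp_all add: Dq_def)

lemma degree_lin: "Polynomial.degree (lin g) \<le> card Xs - 1"
  unfolding lin_def
proof (rule degree_sum_le)
  fix T assume "T \<in> Cs"
  then have "xc T \<in> Xs" by (simp add: Xs_def)
  then show "Polynomial.degree (smult (g T) (Dq (xc T))) \<le> card Xs - 1"
    using degree_Dq degree_smult_le by metis
qed simp

lemma coeff_lin: "Polynomial.coeff (lin g) (card Xs - 1) = sum g Cs"
proof -
  have "Polynomial.coeff (Dq (xc T)) (card Xs - 1) = 1" if "T \<in> Cs" for T
    using that coeff_Dq by (simp add: Xs_def)
  then show ?thesis by (simp add: lin_def Polynomial.coeff_sum)
qed

lemma card_Xs_ge: "card Xs \<ge> 2"
  using card_Xs p_ge_5 by simp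

lemma lagrange:
  assumes "Polynomial.degree A < card Xs" "\<And>T. T \<in> Cs \<Longrightarrow> (g T + g (neg T)) * poly (Dq (xc T)) (xc T) = poly A (xc T)"
  shows "lin g = A"
proof -
  have "lin g - A = 0"
  proof (rule poly_eq_0_if_many_roots)
    show "poly (lin g - A) x = 0" if "x \<in> Xs" for x
      using that assms(2) poly_lin[of _ g] by (auto simp: Xs_def)
    have "Polynomial.degree (lin g) < card Xs" using degree_lin[of g] card_Xs_ge by simp
    then show "Polynomial.degree (lin g - A) < card Xs" using assms(1) by (rule degree_diff_less)
  qed simp
  then show ?thesis by simp
qed

text \<open>The coefficient \<open>r Infinity\<close> is irrelevant here, because \<open>slope Y Infinity = 0\<close>.  Normalising it
  by \<open>sum r C = 0\<close> makes \<open>r\<close> the family of residues and turns translation into a shift of \<open>r\<close>.\<close>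

definition slope_sum :: "'a \<Rightarrow> ('a point \<Rightarrow> 'a) \<Rightarrow> 'a point \<Rightarrow> 'a" where
  "slope_sum c r Y = c + (\<Sum>T\<in>C. r T * slope Y T)"

lemma slope_sum_alt: "slope_sum c r Y = c + (\<Sum>T\<in>Cs. r T * slope Y T)"
proof -
  have "slope Y Infinity = 0" by (cases Y) auto
  then show ?thesis by (simp add: slope_sum_def C_eq)
qed

text \<open>For Y outside C every slope is that of a chord. Clearing denominators turns
  \<open>slope_sum\<close> into (A + B y) / \<open>Dp\<close>, and zeros can then be counted by
  degrees.\<close>

lemma slope_sum_poly:
  assumes "Y \<in> pts" "Y \<notin> C"
  shows "poly Dp (xc Y) * slope_sum c r Y
    = poly (smult c Dp - lin (\<lambda>T. r T * yc T)) (xc Y) + poly (lin r) (xc Y) * yc Y"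
    and "poly Dp (xc Y) \<noteq> 0"
proof -
  have Y: "Y \<noteq> Infinity" using assms Infinity_in_C by auto
  have ne: "xc Y \<noteq> xc T" if "T \<in> Cs" for T
    using that Y assms Cs_facts[OF that] xc_eq_iff[of Y T] by (auto simp: Cs_def)
  have *: "poly Dp (xc Y) * slope Y T = (yc Y - yc T) * poly (Dq (xc T)) (xc Y)" if "T \<in> Cs" for T
  proof -
    have "slope Y T = (yc Y - yc T) / (xc Y - xc T)"
      using ne[OF that] Y Cs_facts(2)[OF that]
      by (cases Y; cases T) (auto simp: divide_simps, simp add: algebra_simps)
    moreover have "poly Dp (xc Y) = (xc Y - xc T) * poly (Dq (xc T)) (xc Y)"
      by (subst Dp_Dq[of "xc T"]) (use that in \<open>simp_all add: Xs_def algebra_simps\<close>)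
    ultimately show ?thesis using ne[OF that] by simp
  qed
  have "poly Dp (xc Y) * slope_sum c r Y
      = c * poly Dp (xc Y) + (\<Sum>T\<in>Cs. r T * (poly Dp (xc Y) * slope Y T))"
    by (simp add: slope_sum_alt algebra_simps sum_distrib_left)
  also have "(\<Sum>T\<in>Cs. r T * (poly Dp (xc Y) * slope Y T))
      = (\<Sum>T\<in>Cs. r T * ((yc Y - yc T) * poly (Dq (xc T)) (xc Y)))"
    using * by simp
  also have "\<dots> = poly (lin r) (xc Y) * yc Y - poly (lin (\<lambda>T. r T * yc T)) (xc Y)"
    by (simp add: lin_def poly_sum sum_distrib_left sum_subtractf algebra_simps)
  finally show "poly Dp (xc Y) * slope_sum c r Y
    = poly (smult c Dp - lin (\<lambda>T. r T * yc T)) (xc Y) + poly (lin r) (xc Y) * yc Y" by simp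
  show "poly Dp (xc Y) \<noteq> 0" using ne by (auto simp: poly_Dp Xs_def)
qed

lemma degree_Dp: "Polynomial.degree Dp = card Xs" "Polynomial.coeff Dp (card Xs) = 1"
  using prod_linear[of Xs] by (simp_all add: Dp_def)

lemma coset_not_in_C: "pt 1 k \<notin> C"
proof
  assume "pt 1 k \<in> C"
  then obtain j where "pt 1 k = pt 0 j" by (auto simp: C_def)
  then show False using p_ge_5 by (auto simp: pt_eq_iff zdvd1_eq)
qed

text \<open>Negation carries Q + C to -Q + C, a different coset since p is odd; hence x is injective
  on Q + C.\<close>

lemma coset_xc:
  "finite (xc ` range (pt 1))" "card (xc ` range (pt 1)) = p"
proof -
  have "inj_on xc (range (pt 1))"
  proof (rule inj_onI)
    fix U V assume "U \<in> range (pt 1)" "V \<in> range (pt 1)" "xc U = xc V"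
    then obtain k l where kl: "U = pt 1 k" "V = pt 1 l" by auto
    have "U \<noteq> Infinity" "V \<noteq> Infinity" using kl coset_not_in_C Infinity_in_C by metis+
    then have "U = V \<or> U = neg V" using \<open>xc U = xc V\<close> kl by (simp add: xc_eq_iff)
    moreover have "U \<noteq> neg V"
    proof
      assume "U = neg V"
      then have "int p dvd 2 * 1" by (simp add: kl neg_pt pt_eq_iff)
      then show False using two_nz[of 1] p_ge_5 by (auto simp: zdvd1_eq)
    qed
    ultimately show "U = V" by simp
  qed
  then have "card (xc ` range (pt 1)) = card (range (pt 1))" by (rule card_image)
  also have "\<dots> = p" using card_image[OF inj_on_pt[of 1]] by (simp add: range_pt)
  finally show "card (xc ` range (pt 1)) = p" .
  then show "finite (xc ` range (pt 1))" by (simp add: range_pt)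
qed

text \<open>Without a pole at infinity the norm of the numerator has degree at most 2 h < p, where h
  is \<open>card Xs\<close>, and yet it has the p roots of \<open>coset_xc\<close>.\<close>

lemma vanishing_unique:
  assumes "sum r C = 0" "r Infinity = 0" "\<And>k. slope_sum c r (pt 1 k) = 0"
  shows "c = 0" "T \<in> C \<Longrightarrow> r T = 0"
proof -
  define A where "A = smult c Dp - lin (\<lambda>T. r T * yc T)"
  define B where "B = lin r"
  let ?h = "card Xs"
  have "A * A - B * B * cubic = 0"
  proof (rule poly_eq_0_if_many_roots[OF coset_xc(1)], unfold coset_xc(2))
    fix x assume "x \<in> xc ` range (pt 1)"
    then obtain k where x: "x = xc (pt 1 k)" by auto
    have i: "pt 1 k \<noteq> Infinity" using coset_not_in_C Infinity_in_C by metis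
    have "poly A x + poly B x * yc (pt 1 k) = 0"
      using slope_sum_poly(1)[OF pt_in coset_not_in_C, of k c r] assms(3) by (simp add: A_def B_def x)
    then have "poly A x = - (poly B x * yc (pt 1 k))" by (simp add: eq_neg_iff_add_eq_0)
    then have "poly A x * poly A x = poly B x * poly B x * yc (pt 1 k) ^ 2"
      by (simp add: power2_eq_square)
    then show "poly (A * A - B * B * cubic) x = 0"
      using poly_cubic[OF pt_in i] by (simp add: x)
  next
    have dA: "Polynomial.degree A \<le> ?h"
      unfolding A_def
      using degree_lin[of "\<lambda>T. r T * yc T"] degree_Dp(1) degree_smult_le[of c Dp]
      by (intro degree_diff_le) auto
    \<comment> \<open>This sum is the coefficient of B in degree h - 1. If it survived, the term B B
      \<open>cubic\<close> would reach degree 2 (h - 1) + 3 = p, one too high.\<close>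
    have "sum r Cs = 0" using assms(1,2) by (simp add: C_eq)
    then have dB: "Polynomial.degree B < ?h - 1"
      unfolding B_def using degree_lin card_Xs_ge coeff_lin[of r]
      by (intro degree_less_if_coeff_eq_0) auto
    have "Polynomial.degree (A * A) \<le> 2 * ?h"
      using degree_mult_le[of A A] dA by linarith
    moreover have "Polynomial.degree (B * B * cubic) \<le> 2 * ?h"
      using degree_mult_le[of "B * B" cubic] degree_mult_le[of B B] degree_cubic(1) dB by linarith
    ultimately show "Polynomial.degree (A * A - B * B * cubic) < p"
      using degree_diff_le[of "A * A" "2 * ?h" "B * B * cubic"] card_Xs by linarith
  qed
  from norm_eq_0[OF this] have AB: "A = 0" "B = 0" by auto
  have "Polynomial.coeff A ?h = c"
    unfolding A_def using degree_Dp(2) degree_lin[of "\<lambda>T. r T * yc T"] card_Xs_ge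
    by (simp add: Polynomial.coeff_eq_0)
  then show c: "c = 0" using AB by simp
  show "r T = 0" if "T \<in> C"
  proof (cases "T = Infinity")
    case False
    with that have T: "T \<in> Cs" by (simp add: Cs_def)
    \<comment> \<open>B gives the sum of the residues at T and -T, and A their difference, because
      \<open>yc\<close> changes sign under negation.\<close>
    have "r T + r (neg T) = 0"
      using poly_lin[OF T, of r] AB(2) poly_Dq_nz by (simp add: B_def)
    moreover have "r T * yc T + r (neg T) * yc (neg T) = 0"
      using poly_lin[OF T, of "\<lambda>T. r T * yc T"] AB(1) poly_Dq_nz c by (simp add: A_def)
    ultimately have "r T + r (neg T) = 0" "yc T * (r T - r (neg T)) = 0"
      using Cs_facts(2)[OF T] by (simp_all add: algebra_simps)
    then have "r T + r (neg T) = 0" "r T - r (neg T) = 0" using Cs_facts(5)[OF T] by simp_all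
    then have "2 * r T = 0" by Groebner_Basis.algebra
    then show ?thesis by simp
  qed (use assms in simp)
qed

end

section \<open>Existence of the vanishing function\<close>

context short_curve
begin

definition ev :: "'a poly \<Rightarrow> 'a poly \<Rightarrow> 'a point \<Rightarrow> 'a" where
  "ev A B U = poly A (xc U) + poly B (xc U) * yc U"

lemma line_through:
  assumes "U \<in> pts" "V \<in> pts" "U \<noteq> Infinity" "V \<noteq> Infinity" "V \<noteq> neg U"
  obtains L where "Polynomial.degree L \<le> 1" "poly L (xc U) = yc U" "poly L (xc V) = yc V"
    "poly L (xc (U \<oplus>\<oplus> V)) = - yc (U \<oplus>\<oplus> V)"
proof -
  obtain x1 y1 x2 y2 where [simp]: "U = Affine x1 y1" "V = Affine x2 y2"
    using assms by (cases U; cases V) auto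
  obtain l v x3 y3 where c: "coll l v x1 y1 x2 y2 x3 y3"
    using add_coll assms by (metis \<open>U = Affine x1 y1\<close> \<open>V = Affine x2 y2\<close> neg.simps(2))
  have *: "U \<oplus>\<oplus> V = Affine x3 (- y3)" using coll_add[OF c] by simp
  show ?thesis
    by (rule that[of "[:v, l:]"], unfold *) (use c in \<open>auto simp: coll_def\<close>)
qed

text \<open>The product (A + B y)(y - L), reduced to the basis 1, y by the equation of the
  curve.\<close>

lemma ev_mult_line:
  assumes "U \<in> pts" "U \<noteq> Infinity"
  shows "ev (B * cubic - A * L) (A - B * L) U = ev A B U * (yc U - poly L (xc U))"
  using poly_cubic[OF assms] by (simp add: ev_def algebra_simps power2_eq_square)

end

context torsion_pair
begin

lemma not_dvd_small: "z \<noteq> 0 \<Longrightarrow> \<bar>z\<bar> < int p \<Longrightarrow> \<not> int p dvd z"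
  using dvd_imp_le_int by force

text \<open>Miller's construction: multiply by the line through the negative of the current residual
  zero and the next point, and divide by the vertical line.\<close>

definition miller_fn :: "nat \<Rightarrow> 'a poly \<Rightarrow> 'a poly \<Rightarrow> bool" where
  "miller_fn n A B \<longleftrightarrow> (A \<noteq> 0 \<or> B \<noteq> 0) \<and>
     2 * Polynomial.degree A \<le> n + 1 \<and> 2 * Polynomial.degree B + 3 \<le> n + 1 \<and>
     (\<forall>i\<in>{1..n}. ev A B (pt 1 (int i)) = 0) \<and> ev A B (pt (- int n) (- int (\<Sum>{1..n}))) = 0"

text \<open>As x and y have poles of order 2 and 3, the degree bounds allow a pole of order n + 1 at
  infinity, which the n + 1 prescribed zeros exhaust. The induction starts at n = 2 with a line; for
  n = 1 the bound on the degree of B cannot be met.\<close>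

lemma exists_miller_fn:
  assumes "2 \<le> n" "n \<le> p - 1"
  shows "\<exists>A B. miller_fn n A B"
  using assms
proof (induction n rule: nat_induct_at_least)
  case base
  have i: "pt 1 1 \<noteq> Infinity" "pt 1 2 \<noteq> Infinity" "pt 1 2 \<noteq> neg (pt 1 1)"
    using not_dvd_small[of 1] not_dvd_small[of 2] p_ge_5 by (simp_all add: pt_eq_Infinity neg_pt pt_eq_iff)
  obtain L where L: "Polynomial.degree L \<le> 1" "poly L (xc (pt 1 1)) = yc (pt 1 1)" "poly L (xc (pt 1 2)) = yc (pt 1 2)"
    "poly L (xc (pt 2 3)) = - yc (pt 2 3)"
    using line_through[OF pt_in pt_in i] by (auto simp: pt_add)
  have ne: "pt 2 3 \<noteq> Infinity" using not_dvd_small[of 2] p_ge_5 by (simp add: pt_eq_Infinity)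
  have "pt (-2) (-3) = neg (pt 2 3)" by (simp add: neg_pt)
  moreover have "\<Sum>{1..2::nat} = 3" by (simp add: numeral_2_eq_2)
  moreover have "{1..2::nat} = {1, 2}" by auto
  ultimately show ?case using L ne
    by (intro exI[of _ "- L"] exI[of _ "1 :: 'a poly"]) (auto simp: ev_def miller_fn_def)
next
  case (Suc n)
  define s where "s = int (\<Sum>{1..n})"
  define S where "S = pt (- int n) (- s)"
  obtain A B where AB: "A \<noteq> 0 \<or> B \<noteq> 0" "2 * Polynomial.degree A \<le> n + 1" "2 * Polynomial.degree B + 3 \<le> n + 1"
    "\<forall>i\<in>{1..n}. ev A B (pt 1 (int i)) = 0" "ev A B S = 0"
    using Suc unfolding miller_fn_def S_def s_def by (meson Suc_leD)
  have n: "2 \<le> int n" "int n + 1 < int p" using Suc p_ge_5 by auto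
  have Sin: "S \<in> pts" by (simp add: S_def)
  have Snz: "S \<noteq> Infinity" using not_dvd_small[of "int n"] n by (simp add: S_def pt_eq_Infinity)
  have negS: "neg S = pt (int n) s" by (simp add: S_def neg_pt)
  have yS: "yc S \<noteq> 0" using neg_pt_neq[of "- int n" "- s"] Snz yc_eq_0_iff[OF Snz] by (simp add: S_def)
  have Xnz: "pt 1 k \<noteq> Infinity" for k using coset_not_in_C Infinity_in_C by metis
  have xX: "xc (pt 1 k) \<noteq> xc S" for k
  proof -
    have "\<not> int p dvd (1 + int n)" "\<not> int p dvd (1 - int n)" using n by (intro not_dvd_small; linarith)+
    then show ?thesis using xc_eq_iff[OF pt_in Sin Xnz Snz] by (simp add: negS) (simp add: S_def pt_eq_iff)
  qed
  define S' where "S' = pt (- int (Suc n)) (- int (\<Sum>{1..Suc n}))"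
  have S': "S' = neg (neg S \<oplus>\<oplus> pt 1 (int (Suc n)))"
    by (simp add: S'_def negS pt_add neg_pt s_def algebra_simps)
  have S'in: "S' \<in> pts" by (simp add: S'_def)
  have S'nz: "S' \<noteq> Infinity" 
  proof -
    have "\<not> int p dvd - int (Suc n)" using n by (intro not_dvd_small) auto
    then show ?thesis unfolding S'_def pt_eq_Infinity by blast
  qed
  \<comment> \<open>Division by the vertical line through S must keep the new zero S'. For S' = -S
    the Q-coordinates can agree, namely when p divides 2 n + 1, so the P-coordinates decide: they
    differ by -(n + 1)^2.\<close>
  have xS': "xc S' \<noteq> xc S"
  proof
    assume "xc S' = xc S"
    then consider "S' = S" | "S' = neg S" using xc_eq_iff S'in Sin S'nz Snz by auto
    then show False
    proof cases
      case 1
      then have "int p dvd - 1" by (simp add: S'_def S_def pt_eq_iff)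
      then show False using not_dvd_small[of "- 1"] p_ge_5 by simp
    next
      case 2
      have sq: "2 * s = int n * (int n + 1)"
      proof -
        have "2 * \<Sum>{1..n} = n * (n + 1)" by (induction n) auto
        then show ?thesis unfolding s_def by (metis of_nat_1 of_nat_add of_nat_mult of_nat_numeral)
      qed
      have "int (\<Sum>{1..Suc n}) = s + (int n + 1)" by (simp add: s_def)
      with 2 have "int p dvd - (s + (int n + 1)) - s" by (simp add: S'_def negS pt_eq_iff)
      also have "- (s + (int n + 1)) - s = - ((int n + 1) * (int n + 1))" using sq by (simp add: algebra_simps)
      finally have "int p dvd (int n + 1) * (int n + 1)" by simp
      then have "int p dvd int n + 1" using prime_p by (simp add: prime_dvd_mult_iff)
      then show False using not_dvd_small[of "int n + 1"] n by simp
    qed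
  qed
  have line: "neg S \<noteq> Infinity" "pt 1 (int (Suc n)) \<noteq> neg (neg S)"
    using Snz xX[of "int (Suc n)"] by auto
  obtain L where L: "Polynomial.degree L \<le> 1" "poly L (xc (neg S)) = yc (neg S)"
    "poly L (xc (pt 1 (int (Suc n)))) = yc (pt 1 (int (Suc n)))" "poly L (xc S') = yc S'"
  proof (rule line_through[OF _ pt_in line(1) Xnz line(2)])
    show "neg S \<in> pts" using Sin by simp
    fix L assume "Polynomial.degree L \<le> 1" "poly L (xc (neg S)) = yc (neg S)"
    "poly L (xc (pt 1 (int (Suc n)))) = yc (pt 1 (int (Suc n)))"
    "poly L (xc (neg S \<oplus>\<oplus> pt 1 (int (Suc n)))) = - yc (neg S \<oplus>\<oplus> pt 1 (int (Suc n)))"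
    moreover have "neg S \<oplus>\<oplus> pt 1 (int (Suc n)) \<noteq> Infinity" using S'nz S' by auto
    ultimately show thesis by (intro that) (auto simp: S')
  qed
  define A' where "A' = B * cubic - A * L"
  define B' where "B' = A - B * L"
  have ev': "ev A' B' U = ev A B U * (yc U - poly L (xc U))" if "U \<in> pts" "U \<noteq> Infinity" for U
    using ev_mult_line[OF that] by (simp add: A'_def B'_def)
  have "ev A' B' S = 0" "ev A' B' (neg S) = 0"
    using ev'[OF Sin Snz] ev'[of "neg S"] AB(5) L(2) Sin Snz by simp_all
  \<comment> \<open>A' + B' y vanishes at S and at -S while \<open>yc S\<close> is nonzero, so X -
    \<open>xc S\<close> divides A' and B' separately.\<close>
  then have "poly A' (xc S) + poly B' (xc S) * yc S = 0" "poly A' (xc S) - poly B' (xc S) * yc S = 0"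
    using Snz by (simp_all add: ev_def)
  then have "2 * poly A' (xc S) = 0" "2 * (poly B' (xc S) * yc S) = 0" by Groebner_Basis.algebra+
  then have "poly A' (xc S) = 0" "poly B' (xc S) = 0" using yS by simp_all
  then obtain A2 B2 where A2: "A' = [:- xc S, 1:] * A2" and B2: "B' = [:- xc S, 1:] * B2"
    by (meson dvdE poly_eq_0_iff_dvd)
  have ev2: "ev A2 B2 U = 0" if "ev A' B' U = 0" "xc U \<noteq> xc S" for U
  proof -
    have "(xc U - xc S) * ev A2 B2 U = 0"
      using that(1) by (simp add: ev_def A2 B2 algebra_simps)
    with that(2) show ?thesis by simp
  qed
  have dA': "2 * Polynomial.degree A' \<le> n + 4"
  proof -
    have "Polynomial.degree (B * cubic) \<le> Polynomial.degree B + 3" "Polynomial.degree (A * L) \<le> Polynomial.degree A + 1"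
      using degree_mult_le[of B cubic] degree_cubic(1) degree_mult_le[of A L] L(1) by auto
    then have "Polynomial.degree A' \<le> max (Polynomial.degree B + 3) (Polynomial.degree A + 1)"
      unfolding A'_def by (intro degree_diff_le) auto
    then show ?thesis using AB by auto
  qed
  have dB': "2 * Polynomial.degree B' + 3 \<le> n + 4"
  proof -
    have "Polynomial.degree (B * L) \<le> Polynomial.degree B + 1"
      using degree_mult_le[of B L] L(1) by auto
    then have "Polynomial.degree B' \<le> max (Polynomial.degree A) (Polynomial.degree B + 1)"
      unfolding B'_def by (intro degree_diff_le) auto
    then show ?thesis using AB by auto
  qed
  have dA2: "2 * Polynomial.degree A2 \<le> n + 2"
  proof (cases "A2 = 0")
    case False
    then have "Polynomial.degree A' = Polynomial.degree A2 + 1"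
      unfolding A2 by (subst degree_mult_eq) auto
    then show ?thesis using dA' by simp
  qed simp
  have dB2: "2 * Polynomial.degree B2 + 3 \<le> n + 2"
  proof (cases "B2 = 0")
    case False
    then have "Polynomial.degree B' = Polynomial.degree B2 + 1"
      unfolding B2 by (subst degree_mult_eq) auto
    then show ?thesis using dB' by simp
  qed (use Suc in simp)
  \<comment> \<open>A zero quotient would give \<open>cubic\<close> = L L, although L has degree at
    most 1.\<close>
  have nz: "A2 \<noteq> 0 \<or> B2 \<noteq> 0"
  proof (rule ccontr)
    assume "\<not> ?thesis"
    then have "A' = 0" "B' = 0" by (auto simp: A2 B2)
    then have e: "B * cubic = A * L" "A = B * L" by (simp_all add: A'_def B'_def)
    then have e2: "B * cubic = B * (L * L)" by (simp add: mult.assoc)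
    have "B \<noteq> 0" using AB(1) e(2) by auto
    with e2 have "cubic = L * L" by simp
    then have "3 \<le> Polynomial.degree L + Polynomial.degree L"
      using degree_cubic(1) degree_mult_le[of L L] by simp
    with L(1) show False by simp
  qed
  have van: "ev A2 B2 (pt 1 (int i)) = 0" if "i \<in> {1..Suc n}" for i
  proof (rule ev2)
    show "ev A' B' (pt 1 (int i)) = 0"
    proof (cases "i = Suc n")
      case True
      then show ?thesis using ev'[OF pt_in Xnz] L(3) by simp
    next
      case False
      then show ?thesis using ev'[OF pt_in Xnz] AB(4) that by simp
    qed
    show "xc (pt 1 (int i)) \<noteq> xc S" by (rule xX)
  qed
  moreover have "ev A2 B2 S' = 0"
    using ev'[OF S'in S'nz] L(4) xS' by (intro ev2) simp_all
  ultimately show ?case using nz dA2 dB2 unfolding S'_def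
    by (intro exI[of _ A2] exI[of _ B2]) (simp add: miller_fn_def)
qed

text \<open>For n = p - 1 the residual zero is -((p - 1) Q + (p (p - 1) / 2) P). It equals Q because
  p is odd, so it is the one point of the coset still missing.\<close>

lemma exists_vanishing_poly:
  obtains A B where "A \<noteq> 0 \<or> B \<noteq> 0" "2 * Polynomial.degree A \<le> p" "2 * Polynomial.degree B + 3 \<le> p"
    "\<And>k. ev A B (pt 1 k) = 0"
proof -
  obtain A B where AB: "A \<noteq> 0 \<or> B \<noteq> 0" "2 * Polynomial.degree A \<le> p" "2 * Polynomial.degree B + 3 \<le> p"
    "\<forall>i\<in>{1..p-1}. ev A B (pt 1 (int i)) = 0"
    "ev A B (pt (- int (p - 1)) (- int (\<Sum>{1..p-1}))) = 0"
  proof -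
    have "2 \<le> p - 1" using p_ge_5 by simp
    then obtain A B where "miller_fn (p - 1) A B" using exists_miller_fn by blast
    moreover have "p - 1 + 1 = p" using p_ge_5 by simp
    ultimately show ?thesis using that unfolding miller_fn_def by metis
  qed
  have "pt (- int (p - 1)) (- int (\<Sum>{1..p-1})) = pt 1 0"
  proof -
    have "2 * \<Sum>{1..n} = n * (n + 1)" for n :: nat by (induction n) auto
    from this[of "p - 1"] have "2 * int (\<Sum>{1..p-1}) = int (p - 1) * int p"
      using p_ge_5 by (metis Suc_diff_1 Suc_eq_plus1 of_nat_mult of_nat_numeral prime_gt_0_nat prime_p)
    then have "int p dvd int (\<Sum>{1..p-1})" using two_nz by (metis dvd_triv_right)
    then show ?thesis using p_ge_5 by (simp add: pt_eq_iff del: of_nat_sum)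
  qed
  with AB(5) have 0: "ev A B (pt 1 0) = 0" by simp
  have "ev A B (pt 1 k) = 0" for k
  proof (cases "k mod int p = 0")
    case True
    then show ?thesis using 0 pt_mod[of 1 k] by simp
  next
    case False
    define i where "i = nat (k mod int p)"
    have i: "int i = k mod int p" using p_ge_5 by (simp add: i_def)
    moreover have "k mod int p < int p" using p_ge_5 by simp
    ultimately have "i \<in> {1..p-1}" using False by auto
    then have "ev A B (pt 1 (int i)) = 0" using AB(4) by blast
    then show ?thesis using i pt_mod[of 1 k] by simp
  qed
  then show ?thesis using AB that by blast
qed

text \<open>Partial fractions of (A + B y) / \<open>Dp\<close>. The numerator has a pole of order at
  most p at infinity and \<open>Dp\<close> one of order p - 1, so at most a simple pole remains
  there.\<close>

lemma exists_vanishing: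
  obtains c r where "sum r C = 0" "r Infinity \<noteq> 0" "\<And>k. slope_sum c r (pt 1 k) = 0"
proof -
  obtain A B where AB: "A \<noteq> 0 \<or> B \<noteq> 0" "2 * Polynomial.degree A \<le> p" "2 * Polynomial.degree B + 3 \<le> p"
    "\<And>k. ev A B (pt 1 k) = 0" using exists_vanishing_poly by blast
  let ?h = "card Xs"
  \<comment> \<open>Subtracting c \<open>Dp\<close> brings A below degree h, as interpolation at h
    nodes requires.\<close>
  define c where "c = Polynomial.coeff A ?h"
  define A0 where "A0 = A - smult c Dp"
  define q where "q T = poly (Dq (xc T)) (xc T)" for T
  \<comment> \<open>Solution of the two equations that \<open>lin\<close> imposes at the node xc T:
    r T + r (-T) = B / q and (r T - r (-T)) yc T = - A0 / q.\<close>
  define r0 where "r0 T = (poly B (xc T) / q T - poly A0 (xc T) / (yc T * q T)) / 2" for T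
  define r where "r = r0(Infinity := - sum r0 Cs)"
  have q: "q T \<noteq> 0" "q (neg T) = q T" if "T \<in> Cs" for T
    using poly_Dq_nz Cs_facts(2)[OF that] by (simp_all add: q_def)
  have rr: "r T = r0 T" if "T \<in> Cs" for T using Cs_facts(2)[OF that] by (simp add: r_def)
  have dA0: "Polynomial.degree A0 < ?h"
  proof (rule degree_less_if_coeff_eq_0)
    show "Polynomial.degree A0 \<le> ?h"
      unfolding A0_def using AB(2) card_Xs degree_Dp(1) degree_smult_le[of c Dp]
      by (intro degree_diff_le) auto
    show "Polynomial.coeff A0 ?h = 0" by (simp add: A0_def c_def degree_Dp(2))
    show "?h > 0" using card_Xs_ge by simp
  qed
  have r_val: "r T = (poly B (xc T) / q T - poly A0 (xc T) / (yc T * q T)) / 2"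
    "r (neg T) = (poly B (xc T) / q T + poly A0 (xc T) / (yc T * q T)) / 2" if T: "T \<in> Cs" for T
    using rr[OF T] rr[OF Cs_facts(3)[OF T]] q[OF T] Cs_facts(2)[OF T] by (simp_all add: r0_def)
  have r_sum: "r T + r (neg T) = poly B (xc T) / q T"
    and r_diff: "r T - r (neg T) = - poly A0 (xc T) / (yc T * q T)" if T: "T \<in> Cs" for T
    unfolding r_val[OF T] by (simp_all add: add_divide_distrib diff_divide_distrib)
  have linr: "lin r = B"
  proof (rule lagrange)
    show "Polynomial.degree B < ?h" using AB(3) card_Xs by simp
    fix T assume T: "T \<in> Cs"
    show "(r T + r (neg T)) * poly (Dq (xc T)) (xc T) = poly B (xc T)"
      using r_sum[OF T] q(1)[OF T] by (simp flip: q_def)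
  qed
  have linry: "lin (\<lambda>T. r T * yc T) = - A0"
  proof (rule lagrange)
    show "Polynomial.degree (- A0) < ?h" using dA0 by simp
    fix T assume T: "T \<in> Cs"
    have "r T * yc T + r (neg T) * yc (neg T) = (r T - r (neg T)) * yc T"
      using Cs_facts(2)[OF T] by (simp add: algebra_simps)
    then show "(r T * yc T + r (neg T) * yc (neg T)) * poly (Dq (xc T)) (xc T) = poly (- A0) (xc T)"
      using r_diff[OF T] q(1)[OF T] Cs_facts(5)[OF T] by (simp flip: q_def)
  qed
  have sum: "sum r C = 0"
    using rr by (simp add: C_eq) (simp add: r_def)
  have van: "slope_sum c r (pt 1 k) = 0" for k
  proof -
    have "poly Dp (xc (pt 1 k)) * slope_sum c r (pt 1 k) = ev A B (pt 1 k)"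
      using slope_sum_poly(1)[OF pt_in coset_not_in_C, of k c r] linr linry by (simp add: ev_def A0_def)
    then show ?thesis using AB(4) slope_sum_poly(2)[OF pt_in coset_not_in_C, of k] by simp
  qed
  have "r Infinity \<noteq> 0"
  proof
    assume "r Infinity = 0"
    note z = vanishing_unique[OF sum this van]
    have rz: "r T = 0" if "T \<in> Cs" for T using z(2)[of T] that by (simp add: Cs_def)
    have "lin r = 0" "lin (\<lambda>T. r T * yc T) = 0" using rz by (simp_all add: lin_def)
    then have "A = 0" "B = 0" using linr linry z(1) by (simp_all add: A0_def)
    with AB(1) show False by simp
  qed
  with sum van show ?thesis using that by blast
qed

text \<open>By the cocycle identity the slope at Y + P and T is slope P T + slope Y (P + T) - slope
  Y P. The first term does not depend on Y, and the last drops out because the residues sum to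
  zero.\<close>

lemma slope_sum_translate:
  assumes "Y \<in> pts" "Y \<notin> C" "sum r C = 0"
  shows "slope_sum c r (Y \<oplus>\<oplus> P)
    = slope_sum (c + (\<Sum>T\<in>C. r T * (if T = Infinity \<or> T = neg P then 0 else slope P T))) (\<lambda>U. r (U \<oplus>\<oplus> neg P)) Y"
proof -
  define \<kappa> where "\<kappa> T = (if T = Infinity \<or> T = neg P then 0 else slope P T)" for T
  have "\<not> int p dvd 1" using p_ge_5 by (intro not_dvd_small) auto
  then have Pnz: "P \<noteq> Infinity" using P_eq pt_eq_Infinity by metis
  have Ynz: "Y \<noteq> Infinity" using assms Infinity_in_C by auto
  have YC: "Y \<noteq> T" if "T \<in> C" for T using assms that by auto
  have Cadd: "U \<oplus>\<oplus> V \<in> C" if "U \<in> C" "V \<in> C" for U V using that by (auto simp: C_def pt_add)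
  have Cneg: "neg U \<in> C" if "U \<in> C" for U using that by (auto simp: C_def neg_pt)
  have "P \<in> C" unfolding C_def using P_eq by (metis rangeI)
  then have PC: "P \<in> C" "neg P \<in> C" using Cneg by auto
  have Cpts: "U \<in> pts" if "U \<in> C" for U using that by (auto simp: C_def)
  \<comment> \<open>\<open>slope_cocycle\<close> does not cover T = Infinity and T = -P. There
    \<open>slope\<close> has its default value 0 at Infinity, and \<kappa> = 0 is the value that
    keeps the identity valid.\<close>
  have *: "slope (Y \<oplus>\<oplus> P) T = \<kappa> T + slope Y (P \<oplus>\<oplus> T) - slope Y P" if T: "T \<in> C" for T
  proof (cases "T = Infinity \<or> T = neg P")
    case True
    have O: "slope U Infinity = 0" for U by (cases U) auto
    from True show ?thesis
    proof
      assume "T = Infinity" then show ?thesis by (simp add: \<kappa>_def O)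
    next
      assume T: "T = neg P"
      have "P \<noteq> neg Y" using YC[OF PC(2)] by (metis neg_neg)
      then have "slope (Y \<oplus>\<oplus> P) T = - slope Y P"
        using T slope_add_neg[of Y P] assms P_in Ynz Pnz by simp
      moreover have "P \<oplus>\<oplus> T = Infinity" using T by (simp add: add_eq_Infinity)
      ultimately show ?thesis using T by (simp add: \<kappa>_def O)
    qed
  next
    case False
    have "slope Y P + slope (Y \<oplus>\<oplus> P) T = slope P T + slope Y (P \<oplus>\<oplus> T)"
    proof (rule slope_cocycle)
      show "Y \<noteq> neg P" "Y \<noteq> neg T" "Y \<noteq> T" using YC PC Cneg T by auto
      show "P \<oplus>\<oplus> T \<noteq> neg Y" using YC[OF Cneg[OF Cadd[OF PC(1) T]]] by (metis neg_neg)
      show "Y \<oplus>\<oplus> P \<noteq> neg T"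
      proof
        assume "Y \<oplus>\<oplus> P = neg T"
        then have "P \<oplus>\<oplus> Y = neg T" using assms P_in by (simp add: add_commute)
        then have "Y = neg P \<oplus>\<oplus> neg T" using neg_add_cancel[of P Y] assms P_in by simp
        then show False using YC Cadd PC Cneg T by blast
      qed
      show "P \<noteq> neg T" using False by (metis neg_neg)
    qed (use assms P_in Cpts T Ynz Pnz False in auto)
    then show ?thesis using False by (simp add: \<kappa>_def algebra_simps)
  qed
  have "slope_sum c r (Y \<oplus>\<oplus> P) = c + (\<Sum>T\<in>C. r T * (\<kappa> T + slope Y (P \<oplus>\<oplus> T) - slope Y P))"
    unfolding slope_sum_def using * by simp
  also have "\<dots> = c + (\<Sum>T\<in>C. r T * \<kappa> T) + (\<Sum>T\<in>C. r T * slope Y (P \<oplus>\<oplus> T)) - sum r C * slope Y P"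
    by (simp add: algebra_simps sum.distrib sum_subtractf sum_distrib_left)
  also have "(\<Sum>T\<in>C. r T * slope Y (P \<oplus>\<oplus> T)) = (\<Sum>U\<in>C. r (U \<oplus>\<oplus> neg P) * slope Y U)"
  proof (rule sum.reindex_bij_witness[of _ "\<lambda>U. U \<oplus>\<oplus> neg P" "\<lambda>T. P \<oplus>\<oplus> T"])
    fix T assume T: "T \<in> C"
    show *: "(P \<oplus>\<oplus> T) \<oplus>\<oplus> neg P = T"
      using neg_add_cancel[of P T] Cpts[OF T] P_in by (simp add: add_commute)
    show "P \<oplus>\<oplus> T \<in> C" using Cadd PC T by blast
    show "r ((P \<oplus>\<oplus> T) \<oplus>\<oplus> neg P) * slope Y (P \<oplus>\<oplus> T) = r T * slope Y (P \<oplus>\<oplus> T)" using * by simp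
  next
    fix U assume U: "U \<in> C"
    show "P \<oplus>\<oplus> (U \<oplus>\<oplus> neg P) = U"
      using neg_add_cancel[of "neg P" U] Cpts[OF U] P_in by (simp add: add_commute)
    show "U \<oplus>\<oplus> neg P \<in> C" using Cadd PC U by blast
  qed
  finally show ?thesis using assms(3) by (simp add: slope_sum_def \<kappa>_def)
qed

end

section \<open>The root of unity attached to a pair of torsion points\<close>

context short_curve
begin

lemma map_point_add:
  assumes "field_endo \<sigma>" "\<sigma> a = a" "\<sigma> b = b"
  shows "map_point \<sigma> (U \<oplus>\<oplus> V) = map_point \<sigma> U \<oplus>\<oplus> map_point \<sigma> V"
proof (rule map_point_point_add[OF assms(1)])
  interpret field_endo \<sigma> by fact
  show "\<sigma> x = x" if "x \<in> set_weierstrass curve" for x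
    using that assms(2,3) by (auto simp: curve_def)
qed

lemma map_point_in_pts:
  assumes "field_endo \<sigma>" "\<sigma> a = a" "\<sigma> b = b" "U \<in> pts"
  shows "map_point \<sigma> U \<in> pts"
proof -
  interpret field_endo \<sigma> by fact
  show ?thesis
  proof (cases U)
    case (Affine x y)
    then have "\<sigma> (y ^ 2) = \<sigma> (x ^ 3 + a * x + b)" using assms by (simp add: Affine_in_pts)
    then show ?thesis using Affine assms by (simp add: Affine_in_pts hom_simps)
  qed simp
qed

lemma slope_map_point:
  assumes "field_endo \<sigma>" "\<sigma> a = a"
  shows "slope (map_point \<sigma> U) (map_point \<sigma> V) = \<sigma> (slope U V)"
proof -
  interpret field_endo \<sigma> by fact
  show ?thesis using assms by (cases U; cases V) (auto simp: hom_simps)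
qed

end

context torsion_pair
begin

text \<open>The combination of the two functions that cancels the pole at infinity falls under
  \<open>vanishing_unique\<close>.\<close>

lemma vanishing_proportional:
  assumes "sum r C = 0" "r Infinity \<noteq> 0" "\<And>k. slope_sum c r (pt 1 k) = 0"
    and "sum r' C = 0" "\<And>k. slope_sum c' r' (pt 1 k) = 0" "T \<in> C"
  shows "r' T * r Infinity = r T * r' Infinity"
proof -
  define r2 where "r2 U = r Infinity * r' U - r' Infinity * r U" for U
  define c2 where "c2 = r Infinity * c' - r' Infinity * c"
  have "sum r2 C = 0"
    using assms(1,4) by (simp add: r2_def sum_subtractf flip: sum_distrib_left)
  moreover have "r2 Infinity = 0" by (simp add: r2_def)
  moreover have "slope_sum c2 r2 Y = r Infinity * slope_sum c' r' Y - r' Infinity * slope_sum c r Y" for Y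
    by (simp add: slope_sum_def r2_def c2_def algebra_simps sum_subtractf sum_distrib_left)
  then have "slope_sum c2 r2 (pt 1 k) = 0" for k using assms(3,5) by simp
  ultimately have "r2 T = 0" using vanishing_unique(2) assms(6) by blast
  then show ?thesis by (simp add: r2_def algebra_simps)
qed

lemma pt_pow: "pt m k [^]\<^bsub>G\<^esub> (i :: int) = pt (m * i) (k * i)"
proof -
  have *: "pt m k [^]\<^bsub>G\<^esub> n = pt (m * int n) (k * int n)" for n :: nat
  proof (induction n)
    case 0
    then show ?case using pt_0_0 by simp
  next
    case (Suc n)
    then show ?case by (simp add: pt_add algebra_simps)
  qed
  show ?thesis
  proof (cases "i \<ge> 0")
    case True
    then obtain n where "i = int n" using nonneg_int_cases by blast
    then show ?thesis by (simp add: int_pow_int *)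
  next
    case False
    define n where "n = nat (- i)"
    have "i = - int n" using False by (simp add: n_def)
    have "pt m k [^]\<^bsub>G\<^esub> (- int n) = inv\<^bsub>G\<^esub> (pt m k [^]\<^bsub>G\<^esub> n)"
      by (rule G.int_pow_neg_int) simp
    also have "\<dots> = neg (pt (m * int n) (k * int n))" unfolding * by (rule inv_G) simp
    finally show ?thesis using \<open>i = - int n\<close> by (simp add: neg_pt)
  qed
qed

text \<open>Negation turns an automorphism that acts on Q with coefficient -1 into a map preserving
  the coset Q + C.\<close>

definition flip :: "bool \<Rightarrow> 'a point \<Rightarrow> 'a point" where
  "flip e U = (if e then neg U else U)"

text \<open>t is chosen before \<sigma>, so one root of unity serves all automorphisms. The image of
  Q enters only through its coset, which leaves j arbitrary.\<close>

lemma pairing_root_of_unity: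
  obtains t where "t \<noteq> 1" "t ^ p = 1"
    "\<And>\<sigma> e k j. \<lbrakk>field_endo \<sigma>; \<sigma> a = a; \<sigma> b = b; flip e (map_point \<sigma> P) = pt 0 (int k);
       flip e (map_point \<sigma> Q) = pt 1 j\<rbrakk> \<Longrightarrow> \<sigma> t = t ^ k"
proof -
  obtain c r where sum0: "sum r C = 0" and r0: "r Infinity \<noteq> 0" and van: "\<And>k. slope_sum c r (pt 1 k) = 0"
    using exists_vanishing by blast
  note proportional = vanishing_proportional[OF sum0 r0 van]
  define t where "t = r (neg P) / r Infinity"
  have Cadd: "U \<oplus>\<oplus> V \<in> C" if "U \<in> C" "V \<in> C" for U V using that by (auto simp: C_def pt_add)
  have negP: "neg P = pt 0 (- 1)"
    using arg_cong[OF P_eq, of neg] neg_pt[of 0 1] by (metis minus_zero)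
  have PC: "P \<in> C" "neg P \<in> C"
    using P_eq negP unfolding C_def by (metis rangeI)+
  have Cpts: "U \<in> pts" if "U \<in> C" for U using that by (auto simp: C_def)
  have step: "r (U \<oplus>\<oplus> neg P) = t * r U" if U: "U \<in> C" for U
  proof -
    define r' where "r' = (\<lambda>U. r (U \<oplus>\<oplus> neg P))"
    define c' where "c' = c + (\<Sum>T\<in>C. r T * (if T = Infinity \<or> T = neg P then 0 else slope P T))"
    have "sum r' C = sum r C"
      unfolding r'_def
    proof (rule sum.reindex_bij_witness[of _ "\<lambda>T. P \<oplus>\<oplus> T" "\<lambda>U. U \<oplus>\<oplus> neg P"])
      fix T assume T: "T \<in> C"
      show "P \<oplus>\<oplus> (T \<oplus>\<oplus> neg P) = T"
        using neg_add_cancel[of "neg P" T] Cpts[OF T] P_in by (simp add: add_commute)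
      show "T \<oplus>\<oplus> neg P \<in> C" "P \<oplus>\<oplus> T \<in> C" using Cadd PC T by blast+
      show "(P \<oplus>\<oplus> T) \<oplus>\<oplus> neg P = T"
        using neg_add_cancel[of P T] Cpts[OF T] P_in by (simp add: add_commute)
    qed simp
    moreover have "slope_sum c' r' (pt 1 k) = 0" for k
    proof -
      have "pt 1 k \<oplus>\<oplus> P = pt 1 (k + 1)" using P_eq pt_add[of 1 k 0 1] by simp
      then have "slope_sum c r (pt 1 k \<oplus>\<oplus> P) = 0" using van by simp
      then show ?thesis
        using slope_sum_translate[where c = c, OF pt_in coset_not_in_C sum0] unfolding c'_def r'_def by metis
    qed
    ultimately have "r' U * r Infinity = r U * r' Infinity" using proportional U sum0 by metis
    then show ?thesis using r0 by (simp add: t_def r'_def field_simps)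
  qed
  have steps: "r (pt 0 (- int n)) = t ^ n * r Infinity" for n
  proof (induction n)
    case 0
    then show ?case by (simp add: pt_0_0)
  next
    case (Suc n)
    have "pt 0 (- int (Suc n)) = pt 0 (- int n) \<oplus>\<oplus> neg P"
      using negP pt_add[of 0 "- int n" 0 "-1"] by (metis add.commute add_0 diff_conv_add_uminus minus_add_distrib of_nat_Suc)
    moreover have "pt 0 (- int n) \<in> C" by (simp add: C_def)
    ultimately show ?case using step Suc by simp
  qed
  have "pt 0 (- int p) = Infinity" by (simp add: pt_eq_Infinity)
  then have tp: "t ^ p = 1" using steps[of p] r0 by simp
  have t1: "t \<noteq> 1"
  proof
    assume "t = 1"
    have "r U = r Infinity" if U: "U \<in> C" for U
    proof -
      obtain k where k: "U = pt 0 k" using U by (auto simp: C_def)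
      have "U = pt 0 (- int (nat ((- k) mod int p)))"
      proof -
        have "int (nat ((- k) mod int p)) = (- k) mod int p" using p_ge_5 by simp
        moreover have "int p dvd k - - ((- k) mod int p)"
        proof -
          have "int p dvd - k - (- k) mod int p" by (rule dvd_minus_mod)
          then have "int p dvd - (- k - (- k) mod int p)" by (simp only: dvd_minus_iff)
          then show ?thesis by (simp add: algebra_simps)
        qed
        ultimately show ?thesis by (simp add: k pt_eq_iff)
      qed
      then show ?thesis using steps[of "nat ((- k) mod int p)"] \<open>t = 1\<close> by (metis mult_1 power_one)
    qed
    then have "sum r C = of_nat p * r Infinity" by (simp add: card_C)
    then show False using sum0 r0 p_ge_5 by simp
  qed
  show ?thesis
  proof (rule that[OF t1 tp])
    fix \<sigma> e k j
    assume \<sigma>: "field_endo \<sigma>" "\<sigma> a = a" "\<sigma> b = b"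
      and P: "flip e (map_point \<sigma> P) = pt 0 (int k)" and Q: "flip e (map_point \<sigma> Q) = pt 1 j"
    interpret field_endo \<sigma> by fact
    define \<psi> where "\<psi> U = flip e (map_point \<sigma> U)" for U
    \<comment> \<open>Negation reverses slopes. The transported residues carry the same sign, and
      the two signs cancel in the sum.\<close>
    define s :: 'a where "s = (if e then - 1 else 1)"
    have ss: "s * s = 1" by (simp add: s_def)
    have \<psi>in: "\<psi> U \<in> pts" if "U \<in> pts" for U
      using map_point_in_pts[OF \<sigma> that] by (simp add: \<psi>_def flip_def)
    have \<psi>add: "\<psi> (U \<oplus>\<oplus> V) = \<psi> U \<oplus>\<oplus> \<psi> V" if "U \<in> pts" "V \<in> pts" for U V
      using map_point_add[OF \<sigma>, of U V] map_point_in_pts[OF \<sigma>] that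
      by (simp add: \<psi>_def flip_def neg_add)
    have "\<psi> \<in> hom G G" using \<psi>in \<psi>add by (auto simp: hom_def)
    then interpret \<psi>: group_hom G G \<psi> by unfold_locales
    have \<psi>pt: "\<psi> (pt m i) = pt m (j * m + int k * i)" for m i
    proof -
      have "\<psi> (Q [^]\<^bsub>G\<^esub> m) = pt m (j * m)" "\<psi> (P [^]\<^bsub>G\<^esub> i) = pt 0 (int k * i)"
        using \<psi>.hom_int_pow[of Q m] \<psi>.hom_int_pow[of P i] P_in Q_in P Q
        by (simp_all add: \<psi>_def[symmetric] pt_pow)
      moreover have "Q [^]\<^bsub>G\<^esub> m \<in> pts" "P [^]\<^bsub>G\<^esub> i \<in> pts"
        using G.int_pow_closed[of Q m] G.int_pow_closed[of P i] P_in Q_in by simp_all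
      ultimately show ?thesis unfolding pt_def[of m i] by (simp add: \<psi>add pt_add)
    qed
    have inj: "inj \<psi>"
    proof (rule injI)
      fix U V assume "\<psi> U = \<psi> V"
      then have "map_point \<sigma> U = map_point \<sigma> V"
        by (auto simp: \<psi>_def flip_def neg_eq_iff split: if_splits)
      moreover have "inj \<sigma>" by (simp add: inj_def)
      ultimately show "U = V" using point.inj_map by (metis injD)
    qed
    \<comment> \<open>An injective self-map of a finite coset is onto, so both the residues on C and
      the zeros on Q + C can be reindexed along \<psi>.\<close>
    have surj: "\<psi> ` range (pt m) = range (pt m)" for m
    proof (rule endo_inj_surj)
      show "finite (range (pt m))" by (simp add: range_pt)
      show "\<psi> ` range (pt m) \<subseteq> range (pt m)" using \<psi>pt by auto
      show "inj_on \<psi> (range (pt m))" using inj by (rule inj_on_subset) simp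
    qed
    have \<psi>slope: "slope (\<psi> Y) (\<psi> T) = s * \<sigma> (slope Y T)" if "Y \<in> pts" "Y \<notin> C" "T \<in> C" for Y T
    proof -
      have ne: "map_point \<sigma> T \<noteq> neg (map_point \<sigma> Y)"
      proof
        assume h: "map_point \<sigma> T = neg (map_point \<sigma> Y)"
        have "map_point \<sigma> (neg Y) = neg (map_point \<sigma> Y)" by (cases Y) (simp_all add: hom_minus)
        with h have "T = neg Y" using point.inj_map[of \<sigma>] by (metis hom_eq_iff injD injI)
        then have "neg Y \<in> C" using that by simp
        then obtain i where "neg Y = pt 0 i" by (auto simp: C_def)
        then have "Y = pt 0 (- i)" using neg_pt[of 0 i] by (metis neg_neg minus_zero)
        then show False using that by (simp add: C_def)
      qed
      show ?thesis
        using slope_neg[OF map_point_in_pts[OF \<sigma>] map_point_in_pts[OF \<sigma>] ne] that Cpts[OF that(3)]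
          slope_map_point[OF \<sigma>(1,2), of Y T]
        by (simp add: \<psi>_def flip_def s_def)
    qed
    define r' where "r' U = s * \<sigma> (r (inv_into UNIV \<psi> U))" for U
    have r': "r' (\<psi> T) = s * \<sigma> (r T)" for T
      using inj by (simp add: r'_def)
    have reindex: "(\<Sum>U\<in>C. f U) = (\<Sum>T\<in>C. f (\<psi> T))" for f :: "'a point \<Rightarrow> 'a"
    proof -
      have "sum f (\<psi> ` C) = (\<Sum>T\<in>C. f (\<psi> T))"
        using inj by (subst sum.reindex) (auto intro: inj_on_subset)
      then show ?thesis using surj[of 0] by (simp add: C_def)
    qed
    have "sum r' C = s * \<sigma> (sum r C)"
      using reindex[of r'] by (simp add: r' hom_sum sum_distrib_left)
    then have sum0': "sum r' C = 0" using sum0 by simp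
    have "slope_sum (\<sigma> c) r' (\<psi> Y) = \<sigma> (slope_sum c r Y)" if "Y \<in> pts" "Y \<notin> C" for Y
    proof -
      have "(\<Sum>T\<in>C. r' (\<psi> T) * slope (\<psi> Y) (\<psi> T)) = (\<Sum>T\<in>C. \<sigma> (r T * slope Y T))"
      proof (rule sum.cong)
        fix T assume "T \<in> C"
        have "r' (\<psi> T) * slope (\<psi> Y) (\<psi> T) = (s * s) * \<sigma> (r T * slope Y T)"
          using \<psi>slope[OF that \<open>T \<in> C\<close>] by (simp add: r' hom_mult)
        then show "r' (\<psi> T) * slope (\<psi> Y) (\<psi> T) = \<sigma> (r T * slope Y T)" by (simp add: ss)
      qed simp
      then show ?thesis using reindex[of "\<lambda>T. r' T * slope (\<psi> Y) T"] by (simp add: slope_sum_def hom_add hom_sum)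
    qed
    then have van1: "slope_sum (\<sigma> c) r' (\<psi> (pt 1 i)) = 0" for i
      using van coset_not_in_C by simp
    have van': "slope_sum (\<sigma> c) r' (pt 1 i) = 0" for i
    proof -
      have "pt 1 i \<in> \<psi> ` range (pt 1)" using surj[of 1] by simp
      then show ?thesis using van1 by auto
    qed
    have "pt 0 (- int k) \<in> C" by (simp add: C_def)
    from proportional[OF sum0' van' this]
    have 1: "r' (pt 0 (- int k)) = t ^ k * r' Infinity" using steps r0 by simp
    have "\<psi> Infinity = Infinity" by (simp add: \<psi>_def flip_def)
    then have i: "r' Infinity = s * \<sigma> (r Infinity)" using r'[of Infinity] by simp
    \<comment> \<open>t is the ratio of the residues at -P and at infinity. The image of -P is -k P,
      where the proportional function has ratio t^k.\<close>
    have "\<psi> (pt 0 (- 1)) = pt 0 (- int k)" by (simp add: \<psi>pt)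
    then have "r' (pt 0 (- int k)) = s * \<sigma> (r (pt 0 (- 1)))" using r'[of "pt 0 (- 1)"] by simp
    also have "r (pt 0 (- 1)) = t * r Infinity" using steps[of 1] by simp
    finally have "r' (pt 0 (- int k)) = \<sigma> t * r' Infinity" by (simp add: hom_mult i)
    moreover have "r' Infinity \<noteq> 0" using i r0 by (simp add: s_def)
    ultimately show "\<sigma> t = t ^ k" using 1 by simp
  qed
qed

end

section \<open>Automorphisms of an algebraic closure\<close>

lemma ambient_simps [simp]:
  "carrier ambient = UNIV" "x \<otimes>\<^bsub>ambient\<^esub> y = x * y" "x \<oplus>\<^bsub>ambient\<^esub> y = x + y"
  "\<one>\<^bsub>ambient\<^esub> = 1" "\<zero>\<^bsub>ambient\<^esub> = 0"
  by (simp_all add: ring_of_type_algebra_def)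

lemma field_ambient: "field (ambient :: 'a :: field_char_0 ring)"
  by (rule field_from_type_algebra)

lemma ambient_minus [simp]: "\<ominus>\<^bsub>ambient\<^esub> (x :: 'a :: field_char_0) = - x"
proof -
  interpret field "ambient :: 'a ring" by (rule field_ambient)
  show ?thesis by (rule minus_equality) simp_all
qed

lemma ambient_inv [simp]: "x \<noteq> 0 \<Longrightarrow> inv\<^bsub>ambient\<^esub> (x :: 'a :: field_char_0) = inverse x"
proof -
  interpret field "ambient :: 'a ring" by (rule field_ambient)
  show "x \<noteq> 0 \<Longrightarrow> ?thesis" by (rule comm_inv_char) simp_all
qed

lemma subfield_closed:
  fixes M :: "'a :: field_char_0 set"
  assumes "subfield M ambient"
  shows "0 \<in> M" "1 \<in> M" "x \<in> M \<Longrightarrow> y \<in> M \<Longrightarrow> x + y \<in> M" "x \<in> M \<Longrightarrow> y \<in> M \<Longrightarrow> x * y \<in> M"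
    "x \<in> M \<Longrightarrow> - x \<in> M" "x \<in> M \<Longrightarrow> y \<in> M \<Longrightarrow> x - y \<in> M" "x \<in> M \<Longrightarrow> inverse x \<in> M"
    "x \<in> M \<Longrightarrow> y \<in> M \<Longrightarrow> x / y \<in> M" "of_nat n \<in> M" "numeral k \<in> M"
proof -
  interpret field "ambient :: 'a ring" by (rule field_ambient)
  note r = subringE[OF subfieldE(1)[OF assms], simplified]
  show 1: "0 \<in> M" "1 \<in> M" "\<And>x y. x \<in> M \<Longrightarrow> y \<in> M \<Longrightarrow> x + y \<in> M"
    "\<And>x y. x \<in> M \<Longrightarrow> y \<in> M \<Longrightarrow> x * y \<in> M" "\<And>x. x \<in> M \<Longrightarrow> - x \<in> M"
    using r by auto
  show "x \<in> M \<Longrightarrow> y \<in> M \<Longrightarrow> x - y \<in> M" using 1(3)[of x "- y"] 1(5) by simp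
  show i: "\<And>x. x \<in> M \<Longrightarrow> inverse x \<in> M"
  proof -
    fix x assume "x \<in> M"
    then show "inverse x \<in> M"
      using subfield_m_inv(1)[OF assms, of x] 1(1) by (cases "x = 0") auto
  qed
  show "x \<in> M \<Longrightarrow> y \<in> M \<Longrightarrow> x / y \<in> M" by (simp add: divide_inverse 1 i)
  show n: "of_nat n \<in> M" for n by (induction n) (simp_all add: 1)
  show "numeral k \<in> M" using n[of "numeral k"] by simp
qed

lemma subfieldI_ambient:
  fixes M :: "'a :: field_char_0 set"
  assumes "1 \<in> M" "\<And>x y. x \<in> M \<Longrightarrow> y \<in> M \<Longrightarrow> x + y \<in> M"
    "\<And>x y. x \<in> M \<Longrightarrow> y \<in> M \<Longrightarrow> x * y \<in> M" "\<And>x. x \<in> M \<Longrightarrow> - x \<in> M"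
    "\<And>x. x \<in> M \<Longrightarrow> x \<noteq> 0 \<Longrightarrow> inverse x \<in> M"
  shows "subfield M ambient"
proof -
  interpret field "ambient :: 'a ring" by (rule field_ambient)
  show ?thesis
    by (intro subfieldI' subringI) (use assms in auto)
qed

lemma subfield_adjoin: "subfield (adjoin K S) (ambient :: 'a :: field_char_0 ring)"
  unfolding adjoin_def by (rule field.generate_field_is_subfield[OF field_ambient]) simp

lemma adjoin_superset: "K \<union> S \<subseteq> adjoin K S"
  unfolding adjoin_def by (auto intro: generate_field.incl)

lemma adjoin_least:
  fixes M :: "'a :: field_char_0 set"
  assumes "subfield M ambient" "K \<subseteq> M" "S \<subseteq> M"
  shows "adjoin K S \<subseteq> M"
  unfolding adjoin_def
  by (rule field.generate_field_min_subfield1[OF field_ambient]) (use assms in auto)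

definition polys_over :: "'a :: field_char_0 set \<Rightarrow> 'a poly set" where
  "polys_over M = {q. \<forall>i. Polynomial.coeff q i \<in> M}"

lemma polys_overD: "q \<in> polys_over M \<Longrightarrow> Polynomial.coeff q i \<in> M"
  by (simp add: polys_over_def)

lemma eval_ambient:
  "ring.eval (ambient :: 'a :: field_char_0 ring) xs x = poly (Poly (rev xs)) x"
proof -
  interpret field "ambient :: 'a ring" by (rule field_ambient)
  have "x [^]\<^bsub>ambient\<^esub> n = x ^ n" for n :: nat
    by (induction n) simp_all
  then show ?thesis
    by (induction xs) (simp_all add: Poly_append poly_monom)
qed

lemma algebraic_closure_algebraic:
  fixes K :: "'a :: field_char_0 set"
  assumes "algebraic_closure (ambient :: 'a ring) K"
  obtains q where "q \<in> polys_over K" "q \<noteq> 0" "poly q x = 0"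
proof -
  interpret algebraic_closure "ambient :: 'a ring" K by fact
  have "(algebraic over K) x" using algebraic_extension by simp
  then obtain xs where xs: "xs \<in> carrier (K[X]\<^bsub>ambient\<^esub>)" "xs \<noteq> []" "eval xs x = 0"
    using algebraicE[OF subfieldE(1)[OF subfield_axioms], of x] by auto
  have "polynomial\<^bsub>ambient\<^esub> K xs" using xs(1) by (simp add: univ_poly_carrier)
  then have s: "set xs \<subseteq> K" "hd xs \<noteq> 0" using xs(2) by (auto simp: polynomial_def)
  have K: "0 \<in> K" using subfield_closed(1)[OF subfield_axioms] .
  \<comment> \<open>HOL-Algebra lists start with the leading coefficient, \<open>Poly\<close>
    expects the constant one first.\<close>
  define q where "q = Poly (rev xs)"
  have c: "Polynomial.coeff q i = nth_default 0 (rev xs) i" for i by (simp add: q_def)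
  have "q \<in> polys_over K"
    using s(1) K by (auto simp: polys_over_def c nth_default_def rev_nth)
  moreover have "Polynomial.coeff q (length xs - 1) = hd xs"
    using xs(2) by (simp add: c nth_default_def rev_nth hd_conv_nth)
  then have "q \<noteq> 0" using s(2) by auto
  moreover have "poly q x = 0" using xs(3) by (simp add: q_def eval_ambient)
  ultimately show ?thesis by (rule that)
qed

lemma algebraic_closure_root:
  fixes K :: "'a :: field_char_0 set" and q :: "'a poly"
  assumes "algebraic_closure (ambient :: 'a ring) K" "Polynomial.degree q > 0"
  shows "\<exists>x. poly q x = 0"
proof -
  interpret algebraic_closure "ambient :: 'a ring" K by fact
  define xs where "xs = rev (coeffs q)"
  have deg: "Polynomials.degree xs = Polynomial.degree q"
    by (auto simp: xs_def degree_eq_length_coeffs)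
  have car: "xs \<in> carrier (poly_ring ambient)"
    using assms(2)
    by (auto simp: univ_poly_def polynomial_def xs_def hd_rev last_coeffs_eq_coeff_degree)
  then have "splitted xs" using roots_over_carrier by blast
  then have "roots xs \<noteq> {#}" unfolding splitted_def using deg assms(2) by auto
  then obtain x where "x \<in># roots xs" by blast
  then have "is_root xs x" using roots_mem_iff_is_root[OF car] by auto
  then have "eval xs x = 0" by (simp add: is_root_def)
  then have "poly q x = 0" by (simp add: eval_ambient xs_def)
  then show ?thesis ..
qed

section \<open>Extension of partial embeddings to automorphisms\<close>

locale closed_over =
  fixes K :: "'a :: field_char_0 set"
  assumes closure: "algebraic_closure (ambient :: 'a ring) K"
begin

lemma subfield_K: "subfield K ambient"
  using closure unfolding algebraic_closure_def by blast

lemma nonzero_const_coeff: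
  assumes "x \<noteq> 0"
  obtains q where "q \<in> polys_over K" "Polynomial.coeff q 0 \<noteq> 0" "poly q x = 0"
proof -
  obtain q where "q \<in> polys_over K" "q \<noteq> 0" "poly q x = 0"
    using algebraic_closure_algebraic[OF closure] by blast
  then have "\<exists>q'\<in>polys_over K. Polynomial.coeff q' 0 \<noteq> 0 \<and> poly q' x = 0"
  proof (induction q)
    case (pCons c q)
    show ?case
    proof (cases "c = 0")
      case True
      then have "poly q x = 0" "q \<noteq> 0" using pCons.prems assms by auto
      moreover have "q \<in> polys_over K"
        using polys_overD[OF pCons.prems(1), of "Suc _"] by (simp add: polys_over_def)
      ultimately show ?thesis using pCons.IH by blast
    next
      case False
      then show ?thesis using pCons.prems by (intro bexI[of _ "pCons c q"]) auto
    qed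
  qed simp
  then show ?thesis using that by blast
qed

lemma poly_in_subring:
  assumes "\<And>x y. x \<in> R \<Longrightarrow> y \<in> R \<Longrightarrow> x + y \<in> R" "\<And>x y. x \<in> R \<Longrightarrow> y \<in> R \<Longrightarrow> x * y \<in> R"
    "0 \<in> R" "\<And>i. Polynomial.coeff q i \<in> R" "x \<in> R"
  shows "poly q x \<in> R"
  using assms(4)
proof (induction q)
  case (pCons c q)
  have "c \<in> R" using pCons.prems[of 0] by simp
  moreover have "Polynomial.coeff q i \<in> R" for i using pCons.prems[of "Suc i"] by simp
  ultimately show ?case using pCons.IH assms by simp
qed (use assms in simp)

text \<open>A relation c + x q'(x) = 0 with nonzero c in K writes the inverse of x as a polynomial
  in x.\<close>

lemma inverse_in_subring:
  assumes "\<And>x y. x \<in> R \<Longrightarrow> y \<in> R \<Longrightarrow> x + y \<in> R" "\<And>x y. x \<in> R \<Longrightarrow> y \<in> R \<Longrightarrow> x * y \<in> R"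
    "K \<subseteq> R" "x \<in> R"
  shows "inverse x \<in> R"
proof (cases "x = 0")
  case False
  then obtain q where q: "q \<in> polys_over K" "Polynomial.coeff q 0 \<noteq> 0" "poly q x = 0"
    using nonzero_const_coeff by blast
  obtain c q' where cq: "q = pCons c q'" by (cases q)
  have c: "c \<noteq> 0" "c \<in> K" "Polynomial.coeff q' i \<in> K" for i
    using q cq polys_overD[OF q(1), of 0] polys_overD[OF q(1), of "Suc i"] by auto
  note Kc = subfield_closed[OF subfield_K]
  have "c + x * poly q' x = 0" using q(3) cq by simp
  then have "x * poly q' x = - c" by (simp add: add_eq_0_iff)
  moreover have "x * (- inverse c * poly q' x) = - inverse c * (x * poly q' x)" by simp
  ultimately have "x * (- inverse c * poly q' x) = 1" using c(1) by simp
  then have "inverse x = - inverse c * poly q' x" by (rule inverse_unique)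
  moreover have "poly q' x \<in> R" using assms Kc(1) c by (intro poly_in_subring) auto
  moreover have "- inverse c \<in> R" using Kc c assms by auto
  ultimately show ?thesis using assms(2) by metis
qed (use assms subfield_closed(1)[OF subfield_K] in auto)

text \<open>Graphs of partial embeddings.  Every ring between \<open>K\<close> and its algebraic closure is a field, so
  compatibility with inverses need not be demanded.\<close>

definition partial_hom :: "('a \<times> 'a) set \<Rightarrow> bool" where
  "partial_hom g \<longleftrightarrow> single_valued g \<and> (\<forall>x\<in>K. (x, x) \<in> g) \<and>
     (\<forall>x y x' y'. (x, y) \<in> g \<and> (x', y') \<in> g \<longrightarrow> (x + x', y + y') \<in> g \<and> (x * x', y * y') \<in> g)"

lemma partial_homD:
  assumes "partial_hom g"
  shows "(x, y) \<in> g \<Longrightarrow> (x, y') \<in> g \<Longrightarrow> y = y'" "x \<in> K \<Longrightarrow> (x, x) \<in> g"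
    "(x, y) \<in> g \<Longrightarrow> (x', y') \<in> g \<Longrightarrow> (x + x', y + y') \<in> g"
    "(x, y) \<in> g \<Longrightarrow> (x', y') \<in> g \<Longrightarrow> (x * x', y * y') \<in> g"
  using assms unfolding partial_hom_def single_valued_def by blast+

lemma Domain_closed:
  assumes "partial_hom g"
  shows "K \<subseteq> Domain g" "x \<in> Domain g \<Longrightarrow> y \<in> Domain g \<Longrightarrow> x + y \<in> Domain g"
    "x \<in> Domain g \<Longrightarrow> y \<in> Domain g \<Longrightarrow> x * y \<in> Domain g"
    "x \<in> Domain g \<Longrightarrow> inverse x \<in> Domain g" "x \<in> Domain g \<Longrightarrow> - x \<in> Domain g"
proof -
  note g = partial_homD[OF assms]
  show 1: "K \<subseteq> Domain g" "\<And>x y. x \<in> Domain g \<Longrightarrow> y \<in> Domain g \<Longrightarrow> x + y \<in> Domain g"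
    "\<And>x y. x \<in> Domain g \<Longrightarrow> y \<in> Domain g \<Longrightarrow> x * y \<in> Domain g"
    using g by blast+
  then show "x \<in> Domain g \<Longrightarrow> inverse x \<in> Domain g" using inverse_in_subring by blast
  have "- 1 \<in> Domain g" using 1(1) subfield_closed[OF subfield_K] by blast
  then show "x \<in> Domain g \<Longrightarrow> - x \<in> Domain g" using 1(3)[of "- 1" x] by simp
qed

text \<open>Quotient and remainder must have coefficients in the set M, which is not a type of its
  own. With a monic divisor the algorithm uses ring operations only.\<close>

lemma poly_division:
  assumes M: "\<And>x y. x \<in> M \<Longrightarrow> y \<in> M \<Longrightarrow> x + y \<in> M" "\<And>x y. x \<in> M \<Longrightarrow> y \<in> M \<Longrightarrow> x * y \<in> M"
    "\<And>x. x \<in> M \<Longrightarrow> - x \<in> M" "0 \<in> M"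
    and m: "m \<in> polys_over M" "Polynomial.lead_coeff m = 1" and q: "q \<in> polys_over M"
  shows "\<exists>d r. d \<in> polys_over M \<and> r \<in> polys_over M \<and> q = d * m + r \<and>
    (r = 0 \<or> Polynomial.degree r < Polynomial.degree m)"
  using q
proof (induction "Polynomial.degree q" arbitrary: q rule: less_induct)
  case less
  show ?case
  proof (cases "Polynomial.degree q < Polynomial.degree m \<or> q = 0")
    case True
    then show ?thesis using less.prems M(4)
      by (intro exI[of _ 0] exI[of _ q]) (auto simp: polys_over_def)
  next
    case False
    define u where "u = Polynomial.monom (Polynomial.lead_coeff q) (Polynomial.degree q - Polynomial.degree m)"
    have u: "u \<in> polys_over M"
      using polys_overD[OF less.prems] M(4) by (simp add: u_def polys_over_def)
    have Msum: "(\<Sum>i\<in>I. f i) \<in> M" if "\<And>i. i \<in> I \<Longrightarrow> f i \<in> M" for I :: "nat set" and f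
      using that by (induction I rule: infinite_finite_induct) (auto simp: M)
    have um: "u * m \<in> polys_over M"
      using u m(1) by (auto simp: polys_over_def Polynomial.coeff_mult intro!: Msum M)
    define q' where "q' = q - u * m"
    have q'M: "q' \<in> polys_over M"
    proof -
      have "Polynomial.coeff q i + - Polynomial.coeff (u * m) i \<in> M" for i
        using polys_overD[OF less.prems] polys_overD[OF um] M by blast
      then show ?thesis by (simp add: q'_def polys_over_def)
    qed
    have lq: "Polynomial.lead_coeff q \<noteq> 0" using False by simp
    have m0: "m \<noteq> 0" using m(2) by auto
    have du: "Polynomial.degree (u * m) = Polynomial.degree q"
      using False lq m0 by (subst degree_mult_eq) (auto simp: u_def degree_monom_eq monom_eq_0_iff)
    have lu: "Polynomial.lead_coeff (u * m) = Polynomial.lead_coeff q"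
      unfolding Polynomial.lead_coeff_mult m(2) using lq by (simp add: u_def degree_monom_eq)
    have c0: "Polynomial.coeff q' (Polynomial.degree q) = 0"
      using lu du by (simp add: q'_def)
    have dq: "Polynomial.degree q' \<le> Polynomial.degree q"
      unfolding q'_def using du by (intro degree_diff_le) auto
    show ?thesis
    proof (cases "Polynomial.degree q = 0")
      case True
      then have "q' = 0" using dq c0 by (metis le_zero_eq leading_coeff_0_iff)
      then show ?thesis using u M(4)
        by (intro exI[of _ u] exI[of _ 0]) (auto simp: q'_def polys_over_def)
    next
      case False
      then have "Polynomial.degree q' < Polynomial.degree q"
        using degree_less_if_coeff_eq_0[OF dq c0] by simp
      from less.hyps[OF this q'M] obtain d r where
        dr: "d \<in> polys_over M" "r \<in> polys_over M" "q' = d * m + r"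
        "r = 0 \<or> Polynomial.degree r < Polynomial.degree m" by blast
      have "d + u \<in> polys_over M" using dr(1) u M(1) by (simp add: polys_over_def)
      moreover have "q = (d + u) * m + r" using dr(3) by (simp add: q'_def algebra_simps)
      ultimately show ?thesis using dr by blast
    qed
  qed
qed

definition min_poly_over :: "'a set \<Rightarrow> 'a \<Rightarrow> 'a poly \<Rightarrow> bool" where
  "min_poly_over M z m \<longleftrightarrow> m \<in> polys_over M \<and> Polynomial.lead_coeff m = 1 \<and> poly m z = 0 \<and>
     (\<forall>q\<in>polys_over M. q \<noteq> 0 \<and> poly q z = 0 \<longrightarrow> Polynomial.degree m \<le> Polynomial.degree q)"

lemma min_poly_exists:
  assumes "K \<subseteq> M" "\<And>x y. x \<in> M \<Longrightarrow> y \<in> M \<Longrightarrow> x * y \<in> M" "\<And>x. x \<in> M \<Longrightarrow> inverse x \<in> M"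
  obtains m where "min_poly_over M z m"
proof -
  obtain q0 where "q0 \<in> polys_over K" "q0 \<noteq> 0" "poly q0 z = 0"
    using algebraic_closure_algebraic[OF closure] by blast
  then have "q0 \<in> polys_over M \<and> q0 \<noteq> 0 \<and> poly q0 z = 0" using assms(1) by (auto simp: polys_over_def)
  from ex_has_least_nat[of "\<lambda>q. q \<in> polys_over M \<and> q \<noteq> 0 \<and> poly q z = 0", OF this, of Polynomial.degree]
  obtain q where q: "q \<in> polys_over M" "q \<noteq> 0" "poly q z = 0"
    and least: "\<And>q'. q' \<in> polys_over M \<Longrightarrow> q' \<noteq> 0 \<Longrightarrow> poly q' z = 0 \<Longrightarrow> Polynomial.degree q \<le> Polynomial.degree q'"
    by blast
  define m where "m = smult (inverse (Polynomial.lead_coeff q)) q"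
  have "Polynomial.degree m = Polynomial.degree q" using q(2) by (simp add: m_def)
  moreover have "m \<in> polys_over M" using q(1) assms(2,3) by (simp add: m_def polys_over_def)
  ultimately have "min_poly_over M z m"
    using q least by (simp add: min_poly_over_def m_def)
  then show ?thesis by (rule that)
qed

text \<open>The new graph pairs q(z) with the value at w of the \<sigma>-image of q. It is single
  valued: if q(z) = 0, minimality of m makes the remainder of q modulo m zero, so the image of q
  vanishes at w.\<close>

lemma partial_hom_extend:
  assumes g: "partial_hom g" and m: "min_poly_over (Domain g) z m"
    and \<sigma>: "\<And>x. x \<in> Domain g \<Longrightarrow> (x, \<sigma> x) \<in> g" and w: "poly (map_poly \<sigma> m) w = 0"
  obtains g' where "partial_hom g'" "g \<subseteq> g'" "(z, w) \<in> g'"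
proof -
  let ?M = "Domain g"
  note Mc = Domain_closed[OF g]
  note gD = partial_homD[OF g]
  have \<sigma>I: "\<sigma> x = y" if "(x, y) \<in> g" for x y
  proof -
    have "x \<in> ?M" using that by blast
    then show ?thesis using gD(1)[OF \<sigma> that] by simp
  qed
  have K01: "0 \<in> K" "1 \<in> K" "- 1 \<in> K" using subfield_closed[OF subfield_K] by blast+
  have M0: "0 \<in> ?M" using Mc(1) K01 by blast
  have \<sigma>0 [simp]: "\<sigma> 0 = 0" and \<sigma>1: "\<sigma> 1 = 1" using \<sigma>I gD(2) K01 by blast+
  have \<sigma>add: "\<sigma> (x + y) = \<sigma> x + \<sigma> y" and \<sigma>mult: "\<sigma> (x * y) = \<sigma> x * \<sigma> y" if "x \<in> ?M" "y \<in> ?M" for x y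
    using \<sigma>I[OF gD(3)[OF \<sigma> \<sigma>]] \<sigma>I[OF gD(4)[OF \<sigma> \<sigma>]] that by blast+
  have sumM: "(\<Sum>i\<in>I. f i) \<in> ?M \<and> \<sigma> (\<Sum>i\<in>I. f i) = (\<Sum>i\<in>I. \<sigma> (f i))"
    if "\<And>i. i \<in> I \<Longrightarrow> f i \<in> ?M" for I :: "nat set" and f
    using that by (induction I rule: infinite_finite_induct) (auto simp: M0 Mc \<sigma>add)
  let ?s = "map_poly \<sigma>"
  have cs: "Polynomial.coeff (?s q) i = \<sigma> (Polynomial.coeff q i)" for q i
    by (simp add: coeff_map_poly)
  have s_add: "?s (q + q') = ?s q + ?s q'" and s_mult: "?s (q * q') = ?s q * ?s q'"
    and add_in: "q + q' \<in> polys_over ?M" and mult_in: "q * q' \<in> polys_over ?M"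
    if "q \<in> polys_over ?M" "q' \<in> polys_over ?M" for q q'
  proof -
    show "?s (q + q') = ?s q + ?s q'"
      by (rule poly_eqI) (simp add: cs \<sigma>add polys_overD[OF that(1)] polys_overD[OF that(2)])
    have *: "Polynomial.coeff q j * Polynomial.coeff q' k \<in> ?M" for j k
      using polys_overD[OF that(1)] polys_overD[OF that(2)] Mc(3) by blast
    show "?s (q * q') = ?s q * ?s q'"
    proof (rule poly_eqI)
      fix n
      have "Polynomial.coeff (?s (q * q')) n = \<sigma> (\<Sum>i\<le>n. Polynomial.coeff q i * Polynomial.coeff q' (n - i))"
        by (simp add: cs Polynomial.coeff_mult)
      also have "\<dots> = (\<Sum>i\<le>n. \<sigma> (Polynomial.coeff q i * Polynomial.coeff q' (n - i)))"
        using sumM[of "{..n}" "\<lambda>i. Polynomial.coeff q i * Polynomial.coeff q' (n - i)"] * by blast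
      also have "\<dots> = Polynomial.coeff (?s q * ?s q') n"
        by (simp add: cs Polynomial.coeff_mult \<sigma>mult polys_overD[OF that(1)] polys_overD[OF that(2)])
      finally show "Polynomial.coeff (?s (q * q')) n = Polynomial.coeff (?s q * ?s q') n" .
    qed
    show "q + q' \<in> polys_over ?M" using that Mc(2) by (simp add: polys_over_def)
    show "q * q' \<in> polys_over ?M"
      unfolding polys_over_def using sumM * by (auto simp: Polynomial.coeff_mult)
  qed
  define g' where "g' = {(poly q z, poly (?s q) w) | q. q \<in> polys_over ?M}"
  have key: "poly (?s q) w = 0" if q: "q \<in> polys_over ?M" "poly q z = 0" for q
  proof -
    obtain d r where dr: "d \<in> polys_over ?M" "r \<in> polys_over ?M" "q = d * m + r"
      "r = 0 \<or> Polynomial.degree r < Polynomial.degree m"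
      using poly_division[of ?M m q] Mc M0 m q(1) unfolding min_poly_over_def by blast
    have mM: "m \<in> polys_over ?M" using m by (simp add: min_poly_over_def)
    have "poly r z = 0" using q(2) dr(3) m by (simp add: min_poly_over_def)
    then have "r = 0" using dr m unfolding min_poly_over_def by (meson not_less)
    then have "?s q = ?s d * ?s m" using dr s_mult mM by simp
    then show ?thesis using w by simp
  qed
  have const: "[:c:] \<in> polys_over ?M" if "c \<in> ?M" for c
    using that M0 by (auto simp: polys_over_def coeff_pCons split: nat.split)
  have s_const: "?s [:c:] = [:\<sigma> c:]" for c by (simp add: map_poly_pCons)
  have incl: "g \<subseteq> g'"
  proof
    fix e assume e: "e \<in> g"
    obtain x y where "e = (x, y)" by (cases e)
    with e have "x \<in> ?M" "\<sigma> x = y" using \<sigma>I by blast+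
    then show "e \<in> g'" using \<open>e = (x, y)\<close> const s_const
      unfolding g'_def by (auto intro!: exI[of _ "[:x:]"])
  qed
  have "single_valued g'"
  proof (rule single_valuedI)
    fix x y y' assume "(x, y) \<in> g'" "(x, y') \<in> g'"
    then obtain q q' where q: "q \<in> polys_over ?M" "x = poly q z" "y = poly (?s q) w"
      "q' \<in> polys_over ?M" "x = poly q' z" "y' = poly (?s q') w"
      by (auto simp: g'_def)
    have m1: "[:- 1:] \<in> polys_over ?M" using const Mc(1) K01 by blast
    define u where "u = q + [:- 1:] * q'"
    have "u \<in> polys_over ?M" unfolding u_def using q m1 add_in mult_in by blast
    moreover have "poly u z = 0" using q by (simp add: u_def)
    ultimately have "poly (?s u) w = 0" by (rule key)
    moreover have "\<sigma> (- 1) = - 1" using \<sigma>I gD(2) K01 by blast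
    then have "?s u = ?s q + [:- 1:] * ?s q'"
      unfolding u_def using q m1 s_add s_mult mult_in s_const by metis
    ultimately show "y = y'" using q by simp
  qed
  moreover have "\<forall>x\<in>K. (x, x) \<in> g'" using gD(2) incl by blast
  moreover have "(x + x', y + y') \<in> g' \<and> (x * x', y * y') \<in> g'" if "(x, y) \<in> g'" "(x', y') \<in> g'" for x y x' y'
  proof -
    obtain q q' where q: "q \<in> polys_over ?M" "x = poly q z" "y = poly (?s q) w"
      "q' \<in> polys_over ?M" "x' = poly q' z" "y' = poly (?s q') w"
      using \<open>(x, y) \<in> g'\<close> \<open>(x', y') \<in> g'\<close> by (auto simp: g'_def)
    have "x + x' = poly (q + q') z \<and> y + y' = poly (?s (q + q')) w \<and> q + q' \<in> polys_over ?M"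
      "x * x' = poly (q * q') z \<and> y * y' = poly (?s (q * q')) w \<and> q * q' \<in> polys_over ?M"
      using q s_add s_mult add_in mult_in by simp_all
    then show ?thesis unfolding g'_def by blast
  qed
  ultimately have "partial_hom g'" unfolding partial_hom_def by blast
  moreover have "(z, w) \<in> g'"
  proof -
    have "[:0, 1:] \<in> polys_over ?M"
      using M0 Mc(1) K01 by (auto simp: polys_over_def coeff_pCons split: nat.split)
    moreover have "?s [:0, 1:] = [:0, 1:]" by (simp add: map_poly_pCons \<sigma>1)
    ultimately show ?thesis unfolding g'_def by (auto intro!: exI[of _ "[:0, 1:]"])
  qed
  ultimately show ?thesis using incl that by blast
qed

text \<open>A maximal extension is total, since the transported minimal polynomial of a missing
  element would have a root. It is onto because it permutes the finitely many roots of each nonzero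
  polynomial over K.\<close>

lemma partial_hom_total:
  assumes "partial_hom g0"
  obtains \<sigma> where "field_endo \<sigma>" "bij \<sigma>" "\<And>x y. (x, y) \<in> g0 \<Longrightarrow> \<sigma> x = y"
proof -
  define S where "S = {g. partial_hom g \<and> g0 \<subseteq> g}"
  have "\<exists>g\<in>S. \<forall>g'\<in>S. g \<subseteq> g' \<longrightarrow> g' = g"
  proof (rule subset_Zorn_nonempty)
    show "S \<noteq> {}" using assms by (auto simp: S_def)
    fix \<C> assume ne: "\<C> \<noteq> {}" and ch: "subset.chain S \<C>"
    have sub: "\<And>g. g \<in> \<C> \<Longrightarrow> partial_hom g" "\<And>g. g \<in> \<C> \<Longrightarrow> g0 \<subseteq> g"
      using ch by (auto simp: subset.chain_def S_def)
    have two: "\<exists>g\<in>\<C>. e \<in> g \<and> e' \<in> g" if "e \<in> \<Union>\<C>" "e' \<in> \<Union>\<C>" for e e'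
      using that ch unfolding subset_chain_def by blast
    have "partial_hom (\<Union>\<C>)"
      unfolding partial_hom_def
    proof (intro conjI ballI allI impI)
      show "single_valued (\<Union>\<C>)"
        using two partial_homD(1)[OF sub(1)] unfolding single_valued_def by meson
      show "(x, x) \<in> \<Union>\<C>" if "x \<in> K" for x
        using ne partial_homD(2)[OF sub(1)] that by blast
    next
      fix x y x' y' assume "(x, y) \<in> \<Union>\<C> \<and> (x', y') \<in> \<Union>\<C>"
      then obtain g where "g \<in> \<C>" "(x, y) \<in> g" "(x', y') \<in> g" using two by blast
      then show "(x + x', y + y') \<in> \<Union>\<C>" "(x * x', y * y') \<in> \<Union>\<C>"
        using partial_homD(3,4)[OF sub(1)] by blast+
    qed
    then show "\<Union>\<C> \<in> S" using ne sub(2) unfolding S_def by blast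
  qed
  then obtain g where gS: "g \<in> S" and mx: "\<forall>g'\<in>S. g \<subseteq> g' \<longrightarrow> g' = g" by blast
  have g: "partial_hom g" "g0 \<subseteq> g" using gS by (simp_all add: S_def)
  have max: "g' = g" if "partial_hom g'" "g \<subseteq> g'" for g'
  proof -
    have "g' \<in> S" using that g(2) by (auto simp: S_def)
    then show ?thesis using mx that(2) by blast
  qed
  define \<sigma> where "\<sigma> x = (SOME y. (x, y) \<in> g)" for x
  have \<sigma>: "(x, \<sigma> x) \<in> g" if "x \<in> Domain g" for x
    using that unfolding \<sigma>_def by (metis DomainE someI)
  have dom: "z \<in> Domain g" for z
  proof -
    obtain m where m: "min_poly_over (Domain g) z m"
      using min_poly_exists Domain_closed[OF g(1)] by metis
    have "Polynomial.degree m > 0"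
    proof (rule ccontr)
      assume "\<not> ?thesis"
      then obtain c where "m = [:c:]" using degree_eq_zeroE by blast
      then show False using m by (auto simp: min_poly_over_def)
    qed
    moreover have "\<sigma> x = x" if "x \<in> K" for x
      using partial_homD(1)[OF g(1) \<sigma> partial_homD(2)[OF g(1) that]] that Domain_closed(1)[OF g(1)] by blast
    then have "\<sigma> 1 = 1" "\<sigma> 0 = 0" using subfield_closed(1,2)[OF subfield_K] by blast+
    \<comment> \<open>The leading coefficient 1 is kept, so the transported polynomial stays
      nonconstant.\<close>
    then have "Polynomial.coeff (map_poly \<sigma> m) (Polynomial.degree m) = 1"
      using m by (simp add: min_poly_over_def coeff_map_poly)
    then have "Polynomial.degree m \<le> Polynomial.degree (map_poly \<sigma> m)" by (intro Polynomial.le_degree) simp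
    ultimately have "Polynomial.degree (map_poly \<sigma> m) > 0" by simp
    then obtain w where "poly (map_poly \<sigma> m) w = 0"
      using algebraic_closure_root[OF closure] by blast
    from partial_hom_extend[OF g(1) m \<sigma> this] obtain g' where "partial_hom g'" "g \<subseteq> g'" "(z, w) \<in> g'"
      by blast
    then show ?thesis using max by blast
  qed
  note gD = partial_homD[OF g(1)]
  have \<sigma>g: "(x, \<sigma> x) \<in> g" for x using \<sigma> dom by blast
  have \<sigma>I: "\<sigma> x = y" if "(x, y) \<in> g" for x y using gD(1)[OF \<sigma>g that] .
  have fixK: "\<sigma> x = x" if "x \<in> K" for x using \<sigma>I gD(2) that by blast
  have endo: "field_endo \<sigma>"
  proof
    fix x y
    show "\<sigma> (x + y) = \<sigma> x + \<sigma> y" using \<sigma>I[OF gD(3)[OF \<sigma>g \<sigma>g]] .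
    show "\<sigma> (x * y) = \<sigma> x * \<sigma> y" using \<sigma>I[OF gD(4)[OF \<sigma>g \<sigma>g]] .
    show "\<sigma> 1 = 1" using fixK subfield_closed(2)[OF subfield_K] by blast
  qed
  interpret field_endo \<sigma> by fact
  have "\<exists>x. y = \<sigma> x" for y
  proof -
    obtain q where q: "q \<in> polys_over K" "q \<noteq> 0" "poly q y = 0"
      using algebraic_closure_algebraic[OF closure] by blast
    let ?Z = "{x. poly q x = 0}"
    have pq: "\<sigma> (poly q x) = poly q (\<sigma> x)" for x
      using polys_overD[OF q(1)]
      by (simp add: poly_altdef hom_sum hom_mult hom_power fixK)
    have "\<sigma> ` ?Z = ?Z"
    proof (rule endo_inj_surj)
      show "finite ?Z" using q(2) by (rule poly_roots_finite)
      show "\<sigma> ` ?Z \<subseteq> ?Z" by (auto simp flip: pq)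
      show "inj_on \<sigma> ?Z" by (simp add: inj_on_def)
    qed
    then show "\<exists>x. y = \<sigma> x" using q(3) by blast
  qed
  then have "bij \<sigma>" by (simp add: bij_def inj_def surj_def)
  with endo show ?thesis using that \<sigma>I g(2) by blast
qed

text \<open>Stands in for the Galois correspondence: its contrapositive puts an element into F once
  every automorphism over F fixes it. In characteristic 0 the minimal polynomial of z has a second
  root w, and z can be sent to w.\<close>

lemma automorphism_moving:
  assumes F: "subfield F ambient" "K \<subseteq> F" and z: "z \<notin> F"
  obtains \<sigma> where "field_endo \<sigma>" "bij \<sigma>" "\<And>x. x \<in> F \<Longrightarrow> \<sigma> x = x" "\<sigma> z \<noteq> z"
proof -
  note Fc = subfield_closed[OF F(1)]
  define g where "g = Id_on F"
  have g: "partial_hom g"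
    unfolding partial_hom_def g_def using Fc F(2) by (auto simp: single_valued_def)
  have dom: "Domain g = F" by (auto simp: g_def)
  obtain m where m: "min_poly_over F z m" using min_poly_exists[OF F(2)] Fc by metis
  then have m0: "m \<noteq> 0" "m \<in> polys_over F" "poly m z = 0" by (auto simp: min_poly_over_def)
  obtain m1 where m1: "m = [:- z, 1:] * m1" using m0(3) by (meson dvdE poly_eq_0_iff_dvd)
  have "m1 \<noteq> 0" using m0 m1 by auto
  then have dm: "Polynomial.degree m = Polynomial.degree m1 + 1"
    unfolding m1 by (subst degree_mult_eq) auto
  have "Polynomial.degree m1 > 0"
  proof (rule ccontr)
    assume "\<not> ?thesis"
    then obtain c where c: "m1 = [:c:]" using degree_eq_zeroE by blast
    have "Polynomial.lead_coeff m = 1" using m by (simp add: min_poly_over_def)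
    then have "c = 1" unfolding m1 c by (auto split: if_splits)
    then have "Polynomial.coeff m 0 = - z" by (simp add: m1 c)
    then have "- z \<in> F" using polys_overD[OF m0(2)] by metis
    then have "z \<in> F" using Fc(5)[of "- z"] by simp
    with z show False by simp
  qed
  then obtain w where w: "poly m1 w = 0" using algebraic_closure_root[OF closure] by blast
  have "w \<noteq> z"
  proof
    assume "w = z"
    \<comment> \<open>A double root z would also be a root of the derivative, a nonzero polynomial
      over F of smaller degree.\<close>
    have "pderiv m = m1 + [:- z, 1:] * pderiv m1"
      unfolding m1 pderiv_mult by (simp add: pderiv_pCons)
    then have "poly (pderiv m) z = 0" using w \<open>w = z\<close> by simp
    moreover have "pderiv m \<in> polys_over F"
      using polys_overD[OF m0(2)] Fc(4,9) by (simp add: polys_over_def coeff_pderiv del: of_nat_Suc)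
    moreover have "pderiv m \<noteq> 0" using dm by (simp add: pderiv_eq_0_iff)
    ultimately have "Polynomial.degree m \<le> Polynomial.degree (pderiv m)"
      using m by (simp add: min_poly_over_def)
    then show False using dm by (simp add: degree_pderiv)
  qed
  have "poly (map_poly (\<lambda>x. x) m) w = 0" using w by (simp add: map_poly_idI m1)
  from partial_hom_extend[OF g _ _ this, of z] m dom
  obtain g' where g': "partial_hom g'" "g \<subseteq> g'" "(z, w) \<in> g'"
    unfolding g_def by (metis Domain_Id_on Id_onI)
  from partial_hom_total[OF g'(1)] obtain \<sigma> where \<sigma>: "field_endo \<sigma>" "bij \<sigma>" "\<And>x y. (x, y) \<in> g' \<Longrightarrow> \<sigma> x = y"
    by blast
  have "\<sigma> x = x" if "x \<in> F" for x using that g'(2) \<sigma>(3) by (auto simp: g_def)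
  moreover have "\<sigma> z \<noteq> z" using \<sigma>(3)[OF g'(3)] \<open>w \<noteq> z\<close> by simp
  ultimately show ?thesis using \<sigma> that by blast
qed

end

section \<open>Reduction to a short Weierstrass equation\<close>

text \<open>Complete the square in \<open>y\<close> and the cube in \<open>x\<close>.\<close>

definition short_c :: "'a :: field_char_0 weierstrass \<Rightarrow> 'a" where
  "short_c E = (a1 E ^ 2 + 4 * a2 E) / 12"

definition short_a :: "'a :: field_char_0 weierstrass \<Rightarrow> 'a" where
  "short_a E = (2 * a4 E + a1 E * a3 E) / 2 - 3 * short_c E ^ 2"

definition short_b :: "'a :: field_char_0 weierstrass \<Rightarrow> 'a" where
  "short_b E = (a3 E ^ 2 + 4 * a6 E) / 4 - short_a E * short_c E - short_c E ^ 3"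

fun to_short :: "'a :: field_char_0 weierstrass \<Rightarrow> 'a point \<Rightarrow> 'a point" where
  "to_short E Infinity = Infinity"
| "to_short E (Affine x y) = Affine (x + short_c E) (y + (a1 E * x + a3 E) / 2)"

lemma numeral_mult_cancel: "numeral k * x = numeral k * (y :: 'a :: field_char_0) \<Longrightarrow> x = y"
  by simp

text \<open>The left sides are the usual b2, b4 and b6. The relations avoid division so that they
  can feed Groebner basis steps.\<close>

lemma short_rels:
  shows "a1 E ^ 2 + 4 * a2 E = 12 * short_c E"
    "2 * a4 E + a1 E * a3 E = 2 * short_a E + 6 * short_c E ^ 2"
    "a3 E ^ 2 + 4 * a6 E = 4 * short_b E + 4 * short_a E * short_c E + 4 * short_c E ^ 3"
proof -
  show "a1 E ^ 2 + 4 * a2 E = 12 * short_c E" by (simp add: short_c_def)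
  show "2 * a4 E + a1 E * a3 E = 2 * short_a E + 6 * short_c E ^ 2" by (simp add: short_a_def)
  show "a3 E ^ 2 + 4 * a6 E = 4 * short_b E + 4 * short_a E * short_c E + 4 * short_c E ^ 3"
    by (simp add: short_b_def)
qed

lemma discriminant_short:
  fixes E :: "'a :: field_char_0 weierstrass"
  shows "discriminant E = - 16 * (4 * short_a E ^ 3 + 27 * short_b E ^ 2)"
proof -
  define b2 where "b2 = a1 E ^ 2 + 4 * a2 E"
  define b4 where "b4 = 2 * a4 E + a1 E * a3 E"
  define b6 where "b6 = a3 E ^ 2 + 4 * a6 E"
  define b8 where "b8 = a1 E ^ 2 * a6 E + 4 * a2 E * a6 E - a1 E * a3 E * a4 E + a2 E * a3 E ^ 2 - a4 E ^ 2"
  \<comment> \<open>The classical relation eliminating b8; the factor 4 is cancelled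
    afterwards.\<close>
  have 8: "4 * b8 = b2 * b6 - b4 ^ 2" unfolding b2_def b4_def b6_def b8_def by Groebner_Basis.algebra
  note r = short_rels[of E, folded b2_def b4_def b6_def]
  have "4 * b8 = 4 * (3 * short_c E * b6 - (short_a E + 3 * short_c E ^ 2) ^ 2)"
    using 8 r by Groebner_Basis.algebra
  then have "b8 = 3 * short_c E * b6 - (short_a E + 3 * short_c E ^ 2) ^ 2"
    by (rule numeral_mult_cancel)
  moreover have "discriminant E = - (b2 ^ 2 * b8) - 8 * b4 ^ 3 - 27 * b6 ^ 2 + 9 * b2 * b4 * b6"
    by (simp add: discriminant_def Let_def b2_def b4_def b6_def b8_def)
  ultimately show ?thesis using r by Groebner_Basis.algebra
qed

lemma to_short_inj: "to_short E U = to_short E V \<longleftrightarrow> U = V"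
  by (cases U; cases V) auto

lemma to_short_eq_Infinity [simp]: "to_short E U = Infinity \<longleftrightarrow> U = Infinity"
  by (cases U) auto

lemma map_point_to_short:
  assumes "field_endo \<sigma>" "\<And>x. x \<in> set_weierstrass E \<Longrightarrow> \<sigma> x = x"
  shows "\<sigma> (short_c E) = short_c E" "\<sigma> (short_a E) = short_a E" "\<sigma> (short_b E) = short_b E"
    "map_point \<sigma> (to_short E U) = to_short E (map_point \<sigma> U)"
proof -
  interpret field_endo \<sigma> by fact
  have c: "\<sigma> (a1 E) = a1 E" "\<sigma> (a2 E) = a2 E" "\<sigma> (a3 E) = a3 E" "\<sigma> (a4 E) = a4 E" "\<sigma> (a6 E) = a6 E"
    using assms(2) by (cases E; auto)+
  show 1: "\<sigma> (short_c E) = short_c E" by (simp add: short_c_def hom_simps c)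
  show 2: "\<sigma> (short_a E) = short_a E" by (simp add: short_a_def hom_simps c 1)
  show "\<sigma> (short_b E) = short_b E" by (simp add: short_b_def hom_simps c 1 2)
  show "map_point \<sigma> (to_short E U) = to_short E (map_point \<sigma> U)"
    by (cases U) (simp_all add: hom_simps c 1)
qed

context short_curve
begin

context
  fixes E :: "'a weierstrass"
  assumes E: "a = short_a E" "b = short_b E"
begin

lemma to_short_in_pts: "to_short E U \<in> pts \<longleftrightarrow> U \<in> points E"
proof (cases U)
  case (Affine x y)
  define Y where "Y = y + (a1 E * x + a3 E) / 2"
  have Y: "2 * Y = 2 * y + a1 E * x + a3 E" by (simp add: Y_def field_simps)
  note r = short_rels[of E]
  have "4 * (Y ^ 2 - ((x + short_c E) ^ 3 + short_a E * (x + short_c E) + short_b E))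
      = 4 * (y ^ 2 + a1 E * x * y + a3 E * y - (x ^ 3 + a2 E * x ^ 2 + a4 E * x + a6 E))"
    using r Y by Groebner_Basis.algebra
  from numeral_mult_cancel[OF this, folded E]
  have "Y ^ 2 = (x + short_c E) ^ 3 + a * (x + short_c E) + b \<longleftrightarrow>
      y ^ 2 + a1 E * x * y + a3 E * y = x ^ 3 + a2 E * x ^ 2 + a4 E * x + a6 E"
    by (metis right_minus_eq)
  moreover have "U \<in> points E \<longleftrightarrow>
      y ^ 2 + a1 E * x * y + a3 E * y = x ^ 3 + a2 E * x ^ 2 + a4 E * x + a6 E"
    by (simp add: Affine points_def)
  ultimately show ?thesis
    by (simp only: Affine to_short.simps Affine_in_pts Y_def)
qed (simp add: points_def)

lemma to_short_add:
  assumes "U \<in> points E" "V \<in> points E"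
  shows "to_short E (point_add E U V) = to_short E U \<oplus>\<oplus> to_short E V"
proof (cases "U = Infinity \<or> V = Infinity")
  case False
  then obtain x1 y1 x2 y2 where [simp]: "U = Affine x1 y1" "V = Affine x2 y2"
    by (cases U; cases V) auto
  define X1 Y1 X2 Y2 where d: "X1 = x1 + short_c E" "Y1 = y1 + (a1 E * x1 + a3 E) / 2"
    "X2 = x2 + short_c E" "Y2 = y2 + (a1 E * x2 + a3 E) / 2"
  have Y: "2 * Y1 = 2 * y1 + a1 E * x1 + a3 E" "2 * Y2 = 2 * y2 + a1 E * x2 + a3 E"
    by (simp_all add: d field_simps)
  have on: "Affine X1 Y1 \<in> pts" "Affine X2 Y2 \<in> pts"
    using assms to_short_in_pts[of U] to_short_in_pts[of V] by (simp_all add: d)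
  have sh: "to_short E U = Affine X1 Y1" "to_short E V = Affine X2 Y2" by (simp_all add: d)
  have X12: "X1 = X2 \<longleftrightarrow> x1 = x2" by (simp add: d)
  have eqO: "X1 = X2 \<and> Y2 = - Y1 \<longleftrightarrow> x1 = x2 \<and> y1 + y2 + a1 E * x2 + a3 E = 0"
  proof -
    have "2 * (Y2 + Y1) = 2 * (y1 + y2 + a1 E * x2 + a3 E)" if "x1 = x2"
      using Y that by Groebner_Basis.algebra
    then have "Y2 + Y1 = y1 + y2 + a1 E * x2 + a3 E" if "x1 = x2"
      using that numeral_mult_cancel by blast
    then show ?thesis using X12 by (auto simp: eq_neg_iff_add_eq_0)
  qed
  show ?thesis
  proof (cases "X1 = X2 \<and> Y2 = - Y1")
    case True
    have "Affine X1 Y1 \<oplus>\<oplus> Affine X2 Y2 = Infinity" unfolding add_eq_Infinity using True by simp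
    moreover have "point_add E U V = Infinity" using True eqO by simp
    ultimately show ?thesis by (simp only: sh to_short.simps)
  next
    case False
    define l where "l = (if x1 = x2
                 then (3 * x1 ^ 2 + 2 * a2 E * x1 + a4 E - a1 E * y1) / (2 * y1 + a1 E * x1 + a3 E)
                 else (y2 - y1) / (x2 - x1))"
    define x3 where "x3 = l ^ 2 + a1 E * l - a2 E - x1 - x2"
    define y3 where "y3 = - (l + a1 E) * x3 - (y1 - l * x1) - a3 E"
    have lhs: "point_add E U V = Affine x3 y3"
      using False eqO by (simp add: l_def[symmetric] x3_def[symmetric] Let_def y3_def)
    define L where "L = slope (Affine X1 Y1) (Affine X2 Y2)"
    \<comment> \<open>Replacing y by y + (a1 x + a3) / 2 adds a1 / 2 to every slope, of chords and
      tangents alike.\<close>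
    have 2: "2 * L = 2 * l + a1 E"
    proof (cases "x1 = x2")
      case True
      have "Y1 \<noteq> 0"
      proof
        assume "Y1 = 0"
        have "Y1 ^ 2 = Y2 ^ 2" using on True X12 by (simp add: Affine_in_pts)
        then have "Y2 = - Y1" using \<open>Y1 = 0\<close> by simp
        then show False using False True X12 by simp
      qed
      then have h1: "L * (2 * Y1) = 3 * X1 ^ 2 + a" using True X12 by (simp add: L_def)
      have h2: "l * (2 * Y1) = 3 * x1 ^ 2 + 2 * a2 E * x1 + a4 E - a1 E * y1"
      proof -
        have "l = (3 * x1 ^ 2 + 2 * a2 E * x1 + a4 E - a1 E * y1) / (2 * Y1)"
          unfolding Y(1) l_def using True by simp
        then show ?thesis using \<open>Y1 \<noteq> 0\<close> by simp
      qed
      have "2 * Y1 * (2 * L) = 2 * Y1 * (2 * l + a1 E)"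
        using h1 h2 Y(1) short_rels(1,2)[of E] d(1) E(1) by Groebner_Basis.algebra
      then show ?thesis using \<open>Y1 \<noteq> 0\<close> by (simp only: mult_cancel_left) simp
    next
      case False
      have h1: "L * (X2 - X1) = Y2 - Y1" using False X12 by (simp add: L_def)
      have h2: "l * (x2 - x1) = y2 - y1" using False by (simp add: l_def)
      have "(x2 - x1) * (2 * L) = (x2 - x1) * (2 * l + a1 E)"
        using h1 h2 Y d(1,3) by Groebner_Basis.algebra
      then show ?thesis using False by (simp only: mult_cancel_left) simp
    qed
    have e1: "L ^ 2 - X1 - X2 = x3 + short_c E"
    proof -
      have "4 * (L ^ 2 - X1 - X2) = 4 * (x3 + short_c E)"
        using 2 x3_def d(1,3) short_rels(1)[of E] by Groebner_Basis.algebra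
      then show ?thesis by (rule numeral_mult_cancel)
    qed
    have e2: "L * (X1 - (x3 + short_c E)) - Y1 = y3 + (a1 E * x3 + a3 E) / 2"
    proof -
      have "2 * (L * (X1 - (x3 + short_c E)) - Y1) = 2 * y3 + (a1 E * x3 + a3 E)"
        using 2 Y(1) y3_def d(1) by Groebner_Basis.algebra
      then have "2 * (L * (X1 - (x3 + short_c E)) - Y1) = 2 * (y3 + (a1 E * x3 + a3 E) / 2)"
        by (simp add: distrib_left)
      then show ?thesis by (rule numeral_mult_cancel)
    qed
    have "to_short E U \<oplus>\<oplus> to_short E V = Affine X1 Y1 \<oplus>\<oplus> Affine X2 Y2" by (simp only: sh)
    also have "\<dots> = Affine (x3 + short_c E) (y3 + (a1 E * x3 + a3 E) / 2)"
      unfolding add_Affine[OF False] Let_def L_def[symmetric] e1 e2 ..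
    finally show ?thesis by (simp only: lhs to_short.simps)
  qed
qed (cases U; cases V; auto)

lemma point_mult_Suc: "point_mult E' (Suc n) U = point_add E' U (point_mult E' n U)"
  by (simp add: point_mult_def)

lemma to_short_mult:
  assumes "U \<in> points E"
  shows "point_mult E n U \<in> points E \<and> to_short E (point_mult E n U) = point_mult curve n (to_short E U)"
proof (induction n)
  case 0
  then show ?case by (simp add: point_mult_def points_def)
next
  case (Suc n)
  then have "to_short E (point_add E U (point_mult E n U)) = to_short E U \<oplus>\<oplus> point_mult curve n (to_short E U)"
    using to_short_add assms by simp
  moreover have "to_short E U \<in> pts" "point_mult curve n (to_short E U) \<in> pts"
    using Suc assms to_short_in_pts by metis+
  then have "to_short E U \<oplus>\<oplus> point_mult curve n (to_short E U) \<in> pts" by simp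
  ultimately show ?case unfolding point_mult_Suc using to_short_in_pts by metis
qed

end

lemma collinear_sum:
  assumes "Affine u1 v1 \<in> pts" "Affine u2 v2 \<in> pts" "Affine u3 v3 \<in> pts"
    "u1 \<noteq> u2" "u1 \<noteq> u3" "u2 \<noteq> u3"
    "v1 = l * u1 + v" "v2 = l * u2 + v" "v3 = l * u3 + v"
  shows "Affine u1 v1 \<oplus>\<oplus> Affine u2 v2 = neg (Affine u3 v3)"
proof -
  obtain l' v' x3 y3 where c: "coll l' v' u1 v1 u2 v2 x3 y3"
    using add_coll[OF assms(1,2)] assms(4) by blast
  have "(u1 - u2) * (l' - l) = 0" using c assms(7,8) unfolding coll_def by Groebner_Basis.algebra
  then have l: "l' = l" using assms(4) by simp
  moreover have "v1 = l' * u1 + v'" using c by (simp add: coll_def)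
  ultimately have v: "v' = v" using assms(7) by simp
  have "(u3 - u1) * ((u3 - u2) * (u3 - x3)) = 0"
    using c l v assms(3,9) unfolding coll_def Affine_in_pts by Groebner_Basis.algebra
  then have "u3 = x3" using assms by auto
  moreover have "v3 = y3" using c l v assms(9) \<open>u3 = x3\<close> unfolding coll_def by simp
  ultimately show ?thesis using coll_add[OF c] by simp
qed

end

lemma root_of_unity_pow_eq_1:
  fixes t :: "'a :: field"
  assumes "prime p" "t ^ p = 1" "t \<noteq> 1" "t ^ n = 1"
  shows "p dvd n"
proof (rule ccontr)
  assume "\<not> p dvd n"
  then have "coprime p n" using assms(1) prime_imp_coprime by blast
  then have g: "gcd p n = 1" by simp
  have "p \<noteq> 0" using assms(1) by auto
  then obtain x y where "p * x = n * y + gcd p n" using bezout_nat by blast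
  then have "t ^ (p * x) = t ^ (n * y) * t" using g by (simp add: power_add)
  then show False using assms by (simp add: power_mult)
qed

text \<open>The powers of \<zeta> with exponent below p are p distinct roots of X^p - 1, hence all
  of its roots.\<close>

lemma primitive_root_power:
  fixes \<zeta> t :: "'a :: field_char_0"
  assumes "primitive_root_of_unity p \<zeta>" "t ^ p = 1"
  obtains i where "t = \<zeta> ^ i"
proof -
  have p: "p > 0" "\<zeta> ^ p = 1" and prim: "\<And>k. 0 < k \<Longrightarrow> k < p \<Longrightarrow> \<zeta> ^ k \<noteq> 1"
    using assms(1) by (auto simp: primitive_root_of_unity_def)
  have z: "\<zeta> \<noteq> 0" using p by (auto simp: power_0_left)
  have inj: "inj_on (\<lambda>i. \<zeta> ^ i) {..<p}"
  proof -
    have *: False if "i < j" "j < p" "\<zeta> ^ i = \<zeta> ^ j" for i j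
    proof -
      have "\<zeta> ^ (i + (j - i)) = \<zeta> ^ i * \<zeta> ^ (j - i)" by (rule power_add)
      then have "\<zeta> ^ i * \<zeta> ^ (j - i) = \<zeta> ^ i * 1" using that by simp
      then have "\<zeta> ^ (j - i) = 1" using z by (simp only: mult_cancel_left) simp
      then show False using prim[of "j - i"] that by simp
    qed
    then show ?thesis by (intro inj_onI) (metis lessThan_iff linorder_neqE_nat)
  qed
  let ?q = "Polynomial.monom 1 p - 1 :: 'a poly"
  have root: "poly ?q x = 0 \<longleftrightarrow> x ^ p = 1" for x by (simp add: poly_monom)
  have q0: "?q \<noteq> 0"
  proof
    assume "?q = 0"
    then have "poly ?q 0 = 0" by simp
    then show False using root[of 0] p by (simp add: power_0_left)
  qed
  have deg: "Polynomial.degree ?q \<le> p"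
    by (intro degree_diff_le) (auto simp: degree_monom_le)
  have "(\<lambda>i. \<zeta> ^ i) ` {..<p} = {x. poly ?q x = 0}"
  proof (rule card_subset_eq)
    show "finite {x. poly ?q x = 0}" using q0 by (rule poly_roots_finite)
    show sub: "(\<lambda>i. \<zeta> ^ i) ` {..<p} \<subseteq> {x. poly ?q x = 0}"
    proof
      fix x assume "x \<in> (\<lambda>i. \<zeta> ^ i) ` {..<p}"
      then obtain i where "x = \<zeta> ^ i" by blast
      then have "x ^ p = (\<zeta> ^ p) ^ i" by (simp flip: power_mult add: mult.commute)
      then show "x \<in> {x. poly ?q x = 0}" using root p(2) by simp
    qed
    have "card ((\<lambda>i. \<zeta> ^ i) ` {..<p}) = p" using card_image[OF inj] by simp
    moreover have "card {x. poly ?q x = 0} \<le> p"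
      using card_poly_roots_bound[OF q0] deg by simp
    moreover have "card ((\<lambda>i. \<zeta> ^ i) ` {..<p}) \<le> card {x. poly ?q x = 0}"
      using sub q0 by (intro card_mono poly_roots_finite)
    ultimately show "card ((\<lambda>i. \<zeta> ^ i) ` {..<p}) = card {x. poly ?q x = 0}" by simp
  qed
  then have "t \<in> (\<lambda>i. \<zeta> ^ i) ` {..<p}" using root assms(2) by blast
  then show ?thesis using that by blast
qed

section \<open>The field generated by the torsion points\<close>

context torsion_pair
begin

lemma map_point_pt:
  assumes \<sigma>: "field_endo \<sigma>" "\<sigma> a = a" "\<sigma> b = b"
    and P: "map_point \<sigma> P = pt 0 i" and Q: "map_point \<sigma> Q = pt k j"
  shows "map_point \<sigma> (pt m n) = pt (k * m) (j * m + i * n)"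
proof -
  have "map_point \<sigma> \<in> hom G G"
    using map_point_in_pts[OF \<sigma>] map_point_add[OF \<sigma>] by (auto simp: hom_def)
  then interpret h: group_hom G G "map_point \<sigma>" by unfold_locales
  have "map_point \<sigma> (Q [^]\<^bsub>G\<^esub> m) = pt (k * m) (j * m)" "map_point \<sigma> (P [^]\<^bsub>G\<^esub> n) = pt 0 (i * n)"
    using h.hom_int_pow[of Q m] h.hom_int_pow[of P n] P_in Q_in P Q pt_pow by simp_all
  then show ?thesis unfolding pt_def[of m n] by (simp add: map_point_add[OF \<sigma>] pt_add)
qed

end

locale borel_torsion = closed_over K for K :: "'a :: field_char_0 set" +
  fixes E :: "'a weierstrass" and p :: nat and x1 y1 x2 y2 \<zeta> :: 'a
  assumes elliptic: "elliptic_curve_over K E"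
    and prime: "prime p" and ge5: "p \<ge> 5"
    and basis: "torsion_basis E p (Affine x1 y1) (Affine x2 y2)"
    and upper_triangular: "\<forall>\<sigma>\<in>Gal (torsion_field K E p) K. \<exists>a b c :: nat. coprime a p \<and> coprime c p
           \<and> map_point \<sigma> (Affine x1 y1) = point_mult E a (Affine x1 y1)
           \<and> map_point \<sigma> (Affine x2 y2)
               = point_add E (point_mult E b (Affine x1 y1)) (point_mult E c (Affine x2 y2))"
    and primitive: "primitive_root_of_unity p \<zeta>"
begin

abbreviation "P1 \<equiv> Affine x1 y1"
abbreviation "P2 \<equiv> Affine x2 y2"
abbreviation "L \<equiv> torsion_field K E p"

lemma basis_points: "P1 \<in> points E" "P2 \<in> points E"
  using basis by (auto simp: torsion_basis_def torsion_def)

definition "T1 = to_short E P1"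
definition "T2 = to_short E P2"

sublocale S: torsion_pair "short_a E" "short_b E" p "T1" "T2"
proof -
  have nz: "4 * short_a E ^ 3 + 27 * short_b E ^ 2 \<noteq> 0"
    using elliptic discriminant_short[of E] unfolding elliptic_curve_over_def by (metis mult_zero_right)
  interpret short_curve_closed "short_a E" "short_b E"
    by unfold_locales (use nz algebraic_closure_root[OF closure] in auto)
  note mult = to_short_mult[OF refl refl]
  have in_pts: "T1 \<in> pts" "T2 \<in> pts"
    using basis_points to_short_in_pts[OF refl refl] unfolding T1_def T2_def by blast+
  have comb: "to_short E (point_add E (point_mult E m P1) (point_mult E n P2))
      = point_add curve (T1 [^]\<^bsub>G\<^esub> m) (T2 [^]\<^bsub>G\<^esub> n)" for m n
    using to_short_add[OF refl refl] mult basis_points point_mult_eq_pow in_pts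
    unfolding T1_def T2_def by metis
  show "torsion_pair (short_a E) (short_b E) p T1 T2"
  proof
    show "prime p" "p \<ge> 5" by (rule prime, rule ge5)
    show "T1 \<in> pts" "T2 \<in> pts" by (rule in_pts)+
    have "point_mult E p P1 = Infinity" "point_mult E p P2 = Infinity"
      using basis by (auto simp: torsion_basis_def torsion_def)
    then show "T1 [^]\<^bsub>G\<^esub> p = Infinity" "T2 [^]\<^bsub>G\<^esub> p = Infinity"
      using mult[OF basis_points(1), of p] mult[OF basis_points(2), of p] point_mult_eq_pow in_pts
      unfolding T1_def T2_def by (metis to_short.simps(1))+
    show "p dvd m \<and> p dvd n" if "point_add curve (T1 [^]\<^bsub>G\<^esub> m) (T2 [^]\<^bsub>G\<^esub> n) = Infinity" for m n
    proof -
      have "point_add E (point_mult E m P1) (point_mult E n P2) = Infinity"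
        using that comb[of m n] to_short_eq_Infinity by metis
      then show ?thesis using basis unfolding torsion_basis_def by blast
    qed
  qed
qed

lemma to_short_comb:
  "to_short E (point_add E (point_mult E m P1) (point_mult E n P2)) = S.pt (int n) (int m)"
proof -
  have m: "point_mult E m P1 \<in> points E" "to_short E (point_mult E m P1) = T1 [^]\<^bsub>S.G\<^esub> m"
    and n: "point_mult E n P2 \<in> points E" "to_short E (point_mult E n P2) = T2 [^]\<^bsub>S.G\<^esub> n"
    using S.to_short_mult[OF refl refl] basis_points S.point_mult_eq_pow S.P_in S.Q_in
    unfolding T1_def T2_def by metis+
  have "T1 [^]\<^bsub>S.G\<^esub> m \<in> S.pts" "T2 [^]\<^bsub>S.G\<^esub> n \<in> S.pts"
    using m n S.to_short_in_pts[OF refl refl] by metis+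
  then show ?thesis
    using S.to_short_add[OF refl refl m(1) n(1)] m(2) n(2) S.add_commute
    by (simp add: S.pt_def int_pow_int)
qed

lemma to_short_mult_P1: "to_short E (point_mult E m P1) = S.pt 0 (int m)"
proof -
  have "point_mult E 0 P2 = Infinity" by (simp add: point_mult_def)
  then have "point_add E (point_mult E m P1) (point_mult E 0 P2) = point_mult E m P1"
    by (cases "point_mult E m P1") auto
  then show ?thesis using to_short_comb[of m 0] by simp
qed

text \<open>Automorphisms of the whole ambient field, because \<sigma> must be evaluated at \<zeta>
  before \<zeta> is known to lie in L. \<open>restrict_aut_Gal\<close> leads back to the Galois
  group.\<close>

definition aut :: "('a \<Rightarrow> 'a) \<Rightarrow> bool" where
  "aut \<sigma> \<longleftrightarrow> field_endo \<sigma> \<and> bij \<sigma> \<and> (\<forall>x\<in>K. \<sigma> x = x)"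

lemma aut_inv_into:
  assumes "aut \<sigma>"
  shows "aut (inv_into UNIV \<sigma>)"
proof -
  interpret field_endo \<sigma> using assms by (simp add: aut_def)
  have b: "bij \<sigma>" using assms by (simp add: aut_def)
  let ?\<tau> = "inv_into UNIV \<sigma>"
  have i: "?\<tau> y = x \<longleftrightarrow> y = \<sigma> x" for x y using b by (metis bij_inv_eq_iff)
  have s: "\<sigma> (?\<tau> y) = y" for y using i by metis
  have "field_endo ?\<tau>"
    by unfold_locales (simp_all add: i hom_add hom_mult s)
  moreover have "bij ?\<tau>" using b by (rule bij_imp_bij_inv)
  moreover have "\<forall>x\<in>K. ?\<tau> x = x" using assms by (simp add: aut_def i)
  ultimately show ?thesis by (simp add: aut_def)
qed

lemma aut_coeff: "aut \<sigma> \<Longrightarrow> x \<in> set_weierstrass E \<Longrightarrow> \<sigma> x = x"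
  using elliptic by (auto simp: aut_def elliptic_curve_over_def)

lemma aut_field_endo: "aut \<sigma> \<Longrightarrow> field_endo \<sigma>"
  by (simp add: aut_def)

lemma aut_short:
  assumes "aut \<sigma>"
  shows "\<sigma> (short_a E) = short_a E" "\<sigma> (short_b E) = short_b E"
    "map_point \<sigma> (to_short E U) = to_short E (map_point \<sigma> U)"
  using map_point_to_short[OF aut_field_endo[OF assms] aut_coeff[OF assms]] by blast+

lemma aut_T:
  assumes "aut \<sigma>"
  shows "map_point \<sigma> T1 = to_short E (map_point \<sigma> P1)" "map_point \<sigma> T2 = to_short E (map_point \<sigma> P2)"
  unfolding T1_def T2_def by (rule aut_short(3)[OF assms])+

lemma map_point_torsion:
  assumes "aut \<sigma>" "T \<in> torsion E p"
  shows "map_point \<sigma> T \<in> torsion E p"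
proof -
  have "map_point \<sigma> (point_mult E n T) = point_mult E n (map_point \<sigma> T)" for n
    by (induction n)
      (simp_all add: point_mult_def map_point_point_add[OF aut_field_endo[OF assms(1)] aut_coeff[OF assms(1)]])
  then have "point_mult E p (map_point \<sigma> T) = Infinity"
    using assms(2) by (metis (mono_tags, lifting) mem_Collect_eq point.simps(8) torsion_def)
  moreover have "to_short E T \<in> S.pts"
    using assms(2) S.to_short_in_pts[OF refl refl] by (simp add: torsion_def)
  then have "map_point \<sigma> (to_short E T) \<in> S.pts"
    by (intro S.map_point_in_pts aut_field_endo assms aut_short)
  then have "map_point \<sigma> T \<in> points E"
    using aut_short(3)[OF assms(1)] S.to_short_in_pts[OF refl refl] by metis
  ultimately show ?thesis by (simp add: torsion_def)
qed

lemma subfield_L: "subfield L ambient"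
  unfolding torsion_field_def by (rule subfield_adjoin)

lemma K_sub_L: "K \<subseteq> L"
  and torsion_sub_L: "T \<in> torsion E p \<Longrightarrow> set_point T \<subseteq> L"
  using adjoin_superset[of K "\<Union>Q\<in>torsion E p. set_point Q"] unfolding torsion_field_def by blast+

lemma P_in_L: "x1 \<in> L" "y1 \<in> L" "x2 \<in> L" "y2 \<in> L"
  using torsion_sub_L[of P1] torsion_sub_L[of P2] basis by (auto simp: torsion_basis_def)

lemma L_least:
  assumes "subfield M ambient" "K \<subseteq> M" "\<And>T. T \<in> torsion E p \<Longrightarrow> set_point T \<subseteq> M"
  shows "L \<subseteq> M"
  unfolding torsion_field_def using assms by (intro adjoin_least) auto

text \<open>The preimage of L under \<sigma> is a subfield; it contains K and all torsion
  coordinates, since \<sigma> maps torsion points to torsion points.\<close>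

lemma aut_L:
  assumes "aut \<sigma>" "x \<in> L"
  shows "\<sigma> x \<in> L"
proof -
  interpret field_endo \<sigma> by (rule aut_field_endo[OF assms(1)])
  note c = subfield_closed[OF subfield_L]
  have "L \<subseteq> {x. \<sigma> x \<in> L}"
  proof (rule L_least)
    show "subfield {x. \<sigma> x \<in> L} ambient"
      by (rule subfieldI_ambient) (simp_all add: c hom_simps)
    show "K \<subseteq> {x. \<sigma> x \<in> L}" using K_sub_L assms(1) by (auto simp: aut_def)
    fix T assume "T \<in> torsion E p"
    then have "set_point (map_point \<sigma> T) \<subseteq> L" using map_point_torsion assms(1) torsion_sub_L by blast
    then show "set_point T \<subseteq> {x. \<sigma> x \<in> L}" by (auto simp: point.set_map)
  qed
  then show ?thesis using assms by blast
qed

lemma restrict_aut_Gal: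
  assumes "aut \<sigma>"
  shows "restrict \<sigma> L \<in> Gal L K"
proof -
  interpret field_endo \<sigma> using assms by (rule aut_field_endo)
  note c = subfield_closed[OF subfield_L]
  have b: "bij \<sigma>" using assms by (simp add: aut_def)
  have "\<sigma> ` L = L"
  proof
    show "\<sigma> ` L \<subseteq> L" using aut_L assms by blast
    show "L \<subseteq> \<sigma> ` L"
    proof
      fix y assume "y \<in> L"
      then have "inv_into UNIV \<sigma> y \<in> L" using aut_L aut_inv_into assms by blast
      moreover have "y = \<sigma> (inv_into UNIV \<sigma> y)" using b by (metis bij_inv_eq_iff)
      ultimately show "y \<in> \<sigma> ` L" by blast
    qed
  qed
  then have "bij_betw (restrict \<sigma> L) L L" by (simp add: bij_betw_def inj_on_def)
  then have "restrict \<sigma> L \<in> ring_iso (ambient\<lparr>carrier := L\<rparr>) (ambient\<lparr>carrier := L\<rparr>)"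
    using aut_L[OF assms] by (auto simp: ring_iso_def ring_hom_def hom_add hom_mult c)
  moreover have "\<forall>x\<in>K. restrict \<sigma> L x = x" using assms K_sub_L by (auto simp: aut_def)
  ultimately show ?thesis by (simp add: Gal_def)
qed

lemma aut_action:
  assumes "aut \<sigma>"
  obtains i j k :: nat where "coprime i p" "coprime k p"
    "map_point \<sigma> T1 = S.pt 0 (int i)" "map_point \<sigma> T2 = S.pt (int k) (int j)"
proof -
  obtain i j k :: nat where c: "coprime i p" "coprime k p"
    and P: "map_point (restrict \<sigma> L) P1 = point_mult E i P1"
    and Q: "map_point (restrict \<sigma> L) P2 = point_add E (point_mult E j P1) (point_mult E k P2)"
    using upper_triangular restrict_aut_Gal[OF assms] by blast
  have r: "map_point (restrict \<sigma> L) P1 = map_point \<sigma> P1" "map_point (restrict \<sigma> L) P2 = map_point \<sigma> P2"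
    using P_in_L by simp_all
  have "map_point \<sigma> T1 = S.pt 0 (int i)"
    using aut_T(1)[OF assms] P r(1) to_short_mult_P1[of i] by simp
  moreover have "map_point \<sigma> T2 = S.pt (int k) (int j)"
    using aut_T(2)[OF assms] Q r(2) to_short_comb[of j k] by simp
  ultimately show ?thesis using c that by blast
qed

lemma aut_fixes_L:
  assumes "aut \<sigma>" "map_point \<sigma> P1 = P1" "map_point \<sigma> P2 = P2" "x \<in> L"
  shows "\<sigma> x = x"
proof -
  interpret field_endo \<sigma> by (rule aut_field_endo[OF assms(1)])
  note add = map_point_point_add[OF aut_field_endo[OF assms(1)] aut_coeff[OF assms(1)]]
  have mult: "map_point \<sigma> (point_mult E n T) = point_mult E n T" if "map_point \<sigma> T = T" for n T
    using that by (induction n) (simp_all add: point_mult_def add)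
  have "L \<subseteq> {x. \<sigma> x = x}"
  proof (rule L_least)
    show "subfield {x. \<sigma> x = x} ambient"
      by (rule subfieldI_ambient) (simp_all add: hom_simps)
    show "K \<subseteq> {x. \<sigma> x = x}" using assms(1) by (auto simp: aut_def)
    fix T assume "T \<in> torsion E p"
    then obtain m n where T: "T = point_add E (point_mult E m P1) (point_mult E n P2)"
      using basis unfolding torsion_basis_def by blast
    have "map_point \<sigma> T = T"
      unfolding T by (subst add) (simp_all only: mult[OF assms(2)] mult[OF assms(3)])
    then show "set_point T \<subseteq> {x. \<sigma> x = x}" by (cases T) auto
  qed
  then show ?thesis using assms(4) by blast
qed

text \<open>For k = 1 and k = -1 these are cases of the rule that \<sigma> raises \<zeta> to the
  determinant i k. The pairing yields them for t, and t and \<zeta> are powers of each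
  other.\<close>

lemma aut_fixing_zeta:
  assumes "aut \<sigma>" "map_point \<sigma> T1 = S.pt 0 (int i)"
    "map_point \<sigma> T2 = S.pt k j"
  shows "\<sigma> \<zeta> = \<zeta> \<Longrightarrow> int p dvd k - 1 \<Longrightarrow> int p dvd int i - 1"
    and "\<sigma> \<zeta> = \<zeta> \<Longrightarrow> int p dvd k + 1 \<Longrightarrow> int p dvd int i + 1"
    and "int p dvd k - 1 \<Longrightarrow> int p dvd int i - 1 \<Longrightarrow> \<sigma> \<zeta> = \<zeta>"
proof -
  interpret field_endo \<sigma> by (rule aut_field_endo[OF assms(1)])
  note \<sigma> = aut_field_endo[OF assms(1)] aut_short(1,2)[OF assms(1)]
  obtain t where t: "t \<noteq> 1" "t ^ p = 1" and weil:
    "\<And>\<sigma> e k j. \<lbrakk>field_endo \<sigma>; \<sigma> (short_a E) = short_a E; \<sigma> (short_b E) = short_b E;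
       S.flip e (map_point \<sigma> T1) = S.pt 0 (int k);
       S.flip e (map_point \<sigma> T2) = S.pt 1 j\<rbrakk> \<Longrightarrow> \<sigma> t = t ^ k"
    using S.pairing_root_of_unity by blast
  note order = root_of_unity_pow_eq_1[OF prime t(2,1)]
  have t0: "t \<noteq> 0" using t ge5 by (auto simp: power_0_left)
  have pow_eq: "int p dvd int n - 1" if "t ^ n = t" "n > 0" for n
  proof -
    have "t * t ^ (n - 1) = t * 1" using that by (simp flip: power_Suc)
    then have "t ^ (n - 1) = 1" using t0 by (simp only: mult_cancel_left) simp
    then have "p dvd n - 1" by (rule order)
    then have "int p dvd int (n - 1)" by (simp only: int_dvd_int_iff)
    then show ?thesis using that(2) by (simp add: of_nat_diff)
  qed
  obtain n where n: "t = \<zeta> ^ n" using primitive_root_power[OF primitive t(2)] by blast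
  have one: "\<sigma> t = t ^ i" if "int p dvd k - 1"
  proof -
    have "S.pt k j = S.pt 1 j" using that by (simp add: S.pt_eq_iff)
    then show ?thesis using weil[OF \<sigma>, of False i j] assms by (simp add: S.flip_def)
  qed
  \<comment> \<open>After negation the coefficient of T1 is -i, represented by the natural number (p
    - 1) i.\<close>
  have minus_one: "\<sigma> t = t ^ ((p - 1) * i)" if "int p dvd k + 1"
  proof -
    have "int p dvd - (k + 1)" using that by (simp only: dvd_minus_iff)
    also have "- (k + 1) = - k - 1" by simp
    finally have "S.pt (- k) (- j) = S.pt 1 (- j)" by (simp add: S.pt_eq_iff)
    moreover have "S.pt 0 (- int i) = S.pt 0 (int ((p - 1) * i))"
    proof -
      have "- int i - int ((p - 1) * i) = int p * (- int i)"
        using ge5 by (simp add: of_nat_diff algebra_simps)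
      then show ?thesis by (simp add: S.pt_eq_iff)
    qed
    ultimately show ?thesis
      using weil[OF \<sigma>, of True "(p - 1) * i" "- j"] assms by (simp add: S.flip_def S.neg_pt)
  qed
  have pos: "i > 0"
  proof (rule ccontr)
    assume "\<not> i > 0"
    then have "map_point \<sigma> T1 = Infinity" using assms(2) S.pt_0_0 by simp
    then show False by (simp add: T1_def)
  qed
  {
    assume "\<sigma> \<zeta> = \<zeta>"
    then have st: "\<sigma> t = t" by (simp add: n hom_power)
    show "int p dvd int i - 1" if "int p dvd k - 1"
      using pow_eq[of i] one[OF that] st pos by simp
    show "int p dvd int i + 1" if "int p dvd k + 1"
    proof -
      have "int p dvd int ((p - 1) * i) - 1"
        using pow_eq[of "(p - 1) * i"] minus_one[OF that] st pos ge5 by simp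
      moreover have "int ((p - 1) * i) - 1 = int p * int i - (int i + 1)"
        using ge5 by (simp add: of_nat_diff algebra_simps)
      ultimately show ?thesis by (metis dvd_diff_right_iff dvd_triv_left)
    qed
  }
  assume "int p dvd k - 1" "int p dvd int i - 1"
  have "t ^ i = t"
  proof -
    have "int p dvd int (i - 1)" using \<open>int p dvd int i - 1\<close> pos by (simp add: of_nat_diff)
    then have "p dvd i - 1" by (simp only: int_dvd_int_iff)
    then have "t ^ (i - 1) = 1" using t(2) by (auto simp: power_mult elim!: dvdE)
    then have "t * t ^ (i - 1) = t" by simp
    then show ?thesis using pos by (simp flip: power_Suc)
  qed
  then have st: "\<sigma> t = t" using one[OF \<open>int p dvd k - 1\<close>] by simp
  have zp: "\<zeta> ^ p = 1" using primitive by (simp add: primitive_root_of_unity_def)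
  \<comment> \<open>Since t is not 1, n is prime to p, and Bezout makes \<zeta> a power of
    t.\<close>
  have "\<not> p dvd n" using n t(1) zp by (auto simp: power_mult elim!: dvdE)
  then have "coprime n p" using prime by (metis coprime_commute prime_imp_coprime)
  then have g: "gcd n p = 1" by simp
  have "n \<noteq> 0" using n t(1) by (metis power_0)
  then obtain x y where "n * x = p * y + gcd n p" using bezout_nat by blast
  then have "t ^ x = \<zeta> ^ (p * y + 1)" unfolding n g by (simp flip: power_mult)
  then have "\<zeta> = t ^ x" using zp by (simp add: power_add power_mult)
  then show "\<sigma> \<zeta> = \<zeta>" using st by (simp add: hom_power)
qed

lemma P1_eq: "T1 = S.pt 0 1" and P2_eq: "T2 = S.pt 1 0"
  by (rule S.P_eq, rule S.Q_eq)

text \<open>An automorphism that fixes L fixes P1 and P2, so it acts with i = k = 1 and cannot move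
  \<zeta>.\<close>

lemma zeta_in_L: "\<zeta> \<in> L"
proof (rule ccontr)
  assume "\<zeta> \<notin> L"
  then obtain \<sigma> where \<sigma>: "field_endo \<sigma>" "bij \<sigma>" "\<And>x. x \<in> L \<Longrightarrow> \<sigma> x = x" "\<sigma> \<zeta> \<noteq> \<zeta>"
    using automorphism_moving[OF subfield_L K_sub_L] by blast
  have a: "aut \<sigma>" using \<sigma> K_sub_L by (auto simp: aut_def)
  have "map_point \<sigma> P1 = P1" "map_point \<sigma> P2 = P2" using \<sigma>(3) P_in_L by simp_all
  then have "map_point \<sigma> T1 = T1" "map_point \<sigma> T2 = T2" using aut_T[OF a] T1_def T2_def by metis+
  then have "map_point \<sigma> T1 = S.pt 0 (int 1)" "map_point \<sigma> T2 = S.pt 1 0"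
    using P1_eq P2_eq by simp_all
  then have "\<sigma> \<zeta> = \<zeta>" by (rule aut_fixing_zeta(3)[OF a]) simp_all
  with \<sigma>(4) show False by simp
qed

text \<open>An automorphism over M fixes P2, hence k = 1; as it fixes \<zeta>, also i = 1, and P1 is
  fixed too. So L arises from K by adjoining \<zeta>, x2 and y2.\<close>

lemma L_sub:
  assumes M: "subfield M ambient" "K \<subseteq> M" "\<zeta> \<in> M" "x2 \<in> M" "y2 \<in> M"
  shows "L \<subseteq> M"
proof
  fix z assume z: "z \<in> L"
  show "z \<in> M"
  proof (rule ccontr)
    assume "z \<notin> M"
    then obtain \<sigma> where \<sigma>: "field_endo \<sigma>" "bij \<sigma>" "\<And>x. x \<in> M \<Longrightarrow> \<sigma> x = x" "\<sigma> z \<noteq> z"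
      using automorphism_moving[OF M(1,2)] by blast
    have a: "aut \<sigma>" using \<sigma> M by (auto simp: aut_def)
    obtain i j k :: nat where P: "map_point \<sigma> T1 = S.pt 0 (int i)"
      and Q: "map_point \<sigma> T2 = S.pt (int k) (int j)"
      using aut_action[OF a] by blast
    have Q': "map_point \<sigma> P2 = P2" using \<sigma>(3) M by simp
    then have "S.pt (int k) (int j) = S.pt 1 0" using aut_T(2)[OF a] Q P2_eq T2_def by metis
    then have "int p dvd int k - 1" by (simp add: S.pt_eq_iff)
    then have "int p dvd int i - 1" using aut_fixing_zeta(1)[OF a P Q] \<sigma>(3) M(3) by blast
    then have "S.pt 0 (int i) = S.pt 0 1" by (simp add: S.pt_eq_iff)
    then have "to_short E (map_point \<sigma> P1) = T1" using aut_T(1)[OF a] P P1_eq by simp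
    then have "map_point \<sigma> P1 = P1" by (simp only: T1_def to_short_inj)
    then have "\<sigma> z = z" using aut_fixes_L[OF a _ Q' z] by blast
    with \<sigma>(4) show False by simp
  qed
qed

abbreviation "F \<equiv> adjoin K {\<zeta>, y2}"

lemma F_facts: "subfield F ambient" "K \<subseteq> F" "\<zeta> \<in> F" "y2 \<in> F" "F \<subseteq> L"
proof -
  show "subfield F ambient" by (rule subfield_adjoin)
  show "K \<subseteq> F" "\<zeta> \<in> F" "y2 \<in> F" using adjoin_superset[of K "{\<zeta>, y2}"] by auto
  show "F \<subseteq> L" using zeta_in_L P_in_L K_sub_L by (intro adjoin_least subfield_L) auto
qed

lemma L_eq_F: "x2 \<in> F \<Longrightarrow> L = F"
  using L_sub[of F] F_facts by blast

lemma P2_root: "x2 ^ 3 + a2 E * x2 ^ 2 + (a4 E - a1 E * y2) * x2 + (a6 E - y2 ^ 2 - a3 E * y2) = 0"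
  using basis_points(2) by (simp add: points_def algebra_simps)

text \<open>One automorphism serves both parts of the theorem: the three distinct conjugates of x2
  give the degree, the congruence restricts p modulo 3.\<close>

lemma conjugates:
  assumes "x2 \<notin> F"
  obtains \<sigma> k where "field_endo \<sigma>" "\<And>x. x \<in> F \<Longrightarrow> \<sigma> x = x"
    "\<sigma> x2 \<noteq> x2" "\<sigma> (\<sigma> x2) \<noteq> x2" "\<sigma> (\<sigma> x2) \<noteq> \<sigma> x2" "coprime k p" "int p dvd 1 + int k + int k ^ 2"
proof -
  obtain \<sigma> where \<sigma>: "field_endo \<sigma>" "bij \<sigma>" "\<And>x. x \<in> F \<Longrightarrow> \<sigma> x = x" "\<sigma> x2 \<noteq> x2"
    using automorphism_moving[OF F_facts(1,2) assms] by blast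
  have a: "aut \<sigma>" using \<sigma> F_facts by (auto simp: aut_def)
  interpret field_endo \<sigma> by fact
  have y2: "\<sigma> y2 = y2" using \<sigma>(3) F_facts by blast
  have z: "\<sigma> \<zeta> = \<zeta>" using \<sigma>(3) F_facts by blast
  obtain i j k :: nat where k: "coprime k p" and P: "map_point \<sigma> T1 = S.pt 0 (int i)"
    and Q: "map_point \<sigma> T2 = S.pt (int k) (int j)"
    using aut_action[OF a] by blast
  note \<sigma>' = \<sigma>(1) aut_short(1,2)[OF a]
  note Z = aut_fixing_zeta(1,2)[OF a P Q z]
  have Q1: "to_short E (Affine (\<sigma> x2) y2) = S.pt (int k) (int j)"
    using Q aut_T(2)[OF a] y2 by simp
  have Q2: "to_short E (Affine (\<sigma> (\<sigma> x2)) y2) = S.pt (int k * int k) (int j * int k + int i * int j)"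
  proof -
    have "to_short E (map_point \<sigma> (Affine (\<sigma> x2) y2)) = map_point \<sigma> (S.pt (int k) (int j))"
      using aut_short(3)[OF a, of "Affine (\<sigma> x2) y2"] Q1 by metis
    also have "\<dots> = S.pt (int k * int k) (int j * int k + int i * int j)"
      by (rule S.map_point_pt[OF \<sigma>' P Q])
    finally show ?thesis using y2 by simp
  qed
  have ne1: "\<sigma> (\<sigma> x2) \<noteq> x2"
  proof
    assume "\<sigma> (\<sigma> x2) = x2"
    then have "S.pt (int k * int k) (int j * int k + int i * int j) = S.pt 1 0" using Q2 P2_eq T2_def by simp
    then have d: "int p dvd int k * int k - 1" "int p dvd int j * int k + int i * int j"
      by (simp_all add: S.pt_eq_iff)
    have "int k * int k - 1 = (int k - 1) * (int k + 1)" by (simp add: algebra_simps)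
    then have "int p dvd int k - 1 \<or> int p dvd int k + 1"
      using d(1) prime by (simp add: prime_dvd_mult_iff)
    then show False
    proof
      assume k1: "int p dvd int k - 1"
      \<comment> \<open>Every term on the right is divisible by p when i = k = 1, so j = 0 and
        \<sigma> would fix P2.\<close>
      have "2 * int j = int j * int k + int i * int j - int j * (int k - 1) - int j * (int i - 1)"
        by (simp add: algebra_simps)
      then have "int p dvd 2 * int j" using d(2) k1 Z(1)[OF k1] by (simp add: dvd_diff)
      then have "int p dvd int j" by (simp only: S.two_nz)
      then have "S.pt (int k) (int j) = S.pt 1 0" using k1 by (simp add: S.pt_eq_iff)
      then show False using Q1 P2_eq \<sigma>(4) T2_def by (metis point.inject to_short_inj)
    next
      assume k1: "int p dvd int k + 1"
      \<comment> \<open>The same for i = k = -1: now \<sigma> would send P2 to -P2, which has the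
        same abscissa.\<close>
      have "- (2 * int j) = int j * int k + int i * int j - int j * (int k + 1) - int j * (int i + 1)"
        by (simp add: algebra_simps)
      then have "int p dvd - (2 * int j)" using d(2) k1 Z(2)[OF k1] by (metis dvd_diff dvd_mult)
      then have "int p dvd int j" by (simp only: dvd_minus_iff S.two_nz)
      then have "S.pt (int k) (int j) = S.neg (S.pt 1 0)" using k1 by (simp add: S.neg_pt S.pt_eq_iff)
      then have "to_short E (Affine (\<sigma> x2) y2) = S.neg T2" using Q1 P2_eq by simp
      then show False using \<sigma>(4) by (simp add: T2_def)
    qed
  qed
  have ne2: "\<sigma> (\<sigma> x2) \<noteq> \<sigma> x2" using \<sigma>(4) by simp
  have "int p dvd 1 + int k + int k ^ 2"
  proof -
    \<comment> \<open>The line y = y2 in short coordinates: put x = X - \<open>short_c E\<close>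
      into Y = y2 + (a1 x + a3) / 2.\<close>
    let ?l = "a1 E / 2" and ?v = "y2 + a3 E / 2 - a1 E / 2 * short_c E"
    have on: "T2 \<in> S.pts" "to_short E (Affine (\<sigma> x2) y2) \<in> S.pts"
      "to_short E (Affine (\<sigma> (\<sigma> x2)) y2) \<in> S.pts"
      using S.Q_in unfolding Q1 Q2 by simp_all
    have "point_add S.curve T2 (to_short E (Affine (\<sigma> x2) y2))
        = S.neg (to_short E (Affine (\<sigma> (\<sigma> x2)) y2))"
      unfolding T2_def to_short.simps
      by (rule S.collinear_sum[OF on[unfolded T2_def to_short.simps], of ?l ?v])
        (use \<sigma>(4) ne1 ne2 in \<open>auto simp: algebra_simps add_divide_distrib\<close>)
    then have "point_add S.curve (S.pt 1 0) (S.pt (int k) (int j))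
        = S.neg (S.pt (int k * int k) (int j * int k + int i * int j))"
      using P2_eq Q1 Q2 by metis
    then have "S.pt (1 + int k) (0 + int j) = S.pt (- (int k * int k)) (- (int j * int k + int i * int j))"
      by (simp only: S.pt_add S.neg_pt)
    then show ?thesis by (simp add: S.pt_eq_iff power2_eq_square)
  qed
  then show ?thesis using that \<sigma> ne1 ne2 k by blast
qed

text \<open>The hypothesis gives k^3 = 1 modulo p. If p = 3 m + 2, then k^(p - 1) = k^(3 m + 1) = k,
  so Fermat yields k = 1 and p would divide 3.\<close>

lemma cong_1_mod_3:
  assumes "coprime k p" "int p dvd 1 + int k + int k ^ 2"
  shows "[p = 1] (mod 3)"
proof (rule ccontr)
  assume "\<not> [p = 1] (mod 3)"
  then have "p mod 3 = 0 \<or> p mod 3 = 2" by (auto simp: cong_def)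
  moreover have "p mod 3 \<noteq> 0"
  proof
    assume "p mod 3 = 0"
    then have "3 dvd p" by auto
    then have "p = 3" using prime by (metis One_nat_def numeral_eq_one_iff prime_nat_iff semiring_norm(86))
    with ge5 show False by simp
  qed
  ultimately have "p mod 3 = 2" by simp
  define m where "m = p div 3"
  have pm: "p - 1 = 3 * m + 1" using \<open>p mod 3 = 2\<close> unfolding m_def by presburger
  have "[int k ^ 3 = 1] (mod int p)"
  proof -
    have "int k ^ 3 - 1 = (int k - 1) * (1 + int k + int k ^ 2)"
      by (simp add: algebra_simps power2_eq_square power3_eq_cube)
    then show ?thesis using assms(2) by (simp add: cong_iff_dvd_diff)
  qed
  then have "[(int k ^ 3) ^ m * int k = 1 ^ m * int k] (mod int p)"
    by (intro cong_mult cong_pow cong_refl)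
  moreover have "(int k ^ 3) ^ m * int k = int k ^ (p - 1)"
    unfolding pm by (simp add: power_mult power_add)
  ultimately have 1: "[int k ^ (p - 1) = int k] (mod int p)" by simp
  have "\<not> p dvd k" using assms(1) prime by (metis coprime_absorb_right not_prime_unit)
  then have "[k ^ (p - 1) = 1] (mod p)" using fermat_theorem prime by blast
  then have 2: "[int k ^ (p - 1) = 1] (mod int p)" by (metis cong_int_iff of_nat_1 of_nat_power)
  have "[int k = 1] (mod int p)" using 1 2 by (metis cong_sym cong_trans)
  then have "int p dvd int k - 1" by (simp add: cong_iff_dvd_diff)
  moreover have "3 = (1 + int k + int k ^ 2) - (int k - 1) * (int k + 2)"
    by (simp add: algebra_simps power2_eq_square)
  ultimately have "int p dvd 3" using assms(2) by (metis dvd_diff dvd_mult2)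
  then have "p dvd 3" by (metis int_dvd_int_iff of_nat_numeral)
  then show False using ge5 by (auto dest: dvd_imp_le)
qed

lemma degree_1: "L = F \<Longrightarrow> has_degree L F 1"
  unfolding has_degree_def
  using ring.dimension_one[OF _ F_facts(1)] field_ambient[where 'a = 'a] by (metis field.is_ring)

lemma line_ext:
  fixes M V :: "'a set"
  shows "ring.line_extension ambient M x V = {u * x + v | u v. u \<in> M \<and> v \<in> V}"
proof -
  interpret field "ambient :: 'a ring" by (rule field_ambient)
  show ?thesis
    by (auto simp: line_extension_def r_coset_def set_add_def set_mult_def)
qed

text \<open>W is spanned over F by 1, x2 and x2^2. The cubic equation of x2 makes it a ring, and
  algebraicity over K makes that ring a field, so W = L by \<open>L_sub\<close>.\<close>

lemma degree_3:
  assumes "x2 \<notin> F"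
  shows "has_degree L F 3"
proof -
  obtain \<sigma> and k :: nat where \<sigma>: "field_endo \<sigma>" "\<And>x. x \<in> F \<Longrightarrow> \<sigma> x = x"
    "\<sigma> x2 \<noteq> x2" "\<sigma> (\<sigma> x2) \<noteq> x2" "\<sigma> (\<sigma> x2) \<noteq> \<sigma> x2"
    using conjugates[OF assms] by blast
  interpret field_endo \<sigma> by fact
  interpret R: field "ambient :: 'a ring" by (rule field_ambient)
  note Fc = subfield_closed[OF F_facts(1)]
  define V where "V = {u * x2 + v | u v. u \<in> F \<and> v \<in> F}"
  define W where "W = {u * x2 ^ 2 + v | u v. u \<in> F \<and> v \<in> V}"
  have "R.dimension (Suc 0) F F" using R.dimension_one[OF F_facts(1)] by simp
  then have "R.dimension (Suc (Suc 0)) F V"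
    using R.dimension.Suc_dim[of x2 F "Suc 0" F] assms by (simp add: V_def line_ext)
  \<comment> \<open>A quadratic relation over F would be preserved by \<sigma> and so have three
    distinct roots.\<close>
  moreover have "x2 ^ 2 \<notin> V"
  proof
    assume "x2 ^ 2 \<in> V"
    then obtain u v where uv: "u \<in> F" "v \<in> F" "x2 ^ 2 = u * x2 + v" by (auto simp: V_def)
    have s: "\<sigma> x ^ 2 = u * \<sigma> x + v" if "x ^ 2 = u * x + v" for x
      using arg_cong[OF that, of \<sigma>] \<sigma>(2) uv by (simp add: hom_simps)
    let ?x' = "\<sigma> x2" and ?x'' = "\<sigma> (\<sigma> x2)"
    have e: "?x' ^ 2 = u * ?x' + v" "?x'' ^ 2 = u * ?x'' + v" using s uv(3) by blast+
    have "(?x' - x2) * (?x' + x2 - u) = 0" using e uv(3) by Groebner_Basis.algebra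
    then have 1: "?x' + x2 - u = 0" using \<sigma>(3) by simp
    have "(?x'' - x2) * (?x'' + x2 - u) = 0" using e uv(3) by Groebner_Basis.algebra
    then have 2: "?x'' + x2 - u = 0" using \<sigma>(4) by simp
    have "?x' = ?x''" using 1 2 by Groebner_Basis.algebra
    with \<sigma>(5) show False by simp
  qed
  ultimately have dim: "R.dimension (Suc (Suc (Suc 0))) F W"
    using R.dimension.Suc_dim[of "x2 ^ 2" V "Suc (Suc 0)" F] by (simp add: W_def line_ext)
  have W_alt: "W = {u * x2 ^ 2 + v * x2 + w | u v w. u \<in> F \<and> v \<in> F \<and> w \<in> F}"
    unfolding W_def V_def by (auto simp: add.assoc)
  have WI: "u * x2 ^ 2 + v * x2 + w \<in> W" if "u \<in> F" "v \<in> F" "w \<in> F" for u v w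
    using that unfolding W_alt by blast
  have coeffs: "a1 E \<in> F" "a2 E \<in> F" "a3 E \<in> F" "a4 E \<in> F" "a6 E \<in> F"
    using elliptic F_facts(2) unfolding elliptic_curve_over_def by (cases E; auto)+
  define e2 e1 e0 where "e2 = - a2 E" and "e1 = a1 E * y2 - a4 E" and "e0 = y2 ^ 2 + a3 E * y2 - a6 E"
  have e: "e0 \<in> F" "e1 \<in> F" "e2 \<in> F"
    using coeffs F_facts(4) Fc by (simp_all add: e0_def e1_def e2_def power2_eq_square)
  have x3: "x2 ^ 3 = e2 * x2 ^ 2 + e1 * x2 + e0"
    using P2_root e0_def e1_def e2_def by Groebner_Basis.algebra
  \<comment> \<open>Products of two elements of W reach degree 4 in x2.\<close>
  have x4: "x2 ^ 4 = (e1 + e2 * e2) * x2 ^ 2 + (e0 + e2 * e1) * x2 + e2 * e0"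
    using x3 by Groebner_Basis.algebra
  have Wadd: "x + y \<in> W" if xy: "x \<in> W" "y \<in> W" for x y
  proof -
    obtain u v w u' v' w' where x: "x = u * x2 ^ 2 + v * x2 + w" "u \<in> F" "v \<in> F" "w \<in> F"
      and y: "y = u' * x2 ^ 2 + v' * x2 + w'" "u' \<in> F" "v' \<in> F" "w' \<in> F"
      using xy unfolding W_alt by blast
    have "x + y = (u + u') * x2 ^ 2 + (v + v') * x2 + (w + w')" using x y by (simp add: algebra_simps)
    moreover have "u + u' \<in> F" "v + v' \<in> F" "w + w' \<in> F" using x y Fc(3) by blast+
    ultimately show ?thesis using WI by simp
  qed
  have Wmult: "x * y \<in> W" if xy: "x \<in> W" "y \<in> W" for x y
  proof -
    obtain u v w u' v' w' where x: "x = u * x2 ^ 2 + v * x2 + w" "u \<in> F" "v \<in> F" "w \<in> F"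
      and y: "y = u' * x2 ^ 2 + v' * x2 + w'" "u' \<in> F" "v' \<in> F" "w' \<in> F"
      using xy unfolding W_alt by blast
    define s4 s3 where "s4 = u * u'" and "s3 = u * v' + v * u'"
    define s2 where "s2 = u * w' + v * v' + w * u'"
    define t2 where "t2 = s2 + s3 * e2 + s4 * (e1 + e2 * e2)"
    define t1 where "t1 = v * w' + w * v' + s3 * e1 + s4 * (e0 + e2 * e1)"
    define t0 where "t0 = w * w' + s3 * e0 + s4 * (e2 * e0)"
    have "x * y = s4 * x2 ^ 4 + s3 * x2 ^ 3 + s2 * x2 ^ 2 + (v * w' + w * v') * x2 + w * w'"
      unfolding x(1) y(1) s4_def s3_def s2_def by Groebner_Basis.algebra
    also have "\<dots> = t2 * x2 ^ 2 + t1 * x2 + t0"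
      unfolding x4 x3 t2_def t1_def t0_def by Groebner_Basis.algebra
    finally have "x * y = t2 * x2 ^ 2 + t1 * x2 + t0" .
    moreover have "t0 \<in> F" "t1 \<in> F" "t2 \<in> F"
      using x y e Fc by (simp_all add: t0_def t1_def t2_def s2_def s3_def s4_def)
    ultimately show ?thesis using WI by simp
  qed
  have FW: "F \<subseteq> W" using WI[of 0 0] Fc(1) by auto
  have x2W: "x2 \<in> W" using WI[of 0 1 0] Fc(1,2) by simp
  have sub: "subfield W ambient"
  proof (rule subfieldI_ambient)
    show "1 \<in> W" using FW Fc(2) by blast
    have m1: "- 1 \<in> W" using FW Fc(2,5) by blast
    show "- x \<in> W" if "x \<in> W" for x using Wmult[OF m1 that] by simp
    show "inverse x \<in> W" if "x \<in> W" for x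
      using inverse_in_subring[of W x] Wadd Wmult FW F_facts(2) that by blast
  qed (use Wadd Wmult in auto)
  have "L \<subseteq> W" using L_sub[OF sub] FW F_facts x2W by blast
  moreover have "W \<subseteq> L"
  proof
    fix x assume "x \<in> W"
    then obtain u v w where "x = u * x2 ^ 2 + v * x2 + w" "u \<in> L" "v \<in> L" "w \<in> L"
      unfolding W_alt using F_facts(5) by blast
    then show "x \<in> L" using subfield_closed[OF subfield_L] P_in_L by (simp add: power2_eq_square)
  qed
  ultimately have "W = L" by blast
  then show ?thesis using dim by (simp add: has_degree_def numeral_3_eq_3)
qed

lemma torsion_field_degree:
  "(\<not> [p = 1] (mod 3) \<longrightarrow> L = F) \<and> ([p = 1] (mod 3) \<longrightarrow> has_degree L F 1 \<or> has_degree L F 3)"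
proof (cases "x2 \<in> F")
  case True
  then show ?thesis using L_eq_F degree_1 by blast
next
  case False
  then have "[p = 1] (mod 3)" using conjugates cong_1_mod_3 by metis
  then show ?thesis using degree_3[OF False] by blast
qed

end

theorem theorem4p9:
  fixes K :: "'a :: field_char_0 set" and E :: "'a weierstrass" and p :: nat
    and x1 y1 x2 y2 \<zeta> :: 'a
  assumes "number_field K"
    and "algebraic_closure (ambient :: 'a ring) K"
    and "elliptic_curve_over K E"
    and "prime p" and "p \<ge> 5"
    and "torsion_basis E p (Affine x1 y1) (Affine x2 y2)"
    and "\<forall>\<sigma>\<in>Gal (torsion_field K E p) K. \<exists>a b c :: nat. coprime a p \<and> coprime c p
           \<and> map_point \<sigma> (Affine x1 y1) = point_mult E a (Affine x1 y1)
           \<and> map_point \<sigma> (Affine x2 y2)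
               = point_add E (point_mult E b (Affine x1 y1)) (point_mult E c (Affine x2 y2))"
    and "primitive_root_of_unity p \<zeta>"
  shows "(\<not> [p = 1] (mod 3) \<longrightarrow> torsion_field K E p = adjoin K {\<zeta>, y2})
       \<and> ([p = 1] (mod 3) \<longrightarrow>
            has_degree (torsion_field K E p) (adjoin K {\<zeta>, y2}) 1
          \<or> has_degree (torsion_field K E p) (adjoin K {\<zeta>, y2}) 3)"
proof -
  have "borel_torsion K E p x1 y1 x2 y2 \<zeta>"
    unfolding borel_torsion_def borel_torsion_axioms_def closed_over_def using assms by blast
  then interpret borel_torsion K E p x1 y1 x2 y2 \<zeta> .
  show ?thesis by (rule torsion_field_degree)
qed

end
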